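(* Let $\Omega\Subset\mathbb{R}^2$ be a bounded Lipschitz domain containing a corner with vertex $0\in\partial\Omega$, i.e. $\Omega\cap B_h=W\cap B_h=S_h$ for a sufficiently small $h\in\mathbb{R}_+$. Let $V\in L^\infty(\Omega)$, $q:=1+V$, $k\in\mathbb{R}_+$, and let $v,w\in H^1(\Omega)$ be a pair of interior transmission eigenfunctions, i.e. nontrivial solutions of $$\Delta w+k^2(1+V)w=0\text{ in }\Omega,\qquad \Delta v+k^2v=0\text{ in }\Omega,\qquad w=v,\ \ \partial_\nu v=\partial_\nu w\ \text{ on }\partial\Omega.$$ Assume that $v-w\in H^2(\Sigma_{\Lambda_h})$ and $qw\in C^\alpha(\overline{S_h})$ for some $0<\alpha<1$, that $-\pi<\theta_m<\theta_M<\pi$ and $\theta_M-\theta_m\neq\pi$, and that $v$ can be approximated in $H^1(S_h)$ by Herglotz functions $v_j$, $j=1,2,\ldots$, with kernels $g_j$ satisfying $$\|v-v_j\|_{H^1(S_h)}\le j^{-2-\Upsilon},\qquad \|g_j\|_{L^2(\mathbb{S}^1)}\le Cj^{\varrho}$$ for some constants $C>0$, $\Upsilon>0$ and $0<\varrho<\alpha$. Then $$\lim_{\rho\to+0}\frac{1}{m(B(0,\rho)\cap\Omega)}\int_{B(0,\rho)\cap\Omega}V(x)w(x)\,\mathrm{d}x=0,$$ where $m(\cdot)$ denotes the area.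
   Context: $\nu$ is the exterior unit normal to $\partial\Omega$. For $h>0$, $B_h=B(0,h)$ is the open disc of radius $h$ centered at $0$ in $\mathbb{R}^2$. The sector is $W=\{x\in\mathbb{R}^2: x\neq0,\ \theta_m<\arg(x_1+ix_2)<\theta_M\}$ with $-\pi<\theta_m<\theta_M<\pi$. Set $S_h=W\cap B_h$, $\Lambda_h=W\cap\partial B_h$, $\Sigma_{\Lambda_h}=S_h\setminus S_{h/2}$. The Herglotz wave function with kernel $g_j\in L^2(\mathbb{S}^1)$ is $v_j(x)=\int_{\mathbb{S}^1}e^{ik\xi\cdot x}g_j(\xi)\,\mathrm{d}\sigma(\xi)$, $x\in\mathbb{R}^2$. *)

theory Defs
  imports "HOL-Analysis.Analysis"
begin

section \<open>Smooth functions and test functions\<close>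

definition partial :: "'n::finite \<Rightarrow> (real ^ 'n \<Rightarrow> 'b::real_normed_vector) \<Rightarrow> real ^ 'n \<Rightarrow> 'b" where
  "partial i f x = frechet_derivative f (at x) (axis i 1)"

primrec iter_partial ::
    "'n::finite list \<Rightarrow> (real ^ 'n \<Rightarrow> 'b::real_normed_vector) \<Rightarrow> real ^ 'n \<Rightarrow> 'b" where
  "iter_partial [] f = f"
| "iter_partial (i # is) f = partial i (iter_partial is f)"

definition smooth :: "(real ^ 'n::finite \<Rightarrow> 'b::real_normed_vector) \<Rightarrow> bool" where
  "smooth f \<longleftrightarrow> (\<forall>is x. iter_partial is f differentiable (at x))"

definition laplacian :: "(real ^ 'n::finite \<Rightarrow> 'b::real_normed_vector) \<Rightarrow> real ^ 'n \<Rightarrow> 'b" where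
  "laplacian f x = (\<Sum>i\<in>UNIV. partial i (partial i f) x)"

definition test_function :: "(real ^ 'n::finite) set \<Rightarrow> (real ^ 'n \<Rightarrow> complex) \<Rightarrow> bool" where
  "test_function U \<phi> \<longleftrightarrow>
     smooth \<phi> \<and> compact (closure {x. \<phi> x \<noteq> 0}) \<and> closure {x. \<phi> x \<noteq> 0} \<subseteq> U"


section \<open>Lebesgue and Sobolev spaces\<close>

text \<open>Elements of function spaces are represented by functions on the whole space, of which only
  the values almost everywhere on the given set matter.\<close>

definition L2_on :: "'a measure \<Rightarrow> 'a set \<Rightarrow> ('a \<Rightarrow> complex) \<Rightarrow> bool" where
  "L2_on M S f \<longleftrightarrow> set_borel_measurable M S f \<and> set_integrable M S (\<lambda>x. (norm (f x))\<^sup>2)"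

definition L2_norm_on :: "'a measure \<Rightarrow> 'a set \<Rightarrow> ('a \<Rightarrow> complex) \<Rightarrow> real" where
  "L2_norm_on M S f = sqrt (LINT x:S|M. (norm (f x))\<^sup>2)"

definition Linfty_on :: "'a measure \<Rightarrow> 'a set \<Rightarrow> ('a \<Rightarrow> complex) \<Rightarrow> bool" where
  "Linfty_on M S f \<longleftrightarrow>
     set_borel_measurable M S f \<and> (\<exists>K. AE x in M. x \<in> S \<longrightarrow> norm (f x) \<le> K)"

definition has_weak_partial ::
    "(real ^ 'n::finite) set \<Rightarrow> 'n \<Rightarrow> (real ^ 'n \<Rightarrow> complex) \<Rightarrow> (real ^ 'n \<Rightarrow> complex) \<Rightarrow> bool" where
  "has_weak_partial U i u g \<longleftrightarrow>
     (\<forall>\<phi>. test_function U \<phi> \<longrightarrow>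
        (LINT x:U|lebesgue. u x * partial i \<phi> x) = - (LINT x:U|lebesgue. g x * \<phi> x))"

text \<open>The space \<open>H\<^sup>m(U) = W\<^sup>m\<^sup>,\<^sup>2(U)\<close> on an open set \<open>U\<close>.\<close>

primrec sobolev :: "nat \<Rightarrow> (real ^ 'n::finite) set \<Rightarrow> (real ^ 'n \<Rightarrow> complex) \<Rightarrow> bool" where
  "sobolev 0 U u \<longleftrightarrow> L2_on lebesgue U u"
| "sobolev (Suc m) U u \<longleftrightarrow>
     L2_on lebesgue U u \<and> (\<forall>i. \<exists>g. has_weak_partial U i u g \<and> sobolev m U g)"

text \<open>The weak partial derivative of an \<open>H\<^sup>1\<close> function, which is unique up to null sets.\<close>

definition weak_partial ::
    "(real ^ 'n::finite) set \<Rightarrow> 'n \<Rightarrow> (real ^ 'n \<Rightarrow> complex) \<Rightarrow> real ^ 'n \<Rightarrow> complex" where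
  "weak_partial U i u = (SOME g. has_weak_partial U i u g \<and> L2_on lebesgue U g)"

definition H1_norm :: "(real ^ 'n::finite) set \<Rightarrow> (real ^ 'n \<Rightarrow> complex) \<Rightarrow> real" where
  "H1_norm U u =
     sqrt ((L2_norm_on lebesgue U u)\<^sup>2 + (\<Sum>i\<in>UNIV. (L2_norm_on lebesgue U (weak_partial U i u))\<^sup>2))"

definition has_weak_laplacian ::
    "(real ^ 'n::finite) set \<Rightarrow> (real ^ 'n \<Rightarrow> complex) \<Rightarrow> (real ^ 'n \<Rightarrow> complex) \<Rightarrow> bool" where
  "has_weak_laplacian U u f \<longleftrightarrow>
     L2_on lebesgue U u \<and> L2_on lebesgue U f \<and>
     (\<forall>\<phi>. test_function U \<phi> \<longrightarrow>
        (LINT x:U|lebesgue. u x * laplacian \<phi> x) = (LINT x:U|lebesgue. f x * \<phi> x))"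

text \<open>Membership of a class of functions modulo null sets in \<open>C\<^sup>\<alpha>\<close> of the closure of the open
  set \<open>U\<close>: some representative of the class is bounded and Hoelder continuous there.\<close>

definition holder_closure :: "real \<Rightarrow> (real ^ 'n::finite) set \<Rightarrow> (real ^ 'n \<Rightarrow> complex) \<Rightarrow> bool" where
  "holder_closure \<alpha> U u \<longleftrightarrow>
     (\<exists>f. (AE x in lebesgue. x \<in> U \<longrightarrow> f x = u x) \<and>
          bounded (f ` closure U) \<and>
          (\<exists>K. \<forall>x\<in>closure U. \<forall>y\<in>closure U. norm (f x - f y) \<le> K * dist x y powr \<alpha>))"


section \<open>Lipschitz domains and boundary values in the plane\<close>

definition lipschitz_domain :: "(real ^ 2) set \<Rightarrow> bool" where
  "lipschitz_domain \<Omega> \<longleftrightarrow>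
     open \<Omega> \<and> connected \<Omega> \<and> \<Omega> \<noteq> {} \<and>
     (\<forall>p\<in>frontier \<Omega>. \<exists>e1 e2 r L \<gamma>.
        norm e1 = 1 \<and> norm e2 = 1 \<and> e1 \<bullet> e2 = 0 \<and> 0 < r \<and>
        L-lipschitz_on UNIV (\<gamma> :: real \<Rightarrow> real) \<and>
        (\<forall>x\<in>ball p r. x \<in> \<Omega> \<longleftrightarrow> \<gamma> ((x - p) \<bullet> e1) < (x - p) \<bullet> e2))"

text \<open>One-dimensional Hausdorff measure; on a Lipschitz curve it is arc length.\<close>

definition hausdorff1_pre :: "real \<Rightarrow> 'a::metric_space set \<Rightarrow> ennreal" where
  "hausdorff1_pre \<delta> A =
     (INF U \<in> {U :: nat \<Rightarrow> 'a set. A \<subseteq> (\<Union>n. U n) \<and> (\<forall>n. bounded (U n) \<and> diameter (U n) \<le> \<delta>)}.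
        \<Sum>n. ennreal (diameter (U n)))"

definition hausdorff1_outer :: "'a::metric_space set \<Rightarrow> ennreal" where
  "hausdorff1_outer A = (SUP \<delta>\<in>{0<..}. hausdorff1_pre \<delta> A)"

definition hausdorff1 :: "'a::metric_space measure" where
  "hausdorff1 = measure_of UNIV (sets borel) hausdorff1_outer"

text \<open>\<open>hausdorff1_outer\<close> is a metric outer measure, so that \<open>measure_of\<close> above is not the trivial
  measure it falls back to otherwise.\<close>

lemma hausdorff1_pre_mono: "A \<subseteq> B \<Longrightarrow> hausdorff1_pre \<delta> A \<le> hausdorff1_pre \<delta> B"
  unfolding hausdorff1_pre_def by (rule INF_superset_mono) auto

lemma hausdorff1_pre_antimono: "\<delta> \<le> \<delta>' \<Longrightarrow> hausdorff1_pre \<delta>' A \<le> hausdorff1_pre \<delta> A"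
  unfolding hausdorff1_pre_def by (rule INF_superset_mono) (auto intro: order_trans)

lemma hausdorff1_outer_mono: "A \<subseteq> B \<Longrightarrow> hausdorff1_outer A \<le> hausdorff1_outer B"
  unfolding hausdorff1_outer_def by (rule SUP_mono') (rule hausdorff1_pre_mono)

lemma hausdorff1_outer_empty: "hausdorff1_outer {} = 0"
proof -
  have "hausdorff1_pre \<delta> ({}::'a set) \<le> 0" if "0 < \<delta>" for \<delta> :: real
    unfolding hausdorff1_pre_def
    by (rule INF_lower2[of "\<lambda>_. {}"]) (use that in auto)
  then have "hausdorff1_outer ({}::'a set) \<le> 0"
    unfolding hausdorff1_outer_def by (intro SUP_least) auto
  then show ?thesis by simp
qed

lemma hausdorff1_pre_less:
  "hausdorff1_pre \<delta> A < c \<Longrightarrow> \<exists>U :: nat \<Rightarrow> 'a::metric_space set. A \<subseteq> (\<Union>n. U n) \<and>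
     (\<forall>n. bounded (U n) \<and> diameter (U n) \<le> \<delta>) \<and> (\<Sum>n. ennreal (diameter (U n))) < c"
  unfolding hausdorff1_pre_def INF_less_iff by blast

lemma hausdorff1_pre_UN: "hausdorff1_pre \<delta> (\<Union>n. A n) \<le> (\<Sum>n. hausdorff1_pre \<delta> (A n))"
proof (rule ennreal_le_epsilon)
  fix e :: real assume e: "0 < e" "(\<Sum>n. hausdorff1_pre \<delta> (A n)) < top"
  have "hausdorff1_pre \<delta> (A n) < hausdorff1_pre \<delta> (A n) + e * (1/2)^Suc n" for n
    using e by (auto simp add: less_top dest!: ennreal_suminf_lessD)
  from hausdorff1_pre_less[OF this]
  have "\<forall>n. \<exists>U :: nat \<Rightarrow> 'a set. A n \<subseteq> (\<Union>i. U i) \<and> (\<forall>i. bounded (U i) \<and> diameter (U i) \<le> \<delta>) \<and>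
      (\<Sum>i. ennreal (diameter (U i))) < hausdorff1_pre \<delta> (A n) + e * (1/2)^Suc n" by blast
  then obtain U :: "nat \<Rightarrow> nat \<Rightarrow> 'a set" where U: "\<And>n. A n \<subseteq> (\<Union>i. U n i)"
      "\<And>n i. bounded (U n i)" "\<And>n i. diameter (U n i) \<le> \<delta>"
      "\<And>n. (\<Sum>i. ennreal (diameter (U n i))) < hausdorff1_pre \<delta> (A n) + e * (1/2)^Suc n"
    by metis
  define W where "W m = (case prod_decode m of (n, i) \<Rightarrow> U n i)" for m
  have "(\<Union>n. A n) \<subseteq> (\<Union>m. W m)"
  proof
    fix x assume "x \<in> (\<Union>n. A n)"
    then obtain n where "x \<in> A n" by auto
    then obtain i where "x \<in> U n i" using U(1) by blast
    then have "x \<in> W (prod_encode (n, i))" by (simp add: W_def)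
    then show "x \<in> (\<Union>m. W m)" by blast
  qed
  moreover have "bounded (W m) \<and> diameter (W m) \<le> \<delta>" for m
    by (simp add: W_def U(2,3) split: prod.split)
  ultimately have "hausdorff1_pre \<delta> (\<Union>n. A n) \<le> (\<Sum>m. ennreal (diameter (W m)))"
    unfolding hausdorff1_pre_def by (intro INF_lower) blast
  also have "\<dots> = (\<Sum>n. \<Sum>i. ennreal (diameter (U n i)))"
    using suminf_ennreal_2dimen[of "\<lambda>n. (\<Sum>i. ennreal (diameter (U n i)))"
        "\<lambda>(n, i). ennreal (diameter (U n i))"]
    by (simp add: W_def comp_def case_prod_unfold)
  also have "\<dots> \<le> (\<Sum>n. hausdorff1_pre \<delta> (A n) + e * (1/2)^Suc n)"
    by (intro suminf_le less_imp_le U) auto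
  also have "\<dots> = (\<Sum>n. hausdorff1_pre \<delta> (A n)) + (\<Sum>n. ennreal (e * (1/2)^Suc n))"
    by (rule suminf_add[symmetric]) auto
  also have "(\<Sum>n. ennreal (e * (1/2)^Suc n)) = ennreal e"
    using e by (intro suminf_ennreal_eq) (auto intro: sums_mult[OF power_half_series, of e, simplified])
  finally show "hausdorff1_pre \<delta> (\<Union>n. A n) \<le> (\<Sum>n. hausdorff1_pre \<delta> (A n)) + ennreal e" .
qed

lemma hausdorff1_outer_UN: "hausdorff1_outer (\<Union>n. A n) \<le> (\<Sum>n. hausdorff1_outer (A n))"
  unfolding hausdorff1_outer_def[of "\<Union>n. A n"]
proof (rule SUP_least)
  fix \<delta> :: real assume "\<delta> \<in> {0<..}"
  then have "hausdorff1_pre \<delta> (A n) \<le> hausdorff1_outer (A n)" for n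
    unfolding hausdorff1_outer_def by (rule SUP_upper)
  then have "(\<Sum>n. hausdorff1_pre \<delta> (A n)) \<le> (\<Sum>n. hausdorff1_outer (A n))"
    by (intro suminf_le) auto
  then show "hausdorff1_pre \<delta> (\<Union>n. A n) \<le> (\<Sum>n. hausdorff1_outer (A n))"
    using hausdorff1_pre_UN order_trans by blast
qed

lemma outer_measure_space_hausdorff1: "outer_measure_space (Pow UNIV) hausdorff1_outer"
  by (auto simp: outer_measure_space_def positive_def increasing_def countably_subadditive_def
      hausdorff1_outer_empty hausdorff1_outer_mono hausdorff1_outer_UN)

lemma hausdorff1_outer_Un: "hausdorff1_outer (A \<union> B) \<le> hausdorff1_outer A + hausdorff1_outer B"
proof -
  have "hausdorff1_outer (A \<union> B) = hausdorff1_outer (\<Union>n. binaryset A B n)"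
    by (simp add: UN_binaryset_eq)
  also have "\<dots> \<le> (\<Sum>n. hausdorff1_outer (binaryset A B n))" by (rule hausdorff1_outer_UN)
  also have "\<dots> = hausdorff1_outer A + hausdorff1_outer B"
    by (rule suminf_binaryset_eq) (rule hausdorff1_outer_empty)
  finally show ?thesis .
qed

lemma hausdorff1_pre_separated:
  assumes d: "\<And>x y. x \<in> A \<Longrightarrow> y \<in> B \<Longrightarrow> d \<le> dist x y" and \<delta>: "0 < \<delta>" "\<delta> < d"
  shows "hausdorff1_pre \<delta> A + hausdorff1_pre \<delta> B \<le> hausdorff1_pre \<delta> (A \<union> B)"
  unfolding hausdorff1_pre_def[of \<delta> "A \<union> B"]
proof (rule INF_greatest, clarsimp)
  fix U :: "nat \<Rightarrow> 'a set"
  assume U: "A \<subseteq> (\<Union>n. U n)" "B \<subseteq> (\<Union>n. U n)" "\<forall>n. bounded (U n) \<and> diameter (U n) \<le> \<delta>"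
  define P where "P n = (if U n \<inter> A = {} then {} else U n)" for n
  define Q where "Q n = (if U n \<inter> B = {} then {} else U n)" for n
  have P: "A \<subseteq> (\<Union>n. P n)"
  proof
    fix x assume x: "x \<in> A"
    then obtain n where "x \<in> U n" using U by blast
    then have "x \<in> P n" using x by (auto simp: P_def)
    then show "x \<in> (\<Union>n. P n)" by blast
  qed
  have "bounded (P n) \<and> diameter (P n) \<le> \<delta>" for n
    using U(3) \<delta> by (simp add: P_def)
  then have leP: "hausdorff1_pre \<delta> A \<le> (\<Sum>n. ennreal (diameter (P n)))"
    unfolding hausdorff1_pre_def using P by (intro INF_lower) blast
  have Q: "B \<subseteq> (\<Union>n. Q n)"
  proof
    fix x assume x: "x \<in> B"
    then obtain n where "x \<in> U n" using U by blast
    then have "x \<in> Q n" using x by (auto simp: Q_def)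
    then show "x \<in> (\<Union>n. Q n)" by blast
  qed
  have "bounded (Q n) \<and> diameter (Q n) \<le> \<delta>" for n
    using U(3) \<delta> by (simp add: Q_def)
  then have leQ: "hausdorff1_pre \<delta> B \<le> (\<Sum>n. ennreal (diameter (Q n)))"
    unfolding hausdorff1_pre_def using Q by (intro INF_lower) blast
  have "ennreal (diameter (P n)) + ennreal (diameter (Q n)) \<le> ennreal (diameter (U n))" for n
  proof (cases "U n \<inter> A = {} \<or> U n \<inter> B = {}")
    case True
    then show ?thesis by (auto simp: P_def Q_def)
  next
    case False
    then obtain x y where "x \<in> U n" "x \<in> A" "y \<in> U n" "y \<in> B" by blast
    then have "d \<le> \<delta>" using d[of x y] diameter_bounded_bound[of "U n" x y] U(3)
      by (meson order_trans)
    then show ?thesis using \<delta> by simp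
  qed
  then have "(\<Sum>n. ennreal (diameter (P n))) + (\<Sum>n. ennreal (diameter (Q n)))
      \<le> (\<Sum>n. ennreal (diameter (U n)))"
    by (subst suminf_add) (auto intro!: suminf_le)
  then show "hausdorff1_pre \<delta> A + hausdorff1_pre \<delta> B \<le> (\<Sum>n. ennreal (diameter (U n)))"
    using add_mono[OF leP leQ] by (rule order_trans[rotated])
qed

lemma hausdorff1_outer_separated:
  assumes d: "\<And>x y. x \<in> A \<Longrightarrow> y \<in> B \<Longrightarrow> d \<le> dist x y" and "0 < d"
  shows "hausdorff1_outer A + hausdorff1_outer B \<le> hausdorff1_outer (A \<union> B)"
proof -
  have "hausdorff1_outer A + hausdorff1_outer B
      = (SUP \<delta>\<in>{0<..}. hausdorff1_pre \<delta> A + hausdorff1_pre \<delta> B)"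
    unfolding hausdorff1_outer_def
  proof (rule SUP_add_directed_ennreal[symmetric])
    fix i j :: real assume "i \<in> {0<..}" "j \<in> {0<..}"
    then show "\<exists>k\<in>{0<..}. hausdorff1_pre i A + hausdorff1_pre j B
        \<le> hausdorff1_pre k A + hausdorff1_pre k B"
      by (intro bexI[of _ "min i j"] add_mono hausdorff1_pre_antimono) auto
  qed
  also have "\<dots> \<le> hausdorff1_outer (A \<union> B)"
  proof (rule SUP_least)
    fix \<delta> :: real assume "\<delta> \<in> {0<..}"
    define \<epsilon> where "\<epsilon> = min \<delta> (d / 2)"
    have \<epsilon>: "0 < \<epsilon>" "\<epsilon> \<le> \<delta>" "\<epsilon> < d"
      using \<open>\<delta> \<in> {0<..}\<close> \<open>0 < d\<close> by (auto simp: \<epsilon>_def)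
    have "hausdorff1_pre \<delta> A + hausdorff1_pre \<delta> B \<le> hausdorff1_pre \<epsilon> A + hausdorff1_pre \<epsilon> B"
      using \<epsilon> by (intro add_mono hausdorff1_pre_antimono)
    also have "\<dots> \<le> hausdorff1_pre \<epsilon> (A \<union> B)"
      using d \<epsilon> by (intro hausdorff1_pre_separated) auto
    also have "\<dots> \<le> hausdorff1_outer (A \<union> B)"
      unfolding hausdorff1_outer_def using \<epsilon> by (intro SUP_upper) auto
    finally show "hausdorff1_pre \<delta> A + hausdorff1_pre \<delta> B \<le> hausdorff1_outer (A \<union> B)" .
  qed
  finally show ?thesis .
qed

lemma hausdorff1_outer_closed:
  fixes C :: "'a::metric_space set"
  assumes C: "closed C" "C \<noteq> {}"
  shows "hausdorff1_outer (A \<inter> C) + hausdorff1_outer (A - C) \<le> hausdorff1_outer A"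
proof (cases "hausdorff1_outer A = top")
  case False
  let ?H = "hausdorff1_outer :: 'a set \<Rightarrow> ennreal"
  define E where "E k = {x \<in> A. 1 / (real k + 1) \<le> infdist x C}" for k
  define R where "R k = E (Suc k) - E k" for k
  have sep: "?H X + ?H Y \<le> ?H (X \<union> Y)"
    if "\<And>x. x \<in> X \<Longrightarrow> infdist x C \<le> a" "\<And>y. y \<in> Y \<Longrightarrow> b \<le> infdist y C" "a < b" for X Y a b
  proof (rule hausdorff1_outer_separated[of _ _ "b - a"])
    fix x y assume "x \<in> X" "y \<in> Y"
    then show "b - a \<le> dist x y"
      using that(1)[of x] that(2)[of y] infdist_triangle[of y C x] by (simp add: dist_commute)
  qed (use that in auto)
  have sum_le: "(\<Sum>j<m. ?H (R (2 * j + p))) \<le> ?H (\<Union>j<m. R (2 * j + p))" for m p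
  proof (induction m)
    case (Suc m)
    have "(\<Sum>j<Suc m. ?H (R (2 * j + p)))
        \<le> ?H (R (2 * m + p)) + ?H (\<Union>j<m. R (2 * j + p))"
      using Suc by (simp add: add.commute add_left_mono)
    also have "\<dots> \<le> ?H (R (2 * m + p) \<union> (\<Union>j<m. R (2 * j + p)))"
    proof (cases "m = 0")
      case False
      show ?thesis
      proof (rule sep)
        show "infdist x C \<le> 1 / (real (2 * m + p) + 1)" if "x \<in> R (2 * m + p)" for x
          using that by (auto simp: R_def E_def)
        show "1 / real (2 * m + p) \<le> infdist y C" if y: "y \<in> (\<Union>j<m. R (2 * j + p))" for y
        proof -
          from y obtain j where j: "j < m" "y \<in> R (2 * j + p)" by auto
          then have "1 / (real (2 * j + p) + 2) \<le> infdist y C" by (auto simp: R_def E_def add_ac)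
          moreover have "1 / real (2 * m + p) \<le> 1 / (real (2 * j + p) + 2)"
            using j by (intro divide_left_mono) auto
          ultimately show ?thesis by linarith
        qed
        show "1 / (real (2 * m + p) + 1) < 1 / real (2 * m + p)"
          using False by (intro divide_strict_left_mono) auto
      qed
    qed (simp add: hausdorff1_outer_empty)
    also have "R (2 * m + p) \<union> (\<Union>j<m. R (2 * j + p)) = (\<Union>j<Suc m. R (2 * j + p))"
      by (auto simp: lessThan_Suc)
    finally show ?case .
  qed simp
  have sum_le': "(\<Sum>j<m. ?H (R (2 * j + p))) \<le> ?H A" for m p
    by (rule order_trans[OF sum_le hausdorff1_outer_mono]) (auto simp: R_def E_def)
  have "(\<Sum>n. ?H (R n)) \<le> ?H A + ?H A"
  proof (rule suminf_le_const)
    fix n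
    have *: "(\<Sum>i<2 * m. f i) = (\<Sum>j<m. f (2 * j)) + (\<Sum>j<m. f (2 * j + 1))"
      for m and f :: "nat \<Rightarrow> ennreal"
      by (induction m) (auto simp: algebra_simps)
    have "(\<Sum>i<n. ?H (R i)) \<le> (\<Sum>i<2 * n. ?H (R i))"
      by (intro sum_mono2) auto
    also have "\<dots> \<le> ?H A + ?H A"
      unfolding * using sum_le'[where m=n and p=0] sum_le'[where m=n and p=1] by (intro add_mono) simp_all
    finally show "(\<Sum>i<n. ?H (R i)) \<le> ?H A + ?H A" .
  qed simp
  then have T: "(\<Sum>n. ?H (R n)) \<noteq> top"
    using False by (auto simp: top_unique ennreal_add_eq_top)
  then have fin: "?H (R n) \<noteq> top" for n
    using ennreal_suminf_lessD less_top by metis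
  define r where "r n = enn2real (?H (R n))" for n
  have r: "?H (R n) = ennreal (r n)" "0 \<le> r n" for n
    using fin by (simp_all add: r_def less_top)
  have sr: "summable r"
    using T r by (intro summable_suminf_not_top) auto
  show ?thesis
  proof (rule ennreal_le_epsilon)
    fix e :: real assume "0 < e"
    obtain N where N: "\<And>n. n \<ge> N \<Longrightarrow> norm (\<Sum>i. r (i + n)) < e"
      using suminf_exist_split[OF \<open>0 < e\<close> sr] by blast
    have tail: "(\<Sum>i. ?H (R (i + N))) \<le> ennreal e"
    proof -
      have "(\<Sum>i. ?H (R (i + N))) = ennreal (\<Sum>i. r (i + N))"
        unfolding r using sr r(2) by (intro suminf_ennreal2) (auto simp: summable_iff_shift)
      also have "\<dots> \<le> ennreal e" using N[of N] by (intro ennreal_leI) auto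
      finally show ?thesis .
    qed
    have "A - C \<subseteq> E N \<union> (\<Union>i. R (i + N))"
    proof
      fix x assume x: "x \<in> A - C"
      then have "0 < infdist x C"
        using C by (simp add: infdist_pos_not_in_closed)
      then obtain k where k: "inverse (real (Suc k)) < infdist x C" using reals_Archimedean by blast
      have ex: "\<exists>k. x \<in> E k" using k x by (intro exI[of _ k]) (auto simp: E_def inverse_eq_divide add.commute)
      define k0 where "k0 = (LEAST k. x \<in> E k)"
      have k0: "x \<in> E k0" unfolding k0_def by (rule LeastI_ex[OF ex])
      have k1: "x \<notin> E j" if "j < k0" for j using that unfolding k0_def by (rule not_less_Least)
      have Emono: "E a \<subseteq> E b" if "a \<le> b" for a b
      proof -
        have "1 / (real b + 1) \<le> 1 / (real a + 1)" using that by (intro divide_left_mono) auto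
        then show ?thesis by (auto simp: E_def)
      qed
      show "x \<in> E N \<union> (\<Union>i. R (i + N))"
      proof (cases "k0 \<le> N")
        case True then show ?thesis using Emono k0 by blast
      next
        case False
        then obtain i where i: "k0 = Suc (i + N)" by (metis add.commute less_imp_Suc_add not_le)
        then have "x \<in> R (i + N)" using k0 k1[of "i + N"] by (simp add: R_def)
        then show ?thesis by blast
      qed
    qed
    then have "?H (A - C) \<le> ?H (E N \<union> (\<Union>i. R (i + N)))" by (rule hausdorff1_outer_mono)
    also have "\<dots> \<le> ?H (E N) + ?H (\<Union>i. R (i + N))" by (rule hausdorff1_outer_Un)
    also have "\<dots> \<le> ?H (E N) + ennreal e"
      using hausdorff1_outer_UN[of "\<lambda>i. R (i + N)"] tail by (intro add_left_mono) (rule order_trans)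
    finally have "?H (A \<inter> C) + ?H (A - C) \<le> (?H (A \<inter> C) + ?H (E N)) + ennreal e"
      by (simp add: add.assoc add_left_mono)
    also have "?H (A \<inter> C) + ?H (E N) \<le> ?H ((A \<inter> C) \<union> E N)"
      by (rule sep[of _ 0 _ "1 / (real N + 1)"]) (auto simp: E_def)
    also have "\<dots> \<le> ?H A" by (rule hausdorff1_outer_mono) (auto simp: E_def)
    finally show "?H (A \<inter> C) + ?H (A - C) \<le> ?H A + ennreal e" by (simp add: add_right_mono)
  qed
qed simp

lemma sets_hausdorff1: "sets hausdorff1 = sets borel"
  and space_hausdorff1: "space hausdorff1 = UNIV"
  using sets.sigma_sets_eq[of borel] by (simp_all add: hausdorff1_def)

lemma emeasure_hausdorff1:
  fixes A :: "'a::metric_space set"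
  assumes "A \<in> sets borel"
  shows "emeasure hausdorff1 A = hausdorff1_outer A"
proof -
  let ?H = "hausdorff1_outer :: 'a set \<Rightarrow> ennreal"
  let ?L = "lambda_system UNIV (Pow UNIV) ?H"
  interpret P: sigma_algebra UNIV "Pow (UNIV :: 'a set)" by (rule sigma_algebra_Pow)
  have ms: "measure_space UNIV ?L ?H"
    by (rule P.caratheodory_lemma[OF outer_measure_space_hausdorff1])
  then interpret L: sigma_algebra UNIV ?L by (simp add: measure_space_def)
  have closed: "C \<in> ?L" if "closed C" for C
  proof (cases "C = {}")
    case False
    have "?H (X \<inter> C) + ?H (X - C) = ?H X" for X
    proof (rule antisym)
      show "?H X \<le> ?H (X \<inter> C) + ?H (X - C)"
        using hausdorff1_outer_Un[of "X \<inter> C" "X - C"] by (simp add: Int_Diff_Un)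
    qed (rule hausdorff1_outer_closed[OF that False])
    then show ?thesis unfolding P.lambda_system_eq by blast
  qed (use L.empty_sets in blast)
  have "sets borel = sigma_sets UNIV (Collect closed :: 'a set set)"
    by (simp add: borel_eq_closed)
  also have "\<dots> \<subseteq> ?L"
    by (rule L.sigma_sets_subset) (use closed in auto)
  finally have sub: "sets (borel :: 'a measure) \<subseteq> ?L" .
  have "measure_space UNIV (sets (borel :: 'a measure)) ?H"
    using ms sub sets.sigma_algebra_axioms[of "borel :: 'a measure"]
    by (auto simp: measure_space_def positive_def countably_additive_def)
  then show ?thesis
    unfolding hausdorff1_def using assms
    by (intro emeasure_measure_of_sigma) (auto simp: measure_space_def)
qed

text \<open>\<open>g\<close> is the trace of \<open>u \<in> H\<^sup>1(\<Omega>)\<close>: the trace operator into \<open>L\<^sup>2(\<partial>\<Omega>)\<close> is the continuous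
  extension of the restriction map from functions smooth up to the boundary.\<close>

definition has_trace :: "(real ^ 2) set \<Rightarrow> (real ^ 2 \<Rightarrow> complex) \<Rightarrow> (real ^ 2 \<Rightarrow> complex) \<Rightarrow> bool" where
  "has_trace \<Omega> u g \<longleftrightarrow>
     sobolev 1 \<Omega> u \<and> L2_on hausdorff1 (frontier \<Omega>) g \<and>
     (\<exists>\<phi> :: nat \<Rightarrow> real ^ 2 \<Rightarrow> complex. (\<forall>n. smooth (\<phi> n)) \<and>
        (\<lambda>n. H1_norm \<Omega> (\<lambda>x. u x - \<phi> n x)) \<longlonglongrightarrow> 0 \<and>
        (\<lambda>n. L2_norm_on hausdorff1 (frontier \<Omega>) (\<lambda>x. g x - \<phi> n x)) \<longlonglongrightarrow> 0)"

text \<open>For \<open>u \<in> H\<^sup>1(\<Omega>)\<close> with \<open>\<Delta>u \<in> L\<^sup>2(\<Omega>)\<close> the exterior normal derivative is an element \<open>F\<close> of the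
  dual \<open>H\<^sup>-\<^sup>1\<^sup>/\<^sup>2(\<partial>\<Omega>)\<close> of the trace space, defined by Green's formula
  \<open>\<langle>F, g\<rangle> = \<integral>\<^sub>\<Omega> \<Delta>u \<phi> + \<nabla>u \<bullet> \<nabla>\<phi>\<close> for every \<open>\<phi> \<in> H\<^sup>1(\<Omega>)\<close> with trace \<open>g\<close>. For \<open>u\<close> smooth up to the
  boundary, \<open>\<langle>F, g\<rangle> = \<integral>\<^sub>\<partial>\<^sub>\<Omega> (\<nu> \<bullet> \<nabla>u) g\<close>. The values of \<open>F\<close> outside the trace space are irrelevant.\<close>

definition has_normal_derivative ::
    "(real ^ 2) set \<Rightarrow> (real ^ 2 \<Rightarrow> complex) \<Rightarrow> ((real ^ 2 \<Rightarrow> complex) \<Rightarrow> complex) \<Rightarrow> bool" where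
  "has_normal_derivative \<Omega> u F \<longleftrightarrow>
     sobolev 1 \<Omega> u \<and>
     (\<exists>f. has_weak_laplacian \<Omega> u f \<and>
       (\<forall>\<phi> g. has_trace \<Omega> \<phi> g \<longrightarrow>
          F g = (LINT x:\<Omega>|lebesgue.
                   f x * \<phi> x + (\<Sum>i\<in>UNIV. weak_partial \<Omega> i u x * weak_partial \<Omega> i \<phi> x))))"


section \<open>Interior transmission eigenfunctions\<close>

definition transmission_eigenfunctions ::
    "(real ^ 2) set \<Rightarrow> (real ^ 2 \<Rightarrow> complex) \<Rightarrow> real \<Rightarrow>
     (real ^ 2 \<Rightarrow> complex) \<Rightarrow> (real ^ 2 \<Rightarrow> complex) \<Rightarrow> bool" where
  "transmission_eigenfunctions \<Omega> V k v w \<longleftrightarrow>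
     sobolev 1 \<Omega> v \<and> sobolev 1 \<Omega> w \<and>
     \<not> (AE x in lebesgue. x \<in> \<Omega> \<longrightarrow> v x = 0 \<and> w x = 0) \<and>
     has_weak_laplacian \<Omega> w (\<lambda>x. - (complex_of_real (k\<^sup>2) * (1 + V x) * w x)) \<and>
     has_weak_laplacian \<Omega> v (\<lambda>x. - (complex_of_real (k\<^sup>2) * v x)) \<and>
     (\<exists>g. has_trace \<Omega> w g \<and> has_trace \<Omega> v g) \<and>
     (\<exists>F. has_normal_derivative \<Omega> v F \<and> has_normal_derivative \<Omega> w F)"


section \<open>Sectors and Herglotz waves\<close>

definition sector :: "real \<Rightarrow> real \<Rightarrow> (real ^ 2) set" where
  "sector \<theta>m \<theta>M =
     {x. x \<noteq> 0 \<and> \<theta>m < Arg (Complex (x $ 1) (x $ 2)) \<and> Arg (Complex (x $ 1) (x $ 2)) < \<theta>M}"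

definition S_sector :: "real \<Rightarrow> real \<Rightarrow> real \<Rightarrow> (real ^ 2) set" where
  "S_sector \<theta>m \<theta>M h = sector \<theta>m \<theta>M \<inter> ball 0 h"

definition Sigma_sector :: "real \<Rightarrow> real \<Rightarrow> real \<Rightarrow> (real ^ 2) set" where
  "Sigma_sector \<theta>m \<theta>M h = S_sector \<theta>m \<theta>M h - S_sector \<theta>m \<theta>M (h / 2)"

text \<open>Arc length on the unit circle, as a measure on the plane.\<close>

definition circle_measure :: "(real ^ 2) measure" where
  "circle_measure =
     distr (restrict_space lborel {0..<2 * pi}) borel (\<lambda>t. vector [cos t, sin t])"

lemma emeasure_circle_measure: "emeasure circle_measure (sphere 0 1) = ennreal (2 * pi)"
proof -
  have eq: "(\<lambda>t. vector [cos t, sin t] :: real ^ 2) = (\<lambda>t. \<chi> i. if i = 1 then cos t else sin t)"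
    by (auto simp: fun_eq_iff vec_eq_iff forall_2)
  have "continuous_on UNIV (\<lambda>t. vector [cos t, sin t] :: real ^ 2)"
    unfolding eq
  proof (intro continuous_on_vec_lambda)
    show "continuous_on UNIV (\<lambda>t :: real. if i = 1 then cos t else sin t)" for i :: 2
      by (cases "i = 1") (simp_all add: continuous_on_cos continuous_on_sin)
  qed
  then have m: "(\<lambda>t. vector [cos t, sin t] :: real ^ 2) \<in> borel_measurable (restrict_space lborel {0..<2 * pi})"
    by (intro measurable_restrict_space1) (simp add: borel_measurable_continuous_onI)
  have "norm (vector [cos t, sin t] :: real ^ 2) = 1" for t
    by (simp add: norm_vec_def L2_set_def sum_2)
  then have "(\<lambda>t. vector [cos t, sin t] :: real ^ 2) -` sphere 0 1 \<inter> {0..<2 * pi} = {0..<2 * pi}"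
    by auto
  then show ?thesis
    using m by (simp add: circle_measure_def emeasure_distr space_restrict_space emeasure_restrict_space)
qed

definition herglotz :: "real \<Rightarrow> (real ^ 2 \<Rightarrow> complex) \<Rightarrow> real ^ 2 \<Rightarrow> complex" where
  "herglotz k g x =
     (LINT \<xi>:sphere 0 1|circle_measure. exp (\<i> * complex_of_real (k * (\<xi> \<bullet> x))) * g \<xi>)"

end

theory Submission
  imports Defs
begin

text \<open>Write \<open>u = v - w\<close> and \<open>q = 1 + V\<close>. Equality of the Cauchy data means that
  \<open>\<integral> k\<^sup>2 (q w - v) \<phi> = - \<integral> \<nabla>u \<bullet> \<nabla>\<phi>\<close> over \<open>\<Omega>\<close> for every smooth \<open>\<phi>\<close>. Take for \<open>\<phi>\<close> a cutoff times the holomorphic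
  function \<open>U\<^sub>s = (1 + s z) ^ (-4)\<close>, which is as useful as an exponentially decaying complex
  geometrical optics solution: its pole \<open>- 1 / s\<close> stays outside the closed sector, \<open>U\<^sub>s\<close> and its gradient
  are \<open>O(s ^ (-4))\<close> away from the vertex, and \<open>s\<^sup>2 \<integral> U\<^sub>s\<close> over the sector tends to a multiple of
  \<open>exp (- 2 i \<theta>M) - exp (- 2 i \<theta>m)\<close>, which is not zero as \<open>\<theta>M - \<theta>m \<noteq> \<pi>\<close>. Since \<open>U\<^sub>s\<close> is holomorphic and \<open>u\<close>
  has zero trace on the two sides, the right-hand side is \<open>O(s ^ (-4))\<close>. Freezing \<open>q w\<close> and the Herglotz
  wave \<open>v\<^sub>j\<close> at the vertex and choosing \<open>s = j\<close>, one gets \<open>v\<^sub>j(0) \<longlonglongrightarrow> (q w)(0)\<close>. Hence the averages of \<open>q w\<close>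
  and of \<open>v\<close> have the same limit, while those of \<open>u\<close> tend to \<open>0\<close> by Poincare's inequality for functions
  vanishing on a side of the sector; and \<open>V w = q w - v + u\<close>.\<close>

section \<open>Smooth functions\<close>

text \<open>An exponential of a linear function decays only in a half plane, and the sector may be
  wider; a rational kernel needs just a pole outside the closed sector, and the negative real axis
  is always free. The exponent 4 is what the estimates consume: one factor \<open>1 + s r\<close>
  absorbs a Hoelder or Lipschitz error, and \<open>r (1 + s r) ^ (-3)\<close> still has integral
  \<open>O(s ^ (-2))\<close>, the size of the main term. Two obstacles shape the proof. First,
  \<open>v - w\<close> has zero trace only in the sense of approximation, so Green's formula is
  applied to smooth functions that converge to it with their gradients in L1 and whose boundary
  values tend to 0. Holomorphy makes the pairing of gradients a Cauchy-Riemann derivative, hence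
  only values on the sides enter and no normal derivatives; their factor may depend on
  \<open>s\<close>, because \<open>s\<close> is fixed in that limit. Second, the Lipschitz constants
  of the Herglotz waves may grow like \<open>j powr \<rho>v\<close>. Tying \<open>s\<close>, and
  later the inverse radius of the disc, to \<open>j\<close> turns this into
  \<open>j powr (\<rho>v - 1)\<close>, while the approximation error becomes
  \<open>j powr (- \<Upsilon> - 1)\<close>; both vanish.\<close>

fun diffk :: "nat \<Rightarrow> (real ^ 'n::finite \<Rightarrow> 'b::real_normed_vector) \<Rightarrow> bool" where
  "diffk 0 f \<longleftrightarrow> True"
| "diffk (Suc n) f \<longleftrightarrow> (\<forall>x. f differentiable (at x)) \<and> (\<forall>i. diffk n (partial i f))"

lemma iter_partial_append: "iter_partial (is @ js) f = iter_partial is (iter_partial js f)"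
  by (induction "is") auto

text \<open>\<open>diffk\<close> grades smoothness by order, so that closure under products,
  inverses and composition can go by induction on the order with the functions generalised. It
  strips the innermost derivative while \<open>iter_partial\<close> strips the outermost one, whence
  the word is split at its end.\<close>

lemma diffk_iff: "diffk n f \<longleftrightarrow> (\<forall>is x. length is < n \<longrightarrow> iter_partial is f differentiable (at x))"
proof (induction n arbitrary: f)
  case 0 then show ?case by simp
next
  case (Suc n)
  show ?case
  proof
    assume d: "diffk (Suc n) f"
    show "\<forall>is x. length is < Suc n \<longrightarrow> iter_partial is f differentiable (at x)"
    proof (intro allI impI)
      fix "is" :: "'a list" and x assume l: "length is < Suc n"
      show "iter_partial is f differentiable (at x)"
      proof (cases "is" rule: rev_cases)
        case Nil then show ?thesis using d by simp
      next
        case (snoc js i)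
        then show ?thesis using d l Suc.IH[of "partial i f"] by (simp add: iter_partial_append)
      qed
    qed
  next
    assume r: "\<forall>is x. length is < Suc n \<longrightarrow> iter_partial is f differentiable (at x)"
    have "iter_partial is (partial i f) differentiable (at x)" if "length is < n" for "is" i x
      using r[rule_format, of "is @ [i]" x] that by (simp add: iter_partial_append)
    then show "diffk (Suc n) f"
      using r[rule_format, of "[]"] Suc.IH by auto
  qed
qed

lemma smooth_iff_diffk: "smooth f \<longleftrightarrow> (\<forall>n. diffk n f)"
  unfolding smooth_def diffk_iff by blast

lemma smooth_differentiable: "smooth f \<Longrightarrow> f differentiable (at x)"
  unfolding smooth_iff_diffk using diffk.simps(2) by blast

lemma smooth_partial: "smooth f \<Longrightarrow> smooth (partial i f)"
  unfolding smooth_iff_diffk using diffk.simps(2) by blast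

lemma smooth_has_derivative: "smooth f \<Longrightarrow> (f has_derivative frechet_derivative f (at x)) (at x)"
  using smooth_differentiable frechet_derivative_works by blast

lemma partial_eqI: "(f has_derivative D) (at x) \<Longrightarrow> partial i f x = D (axis i 1)"
  unfolding partial_def using frechet_derivative_at by metis

lemma smooth_continuous_on: "smooth f \<Longrightarrow> continuous_on S f"
  by (meson continuous_at_imp_continuous_on differentiable_imp_continuous_within smooth_differentiable)

lemma diffk_Suc_imp: "diffk (Suc n) f \<Longrightarrow> diffk n f"
  unfolding diffk_iff by auto

lemma has_derivative_differentiable: "f differentiable (at x) \<Longrightarrow> (f has_derivative frechet_derivative f (at x)) (at x)"
  using frechet_derivative_works by blast

lemma diffk_const: "diffk n (\<lambda>x. c)"
proof (induction n arbitrary: c)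
  case (Suc n)
  have "partial i (\<lambda>x. c) = (\<lambda>x. 0)" for i :: 'a
    by (rule ext) (simp add: partial_def)
  then show ?case using Suc by simp
qed simp

lemma diffk_add: "diffk n f \<Longrightarrow> diffk n g \<Longrightarrow> diffk n (\<lambda>x. f x + g x)"
proof (induction n arbitrary: f g)
  case (Suc n)
  have "partial i (\<lambda>x. f x + g x) = (\<lambda>x. partial i f x + partial i g x)" for i
  proof
    fix x show "partial i (\<lambda>x. f x + g x) x = partial i f x + partial i g x"
      by (rule partial_eqI[THEN trans], rule has_derivative_add)
        (use Suc.prems in \<open>auto intro!: has_derivative_differentiable simp: partial_def\<close>)
  qed
  then show ?case using Suc by (auto intro!: differentiable_add)
qed simp

lemma partial_mult:
  fixes f g :: "real ^ 'n::finite \<Rightarrow> 'b::real_normed_algebra"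
  assumes "f differentiable (at x)" "g differentiable (at x)"
  shows "partial i (\<lambda>x. f x * g x) x = partial i f x * g x + f x * partial i g x"
  by (rule partial_eqI[THEN trans], rule has_derivative_mult)
    (use assms in \<open>auto intro!: has_derivative_differentiable simp: partial_def\<close>)

lemma diffk_mult:
  fixes f g :: "real ^ 'n::finite \<Rightarrow> 'b::real_normed_algebra"
  shows "diffk n f \<Longrightarrow> diffk n g \<Longrightarrow> diffk n (\<lambda>x. f x * g x)"
proof (induction n arbitrary: f g)
  case (Suc n)
  have "partial i (\<lambda>x. f x * g x) = (\<lambda>x. partial i f x * g x + f x * partial i g x)" for i
    using Suc.prems by (intro ext partial_mult) auto
  moreover have "diffk n (\<lambda>x. partial i f x * g x + f x * partial i g x)" for i
    using Suc.prems by (intro diffk_add Suc.IH diffk_Suc_imp[of n f] diffk_Suc_imp[of n g]) auto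
  ultimately show ?case using Suc.prems by (auto intro!: differentiable_mult)
qed simp

lemma partial_inverse:
  fixes f :: "real ^ 'n::finite \<Rightarrow> complex"
  assumes "f differentiable (at x)" "f x \<noteq> 0"
  shows "partial i (\<lambda>x. inverse (f x)) x = - (partial i f x * (inverse (f x) * inverse (f x)))"
  by (rule partial_eqI[THEN trans], rule Deriv.has_derivative_inverse)
    (use assms in \<open>auto intro!: has_derivative_differentiable simp: partial_def\<close>)

lemma diffk_inverse:
  fixes f :: "real ^ 'n::finite \<Rightarrow> complex"
  assumes nz: "\<And>x. f x \<noteq> 0"
  shows "diffk n f \<Longrightarrow> diffk n (\<lambda>x. inverse (f x))"
proof (induction n)
  case (Suc n)
  have d: "f differentiable (at x)" for x using Suc.prems by simp
  have "partial i (\<lambda>x. inverse (f x)) = (\<lambda>x. (- 1) * (partial i f x * (inverse (f x) * inverse (f x))))" for i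
    using d nz by (intro ext) (simp add: partial_inverse)
  moreover have "diffk n (\<lambda>x. (- 1) * (partial i f x * (inverse (f x) * inverse (f x))))" for i
    using Suc diffk_Suc_imp[OF Suc.prems] by (intro diffk_mult diffk_const Suc.IH) auto
  ultimately show ?case using d nz by (auto intro!: differentiable_inverse)
qed simp

lemma diffk_linear:
  assumes "bounded_linear f" shows "diffk n f"
proof (cases n)
  case (Suc m)
  have d: "(f has_derivative f) (at x)" for x by (rule bounded_linear_imp_has_derivative[OF assms])
  have "partial i f = (\<lambda>x. f (axis i 1))" for i using partial_eqI[OF d] by blast
  then show ?thesis using Suc d diffk_const by (auto simp: differentiable_def)
qed simp

lemma partial_chain:
  assumes "f differentiable (at x)" "(G has_vector_derivative G') (at (f x))"
  shows "partial i (\<lambda>x. G (f x)) x = partial i f x *\<^sub>R G'"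
proof -
  have "((\<lambda>x. G (f x)) has_derivative (\<lambda>t. frechet_derivative f (at x) t *\<^sub>R G')) (at x)"
    using has_derivative_compose[OF has_derivative_differentiable[OF assms(1)] assms(2)[unfolded has_vector_derivative_def]] .
  then show ?thesis by (simp add: partial_eqI) (simp add: partial_def)
qed

text \<open>The derivative of a composition with \<open>G m\<close> involves one with
  \<open>G (Suc m)\<close>; giving the whole chain of derivatives at once and generalising over
  \<open>m\<close> closes the induction.\<close>

lemma diffk_compose:
  fixes f :: "real ^ 'n::finite \<Rightarrow> real" and G :: "nat \<Rightarrow> real \<Rightarrow> real"
  assumes G: "\<And>m t. (G m has_real_derivative G (Suc m) t) (at t)"
  shows "diffk n f \<Longrightarrow> diffk n (\<lambda>x. G m (f x))"
proof (induction n arbitrary: m)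
  case (Suc n)
  have d: "f differentiable (at x)" for x using Suc.prems by simp
  have "partial i (\<lambda>x. G m (f x)) = (\<lambda>x. partial i f x * G (Suc m) (f x))" for i
    using partial_chain[OF d, of "G m"] G[unfolded has_real_derivative_iff_has_vector_derivative]
    by (intro ext) simp
  moreover have "diffk n (\<lambda>x. partial i f x * G (Suc m) (f x))" for i
    using Suc diffk_Suc_imp[OF Suc.prems] by (intro diffk_mult Suc.IH) auto
  moreover have "(\<lambda>x. G m (f x)) differentiable (at x)" for x
    using differentiable_chain_at[OF d, of "G m" x] G
    by (auto simp: o_def real_differentiable_def)
  ultimately show ?case using Suc.prems by simp
qed simp

lemma diffk_complex_of_real:
  "diffk n f \<Longrightarrow> diffk n (\<lambda>x. complex_of_real (f x))"
proof (induction n arbitrary: f)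
  case (Suc n)
  have d: "((\<lambda>x. complex_of_real (f x)) has_derivative (\<lambda>t. complex_of_real (frechet_derivative f (at x) t))) (at x)" for x
    using has_derivative_of_real[OF has_derivative_differentiable, of f x] Suc.prems by simp
  have "partial i (\<lambda>x. complex_of_real (f x)) = (\<lambda>x. complex_of_real (partial i f x))" for i
    using partial_eqI[OF d] by (intro ext) (simp add: partial_def)
  then show ?case using Suc d by (auto simp: differentiable_def)
qed simp

lemma smooth_const: "smooth (\<lambda>x. c)"
  and smooth_add: "smooth f \<Longrightarrow> smooth g \<Longrightarrow> smooth (\<lambda>x. f x + g x)"
  and smooth_linear: "bounded_linear f \<Longrightarrow> smooth f"
  by (simp_all add: smooth_iff_diffk diffk_const diffk_add diffk_linear)

lemma smooth_mult:
  fixes f g :: "real ^ 'n::finite \<Rightarrow> 'b::real_normed_algebra"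
  shows "smooth f \<Longrightarrow> smooth g \<Longrightarrow> smooth (\<lambda>x. f x * g x)"
  by (simp add: smooth_iff_diffk diffk_mult)

lemma smooth_power:
  fixes f :: "real ^ 'n::finite \<Rightarrow> 'b::real_normed_algebra_1"
  shows "smooth f \<Longrightarrow> smooth (\<lambda>x. f x ^ m)"
  by (induction m) (auto intro: smooth_const smooth_mult)

lemma smooth_inverse:
  fixes f :: "real ^ 'n::finite \<Rightarrow> complex"
  shows "(\<And>x. f x \<noteq> 0) \<Longrightarrow> smooth f \<Longrightarrow> smooth (\<lambda>x. inverse (f x))"
  by (simp add: smooth_iff_diffk diffk_inverse)

lemma smooth_diff:
  fixes f g :: "real ^ 'n::finite \<Rightarrow> complex"
  assumes "smooth f" "smooth g" shows "smooth (\<lambda>x. f x - g x)"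
  using smooth_add[OF assms(1) smooth_mult[OF smooth_const[of "-1"] assms(2)]] by simp

lemma smooth_prod:
  fixes f :: "'i \<Rightarrow> real ^ 'n::finite \<Rightarrow> 'b::{real_normed_algebra_1,comm_monoid_mult}"
  shows "(\<And>i. i \<in> I \<Longrightarrow> smooth (f i)) \<Longrightarrow> smooth (\<lambda>x. \<Prod>i\<in>I. f i x)"
  by (induction I rule: infinite_finite_induct) (auto intro!: smooth_const smooth_mult)

lemma smooth_of_real: "smooth f \<Longrightarrow> smooth (\<lambda>x. complex_of_real (f x))"
  by (simp add: smooth_iff_diffk diffk_complex_of_real)

lemma smooth_nth: "smooth (\<lambda>x. x $ i)"
  by (intro smooth_linear) (rule bounded_linear_vec_nth)

section \<open>Flat exponentials and smooth cutoffs\<close>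

lemma tendsto_poly_exp_minus: "((\<lambda>x. poly p x * exp (-x)) \<longlongrightarrow> (0::real)) at_top"
proof -
  have "((\<lambda>x. \<Sum>i\<le>degree p. coeff p i * (x ^ i / exp x)) \<longlongrightarrow> (\<Sum>i\<le>degree p. coeff p i * 0)) at_top"
    by (intro tendsto_sum tendsto_mult tendsto_const tendsto_power_div_exp_0)
  then show ?thesis
    by (simp add: poly_altdef sum_divide_distrib exp_minus divide_inverse[symmetric])
qed

text \<open>A class that contains \<open>exp (- 1 / t)\<close>, extended by 0, together with all its
  derivatives: it provides the chain of functions for \<open>diffk_compose\<close>.\<close>

definition flat_exp_poly :: "real poly \<Rightarrow> real \<Rightarrow> real" where
  "flat_exp_poly p t = (if t > 0 then poly p (1 / t) * exp (- 1 / t) else 0)"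

lemma tendsto_flat_exp_poly: "((\<lambda>t. poly p (1 / t) * exp (- 1 / t)) \<longlongrightarrow> (0::real)) (at_right 0)"
proof -
  have "filterlim (\<lambda>t::real. inverse t) at_top (at_right 0)"
    by (rule filterlim_inverse_at_top_right)
  from filterlim_compose[OF tendsto_poly_exp_minus this, of p]
  show ?thesis by (simp add: inverse_eq_divide)
qed

text \<open>With \<open>x = 1 / t\<close> the operator d/dt is \<open>- x\<^sup>2\<close> d/dx,
  which sends \<open>p x * exp (- x)\<close> to \<open>x\<^sup>2\<close> times
  \<open>(p - p') x * exp (- x)\<close>. At 0 the difference quotient belongs to the same class,
  with polynomial \<open>x * p\<close>, and the exponential beats the polynomial.\<close>

lemma flat_exp_poly_deriv:
  "(flat_exp_poly p has_real_derivative flat_exp_poly ([:0,0,1:] * (p - pderiv p)) t) (at t)"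
proof -
  consider "t > 0" | "t < 0" | "t = 0" by linarith
  then show ?thesis
  proof cases
    case 1
    have "((\<lambda>t. poly p (1 / t) * exp (- 1 / t)) has_real_derivative
        flat_exp_poly ([:0,0,1:] * (p - pderiv p)) t) (at t)"
      using 1 by (auto intro!: derivative_eq_intros poly_DERIV[THEN DERIV_chain2]
          simp: flat_exp_poly_def field_simps power2_eq_square)
    then show ?thesis
      by (rule has_field_derivative_transform_within_open[of _ _ _ "{0<..}"])
        (use 1 in \<open>auto simp: flat_exp_poly_def\<close>)
  next
    case 2
    have "((\<lambda>t. 0) has_real_derivative flat_exp_poly ([:0,0,1:] * (p - pderiv p)) t) (at t)"
      using 2 by (simp add: flat_exp_poly_def)
    then show ?thesis
      by (rule has_field_derivative_transform_within_open[of _ _ _ "{..<0}"])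
        (use 2 in \<open>auto simp: flat_exp_poly_def\<close>)
  next
    case 3
    have "((\<lambda>h. flat_exp_poly p h / h) \<longlongrightarrow> 0) (at 0)"
      
    proof (rule filterlim_split_at)
      have "\<forall>\<^sub>F h in at_left 0. flat_exp_poly p h / h = (0::real)"
        by (auto simp: flat_exp_poly_def eventually_at_filter intro!: always_eventually)
      then show "((\<lambda>h. flat_exp_poly p h / h) \<longlongrightarrow> 0) (at_left 0)"
        by (rule tendsto_eventually)
      have "\<forall>\<^sub>F h in at_right 0. poly ([:0,1:] * p) (1/h) * exp (- 1 / h) = flat_exp_poly p h / (h::real)"
        by (auto simp: flat_exp_poly_def eventually_at_filter intro!: always_eventually)
      then show "((\<lambda>h. flat_exp_poly p h / h) \<longlongrightarrow> 0) (at_right 0)"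
        by (rule tendsto_cong[THEN iffD1, OF _ tendsto_flat_exp_poly])
    qed
    then show ?thesis using 3 by (simp add: DERIV_def flat_exp_poly_def)
  qed
qed

definition flat_exp :: "real \<Rightarrow> real" where
  "flat_exp t = (if t > 0 then exp (- 1 / t) else 0)"

lemma smooth_flat_exp: "smooth f \<Longrightarrow> smooth (\<lambda>x. flat_exp (f x))"
proof -
  assume f: "smooth f"
  define Q where "Q m = ((\<lambda>p. [:0,0,1:] * (p - pderiv p)) ^^ m) [:1::real:]" for m
  have "diffk n (\<lambda>x. flat_exp_poly (Q 0) (f x))" for n
  proof (rule diffk_compose[of "\<lambda>m. flat_exp_poly (Q m)"])
    show "(flat_exp_poly (Q m) has_real_derivative flat_exp_poly (Q (Suc m)) t) (at t)" for m t
      using flat_exp_poly_deriv[of "Q m" t] by (simp add: Q_def)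
  qed (use f in \<open>simp add: smooth_iff_diffk\<close>)
  then show "smooth (\<lambda>x. flat_exp (f x))"
    by (simp add: smooth_iff_diffk Q_def flat_exp_poly_def[abs_def] flat_exp_def cong: if_cong)
qed

lemma flat_exp_pos_iff: "0 < flat_exp t \<longleftrightarrow> 0 < t"
  and flat_exp_nonneg: "0 \<le> flat_exp t"
  and flat_exp_eq_0_iff: "flat_exp t = 0 \<longleftrightarrow> t \<le> 0"
  and flat_exp_le_1: "flat_exp t \<le> 1"
  by (auto simp: flat_exp_def)

text \<open>The quotient \<open>A / (A + B)\<close> of two flat exponentials, \<open>A\<close>
  vanishing exactly for \<open>b \<le> f x\<close> and \<open>B\<close> exactly for
  \<open>f x \<le> a\<close>; as \<open>a < b\<close>, they never vanish together.\<close>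

lemma smooth_cutoff_exists:
  fixes f :: "real ^ 'n::finite \<Rightarrow> real"
  assumes "smooth f" "a < b"
  obtains \<eta> :: "real ^ 'n \<Rightarrow> complex"
  where "smooth \<eta>" "\<And>x. f x \<le> a \<Longrightarrow> \<eta> x = 1" "\<And>x. b \<le> f x \<Longrightarrow> \<eta> x = 0"
proof
  let ?A = "\<lambda>x. complex_of_real (flat_exp (b + - 1 * f x))"
  let ?B = "\<lambda>x. complex_of_real (flat_exp (f x + - a))"
  let ?\<eta> = "\<lambda>x. ?A x * inverse (?A x + ?B x)"
  have pos: "0 < flat_exp (b + - 1 * f x) + flat_exp (f x + - a)" for x
    using assms(2) flat_exp_pos_iff flat_exp_nonneg
    by (smt (verit, best))
  then have "?A x + ?B x \<noteq> 0" for x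
    by (metis less_irrefl of_real_add of_real_eq_0_iff)
  moreover have "smooth ?A" "smooth ?B"
    by (intro smooth_of_real smooth_flat_exp smooth_add smooth_const smooth_mult assms(1))+
  ultimately show "smooth ?\<eta>"
    by (intro smooth_mult smooth_inverse smooth_add)
  show "?\<eta> x = 1" if "f x \<le> a" for x
  proof -
    have B: "?B x = 0" using that by (simp add: flat_exp_eq_0_iff)
    have "flat_exp (b + - 1 * f x) \<noteq> 0" using that assms(2) by (simp add: flat_exp_eq_0_iff)
    then show ?thesis unfolding B by simp
  qed
  show "?\<eta> x = 0" if "b \<le> f x" for x
    using that by (simp add: flat_exp_eq_0_iff)
qed

section \<open>Square integrable functions\<close>

lemma L2_onD:
  assumes "L2_on M S f"
  shows "(\<lambda>x. indicator S x *\<^sub>R f x) \<in> borel_measurable M"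
    "integrable M (\<lambda>x. indicator S x *\<^sub>R (norm (f x))\<^sup>2)"
  using assms by (auto simp: L2_on_def set_borel_measurable_def set_integrable_def)

lemma L2_on_mult_integrable:
  assumes f: "L2_on M S f" and g: "L2_on M S g"
  shows "set_integrable M S (\<lambda>x. f x * g x)"
  unfolding set_integrable_def
proof (rule Bochner_Integration.integrable_bound)
  show "integrable M (\<lambda>x. indicator S x *\<^sub>R (norm (f x))\<^sup>2 + indicator S x *\<^sub>R (norm (g x))\<^sup>2)"
    by (intro Bochner_Integration.integrable_add L2_onD f g)
  have "(\<lambda>x. (indicator S x *\<^sub>R f x) * (indicator S x *\<^sub>R g x)) \<in> borel_measurable M"
    by (intro borel_measurable_times L2_onD f g)
  moreover have "(\<lambda>x. (indicator S x *\<^sub>R f x) * (indicator S x *\<^sub>R g x)) = (\<lambda>x. indicator S x *\<^sub>R (f x * g x))"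
    by (auto simp: indicator_def)
  ultimately show "(\<lambda>x. indicator S x *\<^sub>R (f x * g x)) \<in> borel_measurable M" by simp
  have "norm a * norm b \<le> (norm a)\<^sup>2 + (norm b)\<^sup>2" for a b :: complex
    using sum_squares_bound[of "norm a" "norm b"] mult_nonneg_nonneg[OF norm_ge_zero[of a] norm_ge_zero[of b]]
    unfolding mult.assoc by linarith
  then show "AE x in M. norm (indicator S x *\<^sub>R (f x * g x)) \<le>
      norm (indicator S x *\<^sub>R (norm (f x))\<^sup>2 + indicator S x *\<^sub>R (norm (g x))\<^sup>2)"
    by (intro always_eventually allI) (auto simp: indicator_def norm_mult)
qed

text \<open>The integral of \<open>(t * norm (f x) - norm (g x))\<^sup>2\<close> is nonnegative for
  every real \<open>t\<close>, and the best choice is \<open>t = I / A\<close>.\<close>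

lemma L2_on_Cauchy_Schwarz:
  assumes f: "L2_on M S f" and g: "L2_on M S g"
  shows "(LINT x:S|M. norm (f x) * norm (g x)) \<le> L2_norm_on M S f * L2_norm_on M S g"
proof -
  define A where "A = (LINT x:S|M. (norm (f x))\<^sup>2)"
  define B where "B = (LINT x:S|M. (norm (g x))\<^sup>2)"
  define I where "I = (LINT x:S|M. norm (f x) * norm (g x))"
  have fi: "set_integrable M S (\<lambda>x. (norm (f x))\<^sup>2)" and gi: "set_integrable M S (\<lambda>x. (norm (g x))\<^sup>2)"
    using f g by (auto simp: L2_on_def)
  have fgi: "set_integrable M S (\<lambda>x. norm (f x) * norm (g x))"
    using set_integrable_norm[OF L2_on_mult_integrable[OF f g]] by (simp add: norm_mult)
  have nn: "0 \<le> A" "0 \<le> B" "0 \<le> I"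
    unfolding A_def B_def I_def set_lebesgue_integral_def by (auto intro!: integral_nonneg_AE)
  have key: "2 * t * I \<le> t\<^sup>2 * A + B" for t
  proof -
    have "2 * t * I = (LINT x:S|M. 2 * t * (norm (f x) * norm (g x)))"
      by (simp add: I_def)
    also have "\<dots> \<le> (LINT x:S|M. t\<^sup>2 * (norm (f x))\<^sup>2 + (norm (g x))\<^sup>2)"
    proof (rule set_integral_mono)
      show "set_integrable M S (\<lambda>x. 2 * t * (norm (f x) * norm (g x)))"
        using fgi by (rule set_integrable_mult_right)
      show "set_integrable M S (\<lambda>x. t\<^sup>2 * (norm (f x))\<^sup>2 + (norm (g x))\<^sup>2)"
        by (intro set_integral_add(1) set_integrable_mult_right fi gi)
      show "2 * t * (norm (f x) * norm (g x)) \<le> t\<^sup>2 * (norm (f x))\<^sup>2 + (norm (g x))\<^sup>2" for x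
        using sum_squares_bound[of "t * norm (f x)" "norm (g x)"] by (simp add: power_mult_distrib algebra_simps)
    qed
    also have "\<dots> = t\<^sup>2 * A + B"
      by (subst set_integral_add(2)[OF set_integrable_mult_right[OF fi] gi]) (simp add: A_def B_def)
    finally show ?thesis .
  qed
  have "I \<le> sqrt (A * B)"
  proof (cases "A = 0")
    case True
    have "I = 0"
    proof (rule ccontr)
      assume "I \<noteq> 0"
      \<comment> \<open>For \<open>A = 0\<close> this choice of \<open>t\<close> makes the left side
        of \<open>key\<close> equal to \<open>B + 1\<close>, above the right side
        \<open>B\<close>.\<close>
      then show False using key[of "(B + 1) / (2 * I)"] True nn by simp
    qed
    then show ?thesis using nn by simp
  next
    case False
    have "2 * (I / A) * I \<le> (I / A)\<^sup>2 * A + B" by (rule key)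
    then have "I\<^sup>2 \<le> A * B" using False nn by (simp add: field_simps power2_eq_square)
    then show ?thesis by (rule real_le_rsqrt)
  qed
  then show ?thesis unfolding L2_norm_on_def by (simp add: A_def B_def I_def real_sqrt_mult)
qed

lemma L2_on_add:
  assumes f: "L2_on M S f" and g: "L2_on M S g"
  shows "L2_on M S (\<lambda>x. f x + g x)"
  unfolding L2_on_def set_borel_measurable_def set_integrable_def
proof
  have "(\<lambda>x. (indicator S x *\<^sub>R f x) + (indicator S x *\<^sub>R g x)) \<in> borel_measurable M"
    by (intro borel_measurable_add L2_onD f g)
  then show m: "(\<lambda>x. indicator S x *\<^sub>R (f x + g x)) \<in> borel_measurable M"
    by (simp add: scaleR_add_right)
  show "integrable M (\<lambda>x. indicator S x *\<^sub>R (norm (f x + g x))\<^sup>2)"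
  proof (rule Bochner_Integration.integrable_bound)
    show "integrable M (\<lambda>x. 2 * (indicator S x *\<^sub>R (norm (f x))\<^sup>2) + 2 * (indicator S x *\<^sub>R (norm (g x))\<^sup>2))"
      by (intro Bochner_Integration.integrable_add integrable_mult_right L2_onD f g)
    have "(\<lambda>x. (norm (indicator S x *\<^sub>R (f x + g x)))\<^sup>2) \<in> borel_measurable M"
      using m by measurable
    moreover have "(\<lambda>x. (norm (indicator S x *\<^sub>R (f x + g x)))\<^sup>2) = (\<lambda>x. indicator S x *\<^sub>R (norm (f x + g x))\<^sup>2)"
      by (auto simp: indicator_def)
    ultimately show "(\<lambda>x. indicator S x *\<^sub>R (norm (f x + g x))\<^sup>2) \<in> borel_measurable M" by simp
    have "(norm (a + b))\<^sup>2 \<le> 2 * (norm a)\<^sup>2 + 2 * (norm b)\<^sup>2" for a b :: complex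
    proof -
      have "(norm (a + b))\<^sup>2 \<le> (norm a + norm b)\<^sup>2" by (intro power_mono norm_triangle_ineq) auto
      also have "\<dots> \<le> 2 * (norm a)\<^sup>2 + 2 * (norm b)\<^sup>2"
        using sum_squares_bound[of "norm a" "norm b"] by (simp add: power2_sum)
      finally show ?thesis .
    qed
    then show "AE x in M. norm (indicator S x *\<^sub>R (norm (f x + g x))\<^sup>2) \<le>
        norm (2 * (indicator S x *\<^sub>R (norm (f x))\<^sup>2) + 2 * (indicator S x *\<^sub>R (norm (g x))\<^sup>2))"
      by (intro always_eventually allI) (auto simp: indicator_def norm_mult)
  qed
qed

lemma L2_on_bounded_mult:
  assumes f: "L2_on M S f" and m: "set_borel_measurable M S b" and b: "\<And>x. x \<in> S \<Longrightarrow> norm (b x) \<le> K"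
  shows "L2_on M S (\<lambda>x. b x * f x)"
  unfolding L2_on_def set_borel_measurable_def set_integrable_def
proof
  have "(\<lambda>x. (indicator S x *\<^sub>R b x) * (indicator S x *\<^sub>R f x)) \<in> borel_measurable M"
    using m by (intro borel_measurable_times L2_onD(1)[OF f]) (simp add: set_borel_measurable_def)
  also have "(\<lambda>x. (indicator S x *\<^sub>R b x) * (indicator S x *\<^sub>R f x)) = (\<lambda>x. indicator S x *\<^sub>R (b x * f x))"
    by (auto simp: indicator_def)
  finally show m: "(\<lambda>x. indicator S x *\<^sub>R (b x * f x)) \<in> borel_measurable M" .
  show "integrable M (\<lambda>x. indicator S x *\<^sub>R (norm (b x * f x))\<^sup>2)"
  proof (rule Bochner_Integration.integrable_bound)
    show "integrable M (\<lambda>x. K\<^sup>2 * (indicator S x *\<^sub>R (norm (f x))\<^sup>2))"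
      by (intro integrable_mult_right L2_onD f)
    have "(\<lambda>x. (norm (indicator S x *\<^sub>R (b x * f x)))\<^sup>2) \<in> borel_measurable M"
      using m by measurable
    moreover have "(\<lambda>x. (norm (indicator S x *\<^sub>R (b x * f x)))\<^sup>2) = (\<lambda>x. indicator S x *\<^sub>R (norm (b x * f x))\<^sup>2)"
      by (auto simp: indicator_def)
    ultimately show "(\<lambda>x. indicator S x *\<^sub>R (norm (b x * f x))\<^sup>2) \<in> borel_measurable M" by simp
    show "AE x in M. norm (indicator S x *\<^sub>R (norm (b x * f x))\<^sup>2) \<le> norm (K\<^sup>2 * (indicator S x *\<^sub>R (norm (f x))\<^sup>2))"
      using b by (intro always_eventually allI)
        (auto simp: indicator_def norm_mult power_mult_distrib intro!: mult_right_mono power_mono)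
  qed
qed

lemma L2_on_cmult:
  assumes "L2_on M S f" shows "L2_on M S (\<lambda>x. c * f x)"
  unfolding L2_on_def set_borel_measurable_def set_integrable_def
proof
  have "(\<lambda>x. c * (indicator S x *\<^sub>R f x)) \<in> borel_measurable M"
    by (intro borel_measurable_times borel_measurable_const L2_onD assms)
  then show "(\<lambda>x. indicator S x *\<^sub>R (c * f x)) \<in> borel_measurable M"
    by (simp add: mult_scaleR_right)
  have "integrable M (\<lambda>x. (norm c)\<^sup>2 * (indicator S x *\<^sub>R (norm (f x))\<^sup>2))"
    by (intro integrable_mult_right L2_onD assms)
  then show "integrable M (\<lambda>x. indicator S x *\<^sub>R (norm (c * f x))\<^sup>2)"
    by (simp add: norm_mult power_mult_distrib mult_ac)
qed

lemma L2_on_diff: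
  assumes "L2_on M S f" "L2_on M S g"
  shows "L2_on M S (\<lambda>x. f x - g x)"
  using L2_on_add[OF assms(1) L2_on_cmult[OF assms(2), of "-1"]] by simp

lemma L2_on_bounded:
  assumes S: "S \<in> sets M" "emeasure M S < \<infinity>" and m: "set_borel_measurable M S b"
    and b: "\<And>x. x \<in> S \<Longrightarrow> norm (b x) \<le> K"
  shows "L2_on M S b"
proof -
  have "L2_on M S (\<lambda>x. 1)"
    using S by (auto simp: L2_on_def set_borel_measurable_def set_integrable_def)
  from L2_on_bounded_mult[OF this m b] show ?thesis by simp
qed

lemma L2_on_subset:
  assumes "L2_on M S f" "T \<in> sets M" "T \<subseteq> S"
  shows "L2_on M T f"
  using assms set_borel_measurable_subset[of M S f T]
  by (auto simp: L2_on_def intro: set_integrable_subset)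

lemma L2_on_integrable:
  assumes f: "L2_on M S f" and S: "S \<in> sets M" "emeasure M S < \<infinity>"
  shows "set_integrable M S f"
    and "(LINT x:S|M. norm (f x)) \<le> sqrt (measure M S) * L2_norm_on M S f"
proof -
  have 1: "L2_on M S (\<lambda>x. 1)"
    using S by (auto simp: L2_on_def set_borel_measurable_def set_integrable_def)
  show "set_integrable M S f" using L2_on_mult_integrable[OF 1 f] by simp
  have "L2_norm_on M S (\<lambda>x. 1) = sqrt (measure M S)"
    using S by (simp add: L2_norm_on_def set_lebesgue_integral_def)
  then show "(LINT x:S|M. norm (f x)) \<le> sqrt (measure M S) * L2_norm_on M S f"
    using L2_on_Cauchy_Schwarz[OF 1 f] by simp
qed

lemma L2_norm_on_cong_AE:
  assumes "AE x in M. x \<in> S \<longrightarrow> f x = g x" "set_borel_measurable M S f" "set_borel_measurable M S g"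
  shows "L2_norm_on M S f = L2_norm_on M S g"
proof -
  have n: "(\<lambda>x. indicator S x *\<^sub>R (norm (h x))\<^sup>2) \<in> borel_measurable M" if "set_borel_measurable M S h" for h :: "'a \<Rightarrow> complex"
  proof -
    have "(\<lambda>x. (norm (indicator S x *\<^sub>R h x))\<^sup>2) \<in> borel_measurable M"
      using that unfolding set_borel_measurable_def by measurable
    moreover have "(\<lambda>x. (norm (indicator S x *\<^sub>R h x))\<^sup>2) = (\<lambda>x. indicator S x *\<^sub>R (norm (h x))\<^sup>2)"
      by (auto simp: indicator_def)
    ultimately show ?thesis by simp
  qed
  show ?thesis
    unfolding L2_norm_on_def set_lebesgue_integral_def
  proof (rule arg_cong[where f=sqrt], rule integral_cong_AE)
    show "AE x in M. indicator S x *\<^sub>R (norm (f x))\<^sup>2 = indicator S x *\<^sub>R (norm (g x))\<^sup>2"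
      using assms(1) by (rule eventually_mono) (simp add: indicator_def)
  qed (use assms(2,3) n in auto)
qed

lemma L2_norm_on_mono_set:
  assumes "L2_on M S f" "T \<in> sets M" "T \<subseteq> S"
  shows "L2_norm_on M T f \<le> L2_norm_on M S f"
  unfolding L2_norm_on_def set_lebesgue_integral_def
proof (intro real_sqrt_le_mono integral_mono)
  show "integrable M (\<lambda>x. indicator T x *\<^sub>R (norm (f x))\<^sup>2)"
    using L2_onD(2)[OF L2_on_subset[OF assms]] .
qed (use assms L2_onD(2)[OF assms(1)] in \<open>auto simp: indicator_def\<close>)

lemma continuous_set_borel_measurable:
  fixes f :: "real ^ 'n::finite \<Rightarrow> complex"
  assumes "continuous_on UNIV f" "S \<in> sets lebesgue"
  shows "set_borel_measurable lebesgue S f"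
proof -
  have "f \<in> borel_measurable lebesgue"
    using assms(1) by (simp add: borel_measurable_continuous_onI measurable_completion)
  then show ?thesis unfolding set_borel_measurable_def using assms(2) by measurable
qed

lemma continuous_bounded_on:
  fixes f :: "real ^ 'n::finite \<Rightarrow> complex"
  assumes "continuous_on UNIV f" "bounded S"
  obtains K where "\<And>x. x \<in> S \<Longrightarrow> norm (f x) \<le> K" "0 < K"
proof -
  have "compact (f ` closure S)"
    using assms by (intro compact_continuous_image continuous_on_subset[OF assms(1)]) auto
  then obtain K where "0 < K" "\<forall>y\<in>f ` closure S. norm y \<le> K"
    using bounded_pos compact_imp_bounded by blast
  then show ?thesis using closure_subset that by (metis imageI subsetD)
qed

lemma bounded_emeasure_lebesgue:
  fixes S :: "(real ^ 'n::finite) set"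
  assumes "bounded S" "S \<in> sets lebesgue" shows "emeasure lebesgue S < \<infinity>"
  using fmeasurableD2[OF bounded_set_imp_lmeasurable[OF assms]] by (simp add: less_top)

lemma continuous_L2_on:
  fixes f :: "real ^ 'n::finite \<Rightarrow> complex"
  assumes "continuous_on UNIV f" "bounded S" "S \<in> sets lebesgue"
  shows "L2_on lebesgue S f"
proof -
  obtain K where "\<And>x. x \<in> S \<Longrightarrow> norm (f x) \<le> K" using continuous_bounded_on[OF assms(1,2)] by blast
  then show ?thesis
    using assms bounded_emeasure_lebesgue by (intro L2_on_bounded continuous_set_borel_measurable)
qed

lemma test_functionD:
  assumes "test_function U \<phi>"
  shows "smooth \<phi>" "continuous_on UNIV \<phi>" "bounded (closure {x. \<phi> x \<noteq> 0})"
    "closure {x. \<phi> x \<noteq> 0} \<subseteq> U" "x \<notin> closure {x. \<phi> x \<noteq> 0} \<Longrightarrow> \<phi> x = 0"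
    "\<exists>K. \<forall>x. norm (\<phi> x) \<le> K"
proof -
  show *: "smooth \<phi>" "closure {x. \<phi> x \<noteq> 0} \<subseteq> U" "bounded (closure {x. \<phi> x \<noteq> 0})"
    using assms unfolding test_function_def by (blast intro: compact_imp_bounded)+
  show c: "continuous_on UNIV \<phi>" by (rule smooth_continuous_on[OF *(1)])
  show z: "\<phi> x = 0" if "x \<notin> closure {x. \<phi> x \<noteq> 0}" for x
    using that subsetD[OF closure_subset, of x "{x. \<phi> x \<noteq> 0}"] by auto
  obtain K where "\<And>x. x \<in> closure {x. \<phi> x \<noteq> 0} \<Longrightarrow> norm (\<phi> x) \<le> K" "0 < K"
    using continuous_bounded_on[OF c *(3)] by blast
  then have "norm (\<phi> x) \<le> K" for x
    using z[of x] by (metis less_imp_le norm_zero)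
  then show "\<exists>K. \<forall>x. norm (\<phi> x) \<le> K" by blast
qed

lemma test_function_L2:
  assumes "test_function U \<phi>" "open U"
  shows "L2_on lebesgue U \<phi>"
proof -
  let ?C = "closure {x. \<phi> x \<noteq> 0}"
  have "L2_on lebesgue ?C \<phi>"
    by (intro continuous_L2_on test_functionD[OF assms(1)]) auto
  moreover have eq: "indicator U x = (indicator ?C x :: real) \<or> \<phi> x = 0" for x
  proof (cases "x \<in> ?C")
    case True
    then have "x \<in> U" using test_functionD(4)[OF assms(1)] by (rule subsetD[rotated])
    then show ?thesis unfolding indicator_def using True by simp
  next
    case False
    then show ?thesis using test_functionD(5)[OF assms(1)] by (intro disjI2)
  qed
  have "(\<lambda>x. indicator U x *\<^sub>R \<phi> x) = (\<lambda>x. indicator ?C x *\<^sub>R \<phi> x)"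
  proof
    fix x show "indicator U x *\<^sub>R \<phi> x = indicator ?C x *\<^sub>R \<phi> x"
      using eq[of x] by (elim disjE) simp_all
  qed
  moreover have "(\<lambda>x. indicator U x *\<^sub>R (norm (\<phi> x))\<^sup>2) = (\<lambda>x. indicator ?C x *\<^sub>R (norm (\<phi> x))\<^sup>2)"
  proof
    fix x show "indicator U x *\<^sub>R (norm (\<phi> x))\<^sup>2 = indicator ?C x *\<^sub>R (norm (\<phi> x))\<^sup>2"
      using eq[of x] by (elim disjE) simp_all
  qed
  ultimately show ?thesis unfolding L2_on_def set_borel_measurable_def set_integrable_def by (simp only:)
qed

section \<open>Test functions\<close>

text \<open>For positive \<open>n\<close> it is nonzero exactly on the open box and bounded by 1; a
  growing scale \<open>n\<close> drives it to 1 inside. This gives test functions converging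
  boundedly to the indicator of a box.\<close>

definition box_bump :: "real \<Rightarrow> real ^ 'n::finite \<Rightarrow> real ^ 'n \<Rightarrow> real ^ 'n \<Rightarrow> complex" where
  "box_bump n a b x =
     (\<Prod>i\<in>UNIV. complex_of_real (flat_exp (n * (x $ i + - (a $ i))) * flat_exp (n * (b $ i + - 1 * x $ i))))"

lemma smooth_box_bump: "smooth (box_bump n a b)"
  unfolding box_bump_def[abs_def]
  by (intro smooth_prod smooth_of_real smooth_mult smooth_flat_exp smooth_add smooth_const smooth_nth)

lemma box_bump_nonzero_iff: "0 < n \<Longrightarrow> box_bump n a b x \<noteq> 0 \<longleftrightarrow> x \<in> box a b"
  unfolding box_bump_def mem_box_cart
  by (simp add: flat_exp_eq_0_iff not_le zero_less_mult_iff)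

lemma norm_box_bump_le: "norm (box_bump n a b x) \<le> 1"
  unfolding box_bump_def prod_norm[symmetric]
  by (intro prod_le_1) (auto simp: norm_mult flat_exp_nonneg abs_of_nonneg intro!: mult_le_one flat_exp_le_1)

lemma tendsto_flat_exp_scaled: "0 < t \<Longrightarrow> (\<lambda>n. flat_exp (real (Suc n) * t)) \<longlonglongrightarrow> 1"
proof -
  assume t: "0 < t"
  have "filterlim (\<lambda>n. real (Suc n)) at_top sequentially"
    using filterlim_real_sequentially filterlim_sequentially_Suc by blast
  then have "(\<lambda>n. exp (- (1 / t) * inverse (real (Suc n)))) \<longlonglongrightarrow> exp (- (1 / t) * 0)"
    by (intro tendsto_intros tendsto_inverse_0_at_top)
  moreover have "flat_exp (real (Suc n) * t) = exp (- (1 / t) * inverse (real (Suc n)))" for n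
    using t by (simp add: flat_exp_def zero_less_mult_iff divide_simps)
  ultimately show ?thesis by simp
qed

lemma tendsto_box_bump:
  fixes x :: "real ^ 'n::finite"
  shows "(\<lambda>n. box_bump (real (Suc n)) a b x) \<longlonglongrightarrow> indicator (box a b) x"
proof (cases "x \<in> box a b")
  case True
  have "(\<lambda>n. box_bump (real (Suc n)) a b x) \<longlonglongrightarrow> (\<Prod>i\<in>(UNIV::'n set). complex_of_real (1 * 1))"
    unfolding box_bump_def
  proof (rule Limits.tendsto_prod)
    fix i
    show "(\<lambda>n. complex_of_real (flat_exp (real (Suc n) * (x $ i + - a $ i)) * flat_exp (real (Suc n) * (b $ i + - 1 * x $ i))))
        \<longlonglongrightarrow> complex_of_real (1 * 1)"
      by (intro tendsto_of_real tendsto_mult tendsto_flat_exp_scaled) (use True in \<open>auto simp: mem_box_cart\<close>)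
  qed
  then show ?thesis using True by simp
next
  case False
  then have "box_bump (real (Suc n)) a b x = 0" for n
    using box_bump_nonzero_iff[of "real (Suc n)" a b x] by auto
  then show ?thesis using False by simp
qed

lemma test_function_box_bump:
  assumes "cbox a b \<subseteq> U" "0 < n" shows "test_function U (box_bump n a b)"
proof -
  have "{x. box_bump n a b x \<noteq> 0} = box a b"
    using box_bump_nonzero_iff[OF assms(2), of a b] by blast
  moreover have "closure (box a b) \<subseteq> cbox a b"
    by (intro closure_minimal) (auto simp: box_subset_cbox)
  ultimately show ?thesis
    unfolding test_function_def using smooth_box_bump assms(1) by (auto simp: bounded_box)
qed

text \<open>Dominated convergence along \<open>box_bump\<close>, with \<open>norm (f x)\<close> on
  the closed box as bound; integrability is asked only there, so that \<open>f\<close> may be just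
  locally integrable in \<open>U\<close>.\<close>

lemma integral_box_eq_0:
  fixes f :: "real ^ 'n::finite \<Rightarrow> complex"
  assumes f: "set_integrable lebesgue (cbox a b) f" and ab: "cbox a b \<subseteq> U"
    and z: "\<And>\<phi>. test_function U \<phi> \<Longrightarrow> (LINT x:U|lebesgue. f x * \<phi> x) = 0"
  shows "(LINT x:box a b|lebesgue. f x) = 0"
proof -
  let ?B = "\<lambda>n. box_bump (real (Suc n)) a b"
  let ?F = "\<lambda>x. indicator (cbox a b) x *\<^sub>R f x"
  have Fi: "integrable lebesgue ?F" using f by (simp add: set_integrable_def)
  have Bm: "?B n \<in> borel_measurable lebesgue" for n
    by (simp add: measurable_completion borel_measurable_continuous_onI smooth_continuous_on smooth_box_bump)
  have off: "?B n x = 0" if "x \<notin> box a b" for n x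
    using that box_bump_nonzero_iff[of "real (Suc n)" a b x] by auto
  have "(\<lambda>n. LINT x|lebesgue. ?F x * ?B n x) \<longlonglongrightarrow> (LINT x|lebesgue. ?F x * indicator (box a b) x)"
  proof (rule integral_dominated_convergence)
    show "integrable lebesgue (\<lambda>x. norm (?F x))" using Fi by (rule integrable_norm)
    show "(\<lambda>x. ?F x * ?B n x) \<in> borel_measurable lebesgue" for n
      using Fi Bm by (intro borel_measurable_times) auto
    have "(\<lambda>x. indicator (box a b) x :: complex) \<in> borel_measurable lebesgue"
      by (intro borel_measurable_indicator) auto
    then show "(\<lambda>x. ?F x * indicator (box a b) x) \<in> borel_measurable lebesgue"
      using Fi by (intro borel_measurable_times) auto
    show "AE x in lebesgue. (\<lambda>n. ?F x * ?B n x) \<longlonglongrightarrow> ?F x * indicator (box a b) x"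
      by (intro always_eventually allI tendsto_mult tendsto_const tendsto_box_bump)
    show "AE x in lebesgue. norm (?F x * ?B n x) \<le> norm (?F x)" for n
      by (intro always_eventually allI) (simp only: norm_mult mult_left_le[OF norm_box_bump_le norm_ge_zero])
  qed
  moreover have "(LINT x|lebesgue. ?F x * ?B n x) = 0" for n
  proof -
    have "?F x * ?B n x = indicator U x *\<^sub>R (f x * ?B n x)" for x :: "real ^ 'n"
    proof (cases "x \<in> box a b")
      case True
      then have "x \<in> cbox a b" "x \<in> U" using ab box_subset_cbox by blast+
      then show ?thesis by simp
    qed (simp add: off del: of_nat_Suc)
    then have "(\<lambda>x. ?F x * ?B n x) = (\<lambda>x. indicator U x *\<^sub>R (f x * ?B n x))" by (rule ext)
    then show ?thesis
      using z[OF test_function_box_bump[OF ab, of "real (Suc n)"]]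
      unfolding set_lebesgue_integral_def by (simp only: of_nat_0_less_iff zero_less_Suc)
  qed
  ultimately have "(LINT x|lebesgue. ?F x * indicator (box a b) x) = 0"
    by (simp add: LIMSEQ_const_iff)
  moreover have "?F x * indicator (box a b) x = indicator (box a b) x *\<^sub>R f x" for x
    using box_subset_cbox[of a b] by (auto simp: indicator_def)
  ultimately show ?thesis unfolding set_lebesgue_integral_def by simp
qed

section \<open>The fundamental lemma of the calculus of variations\<close>

lemma sigma_finite_lebesgue: "sigma_finite_measure (lebesgue :: 'a::euclidean_space measure)"
proof
  have "x \<in> (\<Union>n. cball 0 (real n))" for x :: 'a
    using real_arch_simple[of "norm x"] by auto
  moreover have "emeasure lborel (cball (0::'a) (real n)) \<noteq> top" for n
    using emeasure_lborel_cball_finite[of "0::'a" "real n"] by simp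
  ultimately show "\<exists>A. countable A \<and> A \<subseteq> sets (lebesgue :: 'a measure) \<and> \<Union>A = space lebesgue \<and> (\<forall>a\<in>A. emeasure lebesgue a \<noteq> \<infinity>)"
    by (intro exI[of _ "range (\<lambda>n. cball 0 (real n))"]) auto
qed

text \<open>A Dynkin argument: boxes are stable under intersection and generate the Borel sets, and
  the sets over which \<open>f\<close> has integral 0 are closed under complements and countable
  disjoint unions. A Lebesgue set differs from a Borel set by a null set.\<close>

lemma AE_eq_0_from_boxes:
  fixes f :: "real ^ 'n::finite \<Rightarrow> complex"
  assumes f: "integrable lebesgue f" and z: "\<And>a b. (LINT x:box a b|lebesgue. f x) = 0"
  shows "AE x in lebesgue. f x = 0"
proof -
  have si: "set_integrable lebesgue A f" if "A \<in> sets lebesgue" for A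
    unfolding set_integrable_def using f that by (rule integrable_mult_indicator[rotated])
  let ?G = "range (\<lambda>(a, b). box a b :: (real ^ 'n) set)"
  \<comment> \<open>Exhaustion of the space by boxes; the total integral is what closure under
    complements needs.\<close>
  have U0: "(LINT x|lebesgue. f x) = 0"
  proof -
    have "(\<lambda>n. LINT x|lebesgue. indicator (box (\<chi> i. - real n) (\<chi> i. real n)) x *\<^sub>R f x) \<longlonglongrightarrow> (LINT x|lebesgue. f x)"
    proof (rule integral_dominated_convergence)
      show "integrable lebesgue (\<lambda>x. norm (f x))" using f by (rule integrable_norm)
      show "AE x in lebesgue. (\<lambda>n. indicator (box (\<chi> i. - real n) (\<chi> i. real n)) x *\<^sub>R f x) \<longlonglongrightarrow> f x"
      proof (rule always_eventually, rule allI, rule tendsto_eventually)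
        fix x :: "real ^ 'n"
        obtain N where N: "norm x < real N" using reals_Archimedean2 by blast
        have "x \<in> box (\<chi> i. - real n) (\<chi> i. real n)" if "N \<le> n" for n
        proof -
          have "\<bar>x $ i\<bar> < real n" for i using component_le_norm_cart[of x i] N that by linarith
          then have "- real n < x $ i \<and> x $ i < real n" for i by (simp add: abs_less_iff minus_less_iff)
          then show ?thesis by (simp add: mem_box_cart)
        qed
        then show "\<forall>\<^sub>F n in sequentially. indicator (box (\<chi> i. - real n) (\<chi> i. real n)) x *\<^sub>R f x = f x"
          by (auto simp: eventually_sequentially intro!: exI[of _ N])
      qed
      show "f \<in> borel_measurable lebesgue" using f by (rule borel_measurable_integrable)
      show "(\<lambda>x. indicator (box (\<chi> i. - real n) (\<chi> i. real n)) x *\<^sub>R f x) \<in> borel_measurable lebesgue" for n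
        using si[of "box (\<chi> i. - real n) (\<chi> i. real n)"]
        by (auto simp: set_integrable_def intro: borel_measurable_integrable)
      show "AE x in lebesgue. norm (indicator (box (\<chi> i. - real n) (\<chi> i. real n)) x *\<^sub>R f x) \<le> norm (f x)" for n
        by (intro always_eventually allI) (simp add: indicator_def)
    qed
    then show ?thesis using z unfolding set_lebesgue_integral_def by (simp add: LIMSEQ_const_iff)
  qed
  have bor: "(LINT x:A|lebesgue. f x) = 0" if "A \<in> sets borel" for A
  proof -
    have A: "A \<in> sigma_sets UNIV ?G"
      using that by (simp add: borel_eq_box sets_measure_of)
    have sb: "X \<in> sets lebesgue" if "X \<in> sigma_sets UNIV ?G" for X
    proof -
      have "X \<in> sets borel" using that by (simp add: borel_eq_box sets_measure_of)
      then show ?thesis by auto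
    qed
    have "Int_stable ?G"
    proof (clarsimp simp: Int_stable_def)
      fix a b c d :: "real ^ 'n"
      have "box a b \<inter> box c d = box (\<chi> i. max (a $ i) (c $ i)) (\<chi> i. min (b $ i) (d $ i))"
        by (auto simp: mem_box_cart)
      then show "box a b \<inter> box c d \<in> ?G" by (auto intro!: image_eqI)
    qed
    then show ?thesis
    proof (rule sigma_sets_induct_disjoint[OF _ _ A])
      show "?G \<subseteq> Pow UNIV" by auto
      show "(LINT x:X|lebesgue. f x) = 0" if "X \<in> ?G" for X using that z by auto
      show "(LINT x:{}|lebesgue. f x) = 0" by (simp add: set_lebesgue_integral_def)
      fix X assume X: "X \<in> sigma_sets UNIV ?G" "(LINT x:X|lebesgue. f x) = 0"
      have "(LINT x:UNIV - X|lebesgue. f x) = (LINT x|lebesgue. f x - indicator X x *\<^sub>R f x)"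
        unfolding set_lebesgue_integral_def by (rule Bochner_Integration.integral_cong) (auto simp: indicator_def)
      also have "\<dots> = 0"
        using X U0 si[OF sb[OF X(1)]] f by (simp add: set_lebesgue_integral_def set_integrable_def)
      finally show "(LINT x:UNIV - X|lebesgue. f x) = 0" .
    next
      fix X :: "nat \<Rightarrow> (real ^ 'n) set"
      assume X: "disjoint_family X" "range X \<subseteq> sigma_sets UNIV ?G" "\<And>i. (LINT x:X i|lebesgue. f x) = 0"
      have m: "X i \<in> sets lebesgue" for i using X(2) sb by blast
      then have "(\<Union>i. X i) \<in> sets lebesgue" by blast
      then have "(LINT x:(\<Union>i. X i)|lebesgue. f x) = (\<Sum>i. (LINT x:(X i)|lebesgue. f x))"
        using X(1) m si by (intro lebesgue_integral_countable_add) (auto simp: disjoint_family_on_def)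
      then show "(LINT x:(\<Union>i. X i)|lebesgue. f x) = 0" using X(3) by simp
    qed
  qed
  show ?thesis
  proof (rule sigma_finite_measure.density_zero[OF sigma_finite_lebesgue f])
    fix A :: "(real ^ 'n) set" assume "A \<in> sets lebesgue"
    then obtain B N where BN: "B \<in> sets borel" "negligible N" "B \<union> N = A"
      by (rule sets_lebesgue_almost_borel)
    have "AE x in lebesgue. x \<notin> N"
      using BN(2) by (simp add: negligible_iff_null_sets AE_not_in)
    then have "(LINT x:A|lebesgue. f x) = (LINT x:B|lebesgue. f x)"
      unfolding set_lebesgue_integral_def
      using si[of A] si[of B] BN \<open>A \<in> sets lebesgue\<close>
      by (intro integral_cong_AE) (auto simp: set_integrable_def indicator_def elim!: eventually_mono)
    then show "set_lebesgue_integral lebesgue A f = 0" using bor[OF BN(1)] by simp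
  qed
qed

text \<open>Localisation: \<open>f\<close> is cut off to a closed box in \<open>U\<close>, where it
  is integrable. The intersection of that box with any open box is an open box up to a null set, so
  \<open>integral_box_eq_0\<close> applies to it. Countably many closed boxes fill
  \<open>U\<close>.\<close>

lemma fundamental_lemma:
  fixes f :: "real ^ 'n::finite \<Rightarrow> complex"
  assumes U: "open U" and f: "\<And>a b. cbox a b \<subseteq> U \<Longrightarrow> set_integrable lebesgue (cbox a b) f"
    and z: "\<And>\<phi>. test_function U \<phi> \<Longrightarrow> (LINT x:U|lebesgue. f x * \<phi> x) = 0"
  shows "AE x in lebesgue. x \<in> U \<longrightarrow> f x = 0"
proof -
  have box0: "AE x in lebesgue. x \<in> cbox a b \<longrightarrow> f x = 0" if ab: "cbox a b \<subseteq> U" for a b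
  proof -
    let ?F = "\<lambda>x. indicator (cbox a b) x *\<^sub>R f x"
    have "AE x in lebesgue. ?F x = 0"
    proof (rule AE_eq_0_from_boxes)
      show "integrable lebesgue ?F" using f[OF ab] by (simp add: set_integrable_def)
      fix c d :: "real ^ 'n"
      define l u where "l = (\<chi> i. max (a $ i) (c $ i))" and "u = (\<chi> i. min (b $ i) (d $ i))"
      have sub: "cbox l u \<subseteq> cbox a b" by (auto simp: l_def u_def mem_box_cart)
      have "box c d \<inter> box a b = box l u" by (auto simp: l_def u_def mem_box_cart)
      moreover have "AE x in lebesgue. x \<notin> cbox a b - box a b"
        by (rule AE_not_in[OF negligible_frontier_interval[unfolded negligible_iff_null_sets]])
      ultimately have "(LINT x:box c d|lebesgue. ?F x) = (LINT x:box l u|lebesgue. f x)"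
      proof -
        assume eq: "box c d \<inter> box a b = box l u" and ae: "AE x in lebesgue. x \<notin> cbox a b - box a b"
        have "set_integrable lebesgue (box l u) f"
          using f[OF ab] by (rule set_integrable_subset) (use sub box_subset_cbox in auto)
        moreover have "integrable lebesgue (\<lambda>x. indicator (box c d) x *\<^sub>R ?F x)"
          by (rule integrable_mult_indicator) (use f[OF ab] in \<open>auto simp: set_integrable_def\<close>)
        moreover have "AE x in lebesgue. indicator (box c d) x *\<^sub>R ?F x = indicator (box l u) x *\<^sub>R f x"
          using ae by (rule eventually_mono) (use eq box_subset_cbox[of a b] in \<open>auto simp: indicator_def\<close>)
        ultimately show ?thesis unfolding set_lebesgue_integral_def set_integrable_def
          by (intro integral_cong_AE) auto
      qed
      also have "\<dots> = 0"
      proof (rule integral_box_eq_0)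
        show "set_integrable lebesgue (cbox l u) f"
          using f[OF ab] by (rule set_integrable_subset) (use sub in auto)
        show "cbox l u \<subseteq> U" using sub ab by blast
      qed (rule z)
      finally show "(LINT x:box c d|lebesgue. ?F x) = 0" .
    qed
    then show ?thesis by (rule eventually_mono) (auto simp: indicator_def split: if_splits)
  qed
  obtain D where D: "countable D" "D \<subseteq> Pow U" "\<And>X. X \<in> D \<Longrightarrow> \<exists>a b. X = cbox a b" "\<Union>D = U"
    using open_countable_Union_open_cbox[OF U] by metis
  have "AE x in lebesgue. \<forall>X\<in>D. x \<in> X \<longrightarrow> f x = 0"
    unfolding AE_ball_countable[OF D(1)]
  proof
    fix X assume X: "X \<in> D"
    then obtain a b where "X = cbox a b" using D(3) by blast
    then show "AE x in lebesgue. x \<in> X \<longrightarrow> f x = 0" using box0 X D(2) by blast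
  qed
  then show ?thesis by (rule eventually_mono) (use D(4) in blast)
qed

lemma L2_on_eq_AE:
  fixes f g :: "real ^ 'n::finite \<Rightarrow> complex"
  assumes U: "open U" and f: "L2_on lebesgue U f" and g: "L2_on lebesgue U g"
    and eq: "\<And>\<phi>. test_function U \<phi> \<Longrightarrow> (LINT x:U|lebesgue. f x * \<phi> x) = (LINT x:U|lebesgue. g x * \<phi> x)"
  shows "AE x in lebesgue. x \<in> U \<longrightarrow> f x = g x"
proof -
  have "AE x in lebesgue. x \<in> U \<longrightarrow> f x - g x = 0"
  proof (rule fundamental_lemma[OF U])
    fix a b :: "real ^ 'n" assume "cbox a b \<subseteq> U"
    then show "set_integrable lebesgue (cbox a b) (\<lambda>x. f x - g x)"
      by (intro L2_on_integrable(1)[of lebesgue] L2_on_subset[OF L2_on_diff[OF f g]] bounded_emeasure_lebesgue) auto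
  next
    fix \<phi> :: "real ^ 'n \<Rightarrow> complex" assume t: "test_function U \<phi>"
    have "(LINT x:U|lebesgue. f x * \<phi> x - g x * \<phi> x) = 0"
      using eq[OF t] L2_on_mult_integrable[OF f test_function_L2[OF t U]] L2_on_mult_integrable[OF g test_function_L2[OF t U]]
      by (subst set_integral_diff(2)) auto
    then show "(LINT x:U|lebesgue. (f x - g x) * \<phi> x) = 0" by (simp add: left_diff_distrib)
  qed
  then show ?thesis by simp
qed

lemma has_weak_partial_unique:
  assumes "open U" "has_weak_partial U i u g" "L2_on lebesgue U g" "has_weak_partial U i u g'" "L2_on lebesgue U g'"
  shows "AE x in lebesgue. x \<in> U \<longrightarrow> g x = g' x"
  using assms by (intro L2_on_eq_AE) (auto simp: has_weak_partial_def)

lemma has_weak_laplacian_unique: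
  assumes "open U" "has_weak_laplacian U u f" "has_weak_laplacian U u f'"
  shows "AE x in lebesgue. x \<in> U \<longrightarrow> f x = f' x"
  using assms by (intro L2_on_eq_AE) (auto simp: has_weak_laplacian_def)

section \<open>Weak derivatives and traces\<close>

lemma test_function_partial:
  assumes "test_function U \<phi>" shows "test_function U (partial i \<phi>)"
    and "x \<notin> closure {x. \<phi> x \<noteq> 0} \<Longrightarrow> partial i \<phi> x = 0"
proof -
  let ?C = "closure {x. \<phi> x \<noteq> 0}"
  show z: "partial i \<phi> x = 0" if "x \<notin> ?C" for x
  proof -
    have "(\<phi> has_derivative (\<lambda>_. 0)) (at x)"
    proof (rule has_derivative_transform_within_open[of "\<lambda>_. 0" _ _ _ "- ?C"])
      show "0 = \<phi> y" if "y \<in> - ?C" for y using that test_functionD(5)[OF assms, of y] by (metis ComplD)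
    qed (use that in auto)
    then show ?thesis by (rule partial_eqI[THEN trans]) simp
  qed
  have "{x. partial i \<phi> x \<noteq> 0} \<subseteq> ?C" using z by blast
  then have sub: "closure {x. partial i \<phi> x \<noteq> 0} \<subseteq> ?C" by (rule closure_minimal) simp
  then have "compact (closure {x. partial i \<phi> x \<noteq> 0})"
    using test_functionD(3)[OF assms] bounded_subset compact_eq_bounded_closed by blast
  then show "test_function U (partial i \<phi>)"
    using sub test_functionD(1,4)[OF assms] smooth_partial unfolding test_function_def by blast
qed

lemma test_function_mult:
  assumes "test_function U \<phi>" "smooth \<zeta>" shows "test_function U (\<lambda>x. \<zeta> x * \<phi> x)"
proof -
  have "{x. \<zeta> x * \<phi> x \<noteq> 0} \<subseteq> {x. \<phi> x \<noteq> 0}" by auto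
  then have sub: "closure {x. \<zeta> x * \<phi> x \<noteq> 0} \<subseteq> closure {x. \<phi> x \<noteq> 0}" by (rule closure_mono)
  then have "compact (closure {x. \<zeta> x * \<phi> x \<noteq> 0})"
    using test_functionD(3)[OF assms(1)] bounded_subset compact_eq_bounded_closed by blast
  then show ?thesis
    using sub test_functionD(1,4)[OF assms(1)] smooth_mult[OF assms(2)] unfolding test_function_def by blast
qed

lemma test_function_integral:
  assumes \<phi>: "test_function U \<phi>" and U: "open U"
  shows "integrable lebesgue \<phi>" "set_integrable lebesgue U \<phi>" "(LINT x:U|lebesgue. \<phi> x) = (LINT x|lebesgue. \<phi> x)"
proof -
  let ?C = "closure {x. \<phi> x \<noteq> 0}"
  have "set_integrable lebesgue ?C \<phi>"
    by (intro L2_on_integrable(1) continuous_L2_on bounded_emeasure_lebesgue test_functionD[OF \<phi>]) auto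
  moreover have C: "indicator ?C x *\<^sub>R \<phi> x = \<phi> x" for x
    using closure_subset[of "{x. \<phi> x \<noteq> 0}"] by (auto simp: indicator_def)
  ultimately show i: "integrable lebesgue \<phi>" by (simp add: set_integrable_def)
  have V: "indicator U x *\<^sub>R \<phi> x = \<phi> x" for x
    using closure_subset[of "{x. \<phi> x \<noteq> 0}"] test_functionD(4)[OF \<phi>] by (auto simp: indicator_def)
  show "set_integrable lebesgue U \<phi>" "(LINT x:U|lebesgue. \<phi> x) = (LINT x|lebesgue. \<phi> x)"
    using i V by (simp_all add: set_integrable_def set_lebesgue_integral_def)
qed

lemma lebesgue_integral_translate:
  fixes f :: "'a::euclidean_space \<Rightarrow> complex"
  assumes "f \<in> borel_measurable borel"
  shows "(LINT x|lebesgue. f (c + x)) = (LINT x|lebesgue. f x)"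
proof -
  have m: "(\<lambda>x. f (c + x)) \<in> borel_measurable borel"
    by (intro measurable_compose[OF _ assms]) measurable
  have "(LINT x|lebesgue. f (c + x)) = (LINT x|lborel. f (c + x))"
    using m by (intro integral_completion) simp
  also have "\<dots> = (LINT x|distr lborel borel ((+) c). f x)"
    using assms by (intro integral_distr[symmetric]) auto
  also have "\<dots> = (LINT x|lebesgue. f x)"
    using assms by (simp add: lborel_distr_plus integral_completion)
  finally show ?thesis .
qed

lemma lebesgue_integrable_translate:
  fixes f :: "'a::euclidean_space \<Rightarrow> complex"
  assumes f: "f \<in> borel_measurable borel" and i: "integrable lebesgue f"
  shows "integrable lebesgue (\<lambda>x. f (c + x))"
proof -
  have m: "(\<lambda>x. f (c + x)) \<in> borel_measurable borel"
    by (intro measurable_compose[OF _ f]) measurable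
  have "integrable (distr lborel borel ((+) c)) f"
    using i f by (simp add: lborel_distr_plus integrable_completion)
  then have "integrable lborel (\<lambda>x. f (c + x))"
    using f by (subst (asm) integrable_distr_eq) auto
  then show ?thesis using m by (simp add: integrable_completion)
qed

lemma partial_has_vector_derivative:
  assumes "smooth f"
  shows "((\<lambda>t. f (x + t *\<^sub>R axis i 1)) has_vector_derivative partial i f (x + t *\<^sub>R axis i 1)) (at t within T)"
proof -
  have "((\<lambda>t. x + t *\<^sub>R axis i 1) has_derivative (\<lambda>h. h *\<^sub>R axis i 1)) (at t within T)"
    by (auto intro!: derivative_eq_intros)
  from has_derivative_compose[OF this smooth_has_derivative[OF assms]]
  have "((\<lambda>t. f (x + t *\<^sub>R axis i 1)) has_derivative
      (\<lambda>h. frechet_derivative f (at (x + t *\<^sub>R axis i 1)) (h *\<^sub>R axis i 1))) (at t within T)" .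
  moreover have "frechet_derivative f (at y) (h *\<^sub>R axis i 1) = h *\<^sub>R partial i f y" for h y
    using linear_scale[OF linear_frechet_derivative[OF smooth_differentiable[OF assms]]]
    by (simp add: partial_def)
  ultimately show ?thesis by (simp add: has_vector_derivative_def)
qed

text \<open>By translation invariance the difference quotients have integral \<open>0\<close>.\<close>

lemma integral_partial_eq_0:
  fixes \<psi> :: "real ^ 'n::finite \<Rightarrow> complex"
  assumes t: "test_function UNIV \<psi>"
  shows "(LINT x|lebesgue. partial i \<psi> x) = 0"
proof -
  have s: "smooth \<psi>" by (rule test_functionD(1)[OF t])
  have t': "test_function UNIV (partial i \<psi>)" by (rule test_function_partial(1)[OF t])
  obtain K where K: "\<And>x. norm (partial i \<psi> x) \<le> K" using test_functionD(6)[OF t'] by blast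
  obtain R where R: "\<And>x. x \<in> closure {x. \<psi> x \<noteq> 0} \<Longrightarrow> norm x \<le> R"
    using test_functionD(3)[OF t] by (auto simp: bounded_iff)
  have z: "\<psi> x = 0" if "R < norm x" for x
    using R[of x] that test_functionD(5)[OF t, of x] by linarith
  let ?e = "axis i 1 :: real ^ 'n"
  let ?D = "\<lambda>n x. real (Suc n) *\<^sub>R (\<psi> ((1 / real (Suc n)) *\<^sub>R ?e + x) - \<psi> x)"
  have ctn: "continuous_on UNIV \<psi>" "continuous_on UNIV (partial i \<psi>)"
    by (rule test_functionD(2)[OF t], rule test_functionD(2)[OF t'])
  have bm: "\<psi> \<in> borel_measurable borel" "partial i \<psi> \<in> borel_measurable borel"
    using ctn by (auto intro: borel_measurable_continuous_onI)
  have ctD: "continuous_on UNIV (?D n)" for n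
    by (intro continuous_intros continuous_on_compose2[OF ctn(1)]) auto
  \<comment> \<open>Mean value bound along one axis: it dominates all difference quotients by
    \<open>K\<close> at once.\<close>
  have lip: "norm (\<psi> (x + r *\<^sub>R ?e) - \<psi> x) \<le> K * r" if "0 \<le> r" for x r
  proof -
    have "norm ((\<lambda>t. \<psi> (x + t *\<^sub>R ?e)) r - (\<lambda>t. \<psi> (x + t *\<^sub>R ?e)) 0) \<le> K * norm (r - 0)"
    proof (rule differentiable_bound[of UNIV])
      show "((\<lambda>t. \<psi> (x + t *\<^sub>R ?e)) has_derivative (\<lambda>h. h *\<^sub>R partial i \<psi> (x + t *\<^sub>R ?e))) (at t within UNIV)" for t
        using partial_has_vector_derivative[OF s] unfolding has_vector_derivative_def .
      show "onorm (\<lambda>h. h *\<^sub>R partial i \<psi> (x + t *\<^sub>R ?e)) \<le> K" for t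
        using mult_right_mono[OF K abs_ge_zero] by (intro onorm_le) (simp add: mult.commute)
    qed auto
    then show ?thesis using that by simp
  qed
  have "(\<lambda>n. LINT x|lebesgue. ?D n x) \<longlonglongrightarrow> (LINT x|lebesgue. partial i \<psi> x)"
  proof (rule integral_dominated_convergence)
    \<comment> \<open>\<open>R\<close> bounds the support of \<open>\<psi>\<close>; the shifts have
      length at most 1, so every difference quotient vanishes outside the ball of radius
      \<open>R + 1\<close>.\<close>
    show "integrable lebesgue (\<lambda>x :: real ^ 'n. indicator (cball 0 (R + 1)) x *\<^sub>R K)"
      by (intro integrable_scaleR_left impI integrable_real_indicator)
        (use emeasure_lborel_cball_finite[of "0 :: real ^ 'n" "R + 1"] in auto)
    show "partial i \<psi> \<in> borel_measurable lebesgue" using bm by (simp add: measurable_completion)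
    show "?D n \<in> borel_measurable lebesgue" for n
      using ctD[of n] by (simp add: measurable_completion borel_measurable_continuous_onI)
    show "AE x in lebesgue. (\<lambda>n. ?D n x) \<longlonglongrightarrow> partial i \<psi> x"
    proof (rule always_eventually, rule allI)
      fix x
      have "((\<lambda>t. (\<psi> (x + t *\<^sub>R ?e) - \<psi> x) /\<^sub>R t) \<longlongrightarrow> partial i \<psi> x) (at 0)"
      proof -
        have A: "((\<lambda>t. norm (\<psi> (x + t *\<^sub>R ?e) - \<psi> x - t *\<^sub>R partial i \<psi> x) / norm t) \<longlongrightarrow> 0) (at 0)"
          using partial_has_vector_derivative[OF s, of x i 0 UNIV]
          by (simp add: has_vector_derivative_def has_derivative_at)
        have B: "norm (\<psi> (x + t *\<^sub>R ?e) - \<psi> x - t *\<^sub>R partial i \<psi> x) / norm t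
            = norm ((\<psi> (x + t *\<^sub>R ?e) - \<psi> x) /\<^sub>R t - partial i \<psi> x)" if "t \<noteq> 0" for t
        proof -
          have "(\<psi> (x + t *\<^sub>R ?e) - \<psi> x - t *\<^sub>R partial i \<psi> x) /\<^sub>R t = (\<psi> (x + t *\<^sub>R ?e) - \<psi> x) /\<^sub>R t - partial i \<psi> x"
            using that by (simp add: scaleR_diff_right)
          then have "norm ((\<psi> (x + t *\<^sub>R ?e) - \<psi> x) /\<^sub>R t - partial i \<psi> x)
              = norm ((\<psi> (x + t *\<^sub>R ?e) - \<psi> x - t *\<^sub>R partial i \<psi> x) /\<^sub>R t)" by (simp only:)
          then show ?thesis unfolding norm_scaleR norm_inverse real_norm_def abs_inverse by (simp add: divide_inverse_commute)
        qed
        have "((\<lambda>t. norm ((\<psi> (x + t *\<^sub>R ?e) - \<psi> x) /\<^sub>R t - partial i \<psi> x)) \<longlongrightarrow> 0) (at 0)"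
        proof (rule Lim_transform_eventually[OF A])
          show "\<forall>\<^sub>F t in at 0. norm (\<psi> (x + t *\<^sub>R ?e) - \<psi> x - t *\<^sub>R partial i \<psi> x) / norm t
              = norm ((\<psi> (x + t *\<^sub>R ?e) - \<psi> x) /\<^sub>R t - partial i \<psi> x)"
            unfolding eventually_at_filter by (intro always_eventually allI impI B)
        qed
        then show ?thesis by (rule LIM_zero_cancel[OF tendsto_norm_zero_cancel])
      qed
      moreover have "filterlim (\<lambda>n. 1 / real (Suc n)) (at 0) sequentially"
        unfolding filterlim_at
      proof
        show "(\<lambda>n. 1 / real (Suc n)) \<longlonglongrightarrow> 0" by (rule LIMSEQ_Suc[OF lim_1_over_n])
      qed (simp del: of_nat_Suc)
      ultimately have "(\<lambda>n. (\<psi> (x + (1 / real (Suc n)) *\<^sub>R ?e) - \<psi> x) /\<^sub>R (1 / real (Suc n))) \<longlonglongrightarrow> partial i \<psi> x"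
        by (rule filterlim_compose)
      then show "(\<lambda>n. ?D n x) \<longlonglongrightarrow> partial i \<psi> x"
        by (simp add: add.commute del: of_nat_Suc)
    qed
    show "AE x in lebesgue. norm (?D n x) \<le> indicator (cball 0 (R + 1)) x *\<^sub>R K" for n
    proof (rule always_eventually, rule allI)
      fix x
      let ?r = "1 / real (Suc n)"
      have r: "0 \<le> ?r" "?r \<le> 1" by (auto simp: field_simps)
      show "norm (?D n x) \<le> indicator (cball 0 (R + 1)) x *\<^sub>R K"
      proof (cases "norm x \<le> R + 1")
        case True
        have "norm (?D n x) \<le> real (Suc n) * (K * ?r)"
          unfolding norm_scaleR using lip[OF r(1), of x]
          by (intro mult_mono) (simp_all only: add.commute[of x] abs_of_nat real_norm_def of_nat_0_le_iff norm_ge_zero order_refl)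
        also have "\<dots> = K" by (simp del: of_nat_Suc)
        finally show ?thesis using True by simp
      next
        case False
        have "norm x \<le> norm (?r *\<^sub>R ?e + x) + norm (?r *\<^sub>R ?e)"
          using norm_triangle_ineq2[of "?r *\<^sub>R ?e + x" "?r *\<^sub>R ?e"] norm_triangle_ineq4[of "?r *\<^sub>R ?e + x" "?r *\<^sub>R ?e"] by simp
        moreover have "norm (?r *\<^sub>R ?e) \<le> 1" using r by (simp add: norm_axis_1)
        ultimately have "R < norm (?r *\<^sub>R ?e + x)" "R < norm x" using False by linarith+
        then have "\<psi> (?r *\<^sub>R ?e + x) = 0" "\<psi> x = 0" using z by blast+
        then have "norm (?D n x) = 0" by (simp only: diff_self scaleR_zero_right norm_zero)
        then show ?thesis using False by simp
      qed
    qed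
  qed
  moreover have "(LINT x|lebesgue. ?D n x) = 0" for n
  proof -
    have i0: "integrable lebesgue \<psi>" using test_function_integral(1)[OF t] by simp
    have i1: "integrable lebesgue (\<lambda>x. \<psi> ((1 / real (Suc n)) *\<^sub>R ?e + x))"
      by (rule lebesgue_integrable_translate[OF bm(1) i0])
    show ?thesis using i0 i1 lebesgue_integral_translate[OF bm(1), of "(1 / real (Suc n)) *\<^sub>R ?e"] by simp
  qed
  ultimately show ?thesis by (simp add: LIMSEQ_const_iff)
qed

text \<open>The product \<open>\<zeta> x * \<phi> x\<close> has compact support, so its derivative
  integrates to 0, and the Leibniz rule separates the two terms.\<close>

lemma smooth_has_weak_partial:
  assumes U: "open U" and s: "smooth \<zeta>"
  shows "has_weak_partial U i \<zeta> (partial i \<zeta>)"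
  unfolding has_weak_partial_def
proof (intro allI impI)
  fix \<phi> assume \<phi>: "test_function U \<phi>"
  have t1: "test_function U (\<lambda>x. \<zeta> x * partial i \<phi> x)"
    by (rule test_function_mult[OF test_function_partial(1)[OF \<phi>] s])
  have t2: "test_function U (\<lambda>x. partial i \<zeta> x * \<phi> x)"
    by (rule test_function_mult[OF \<phi> smooth_partial[OF s]])
  have t3: "test_function UNIV (\<lambda>x. \<zeta> x * \<phi> x)"
    using test_function_mult[OF \<phi> s] by (auto simp: test_function_def)
  have "partial i (\<lambda>x. \<zeta> x * \<phi> x) = (\<lambda>x. partial i \<zeta> x * \<phi> x + \<zeta> x * partial i \<phi> x)"
    using s test_functionD(1)[OF \<phi>] by (intro ext partial_mult smooth_differentiable)
  then have "(LINT x|lebesgue. partial i \<zeta> x * \<phi> x + \<zeta> x * partial i \<phi> x) = 0"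
    using integral_partial_eq_0[OF t3, of i] by simp
  then have "(LINT x|lebesgue. \<zeta> x * partial i \<phi> x) = - (LINT x|lebesgue. partial i \<zeta> x * \<phi> x)"
    using test_function_integral(1)[OF t1 U] test_function_integral(1)[OF t2 U]
    by (simp add: eq_neg_iff_add_eq_0 add.commute)
  then show "(LINT x:U|lebesgue. \<zeta> x * partial i \<phi> x) = - (LINT x:U|lebesgue. partial i \<zeta> x * \<phi> x)"
    using test_function_integral(3)[OF t1 U] test_function_integral(3)[OF t2 U] by simp
qed

text \<open>Any square integrable witness makes the Hilbert choice in \<open>weak_partial\<close> a
  genuine weak derivative, and uniqueness identifies the choice with the witness almost everywhere.
  This is how \<open>weak_partial\<close> is computed below.\<close>

lemma weak_partialI:
  assumes "open U" "has_weak_partial U i u g" "L2_on lebesgue U g"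
  shows "has_weak_partial U i u (weak_partial U i u)" "L2_on lebesgue U (weak_partial U i u)"
    "AE x in lebesgue. x \<in> U \<longrightarrow> weak_partial U i u x = g x"
proof -
  show *: "has_weak_partial U i u (weak_partial U i u)" "L2_on lebesgue U (weak_partial U i u)"
    using someI[of "\<lambda>g. has_weak_partial U i u g \<and> L2_on lebesgue U g" g] assms
    unfolding weak_partial_def by blast+
  show "AE x in lebesgue. x \<in> U \<longrightarrow> weak_partial U i u x = g x"
    by (rule has_weak_partial_unique[OF assms(1) * assms(2,3)])
qed

lemma has_weak_partial_diff:
  assumes U: "open U" and u: "L2_on lebesgue U u" "L2_on lebesgue U u'" "L2_on lebesgue U g" "L2_on lebesgue U g'"
    and w: "has_weak_partial U i u g" "has_weak_partial U i u' g'"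
  shows "has_weak_partial U i (\<lambda>x. u x - u' x) (\<lambda>x. g x - g' x)"
  unfolding has_weak_partial_def
proof (intro allI impI)
  fix \<phi> assume \<phi>: "test_function U \<phi>"
  have L: "L2_on lebesgue U \<phi>" "L2_on lebesgue U (partial i \<phi>)"
    by (rule test_function_L2[OF \<phi> U], rule test_function_L2[OF test_function_partial(1)[OF \<phi>] U])
  note I = L2_on_mult_integrable[OF u(1) L(2)] L2_on_mult_integrable[OF u(2) L(2)]
    L2_on_mult_integrable[OF u(3) L(1)] L2_on_mult_integrable[OF u(4) L(1)]
  have "(LINT x:U|lebesgue. u x * partial i \<phi> x) = - (LINT x:U|lebesgue. g x * \<phi> x)"
    "(LINT x:U|lebesgue. u' x * partial i \<phi> x) = - (LINT x:U|lebesgue. g' x * \<phi> x)"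
    using w \<phi> by (auto simp: has_weak_partial_def)
  then show "(LINT x:U|lebesgue. (u x - u' x) * partial i \<phi> x) = - (LINT x:U|lebesgue. (g x - g' x) * \<phi> x)"
    using I by (simp add: left_diff_distrib set_integral_diff(2))
qed

lemma H1_norm_ge:
  fixes U :: "(real ^ 'n::finite) set"
  shows "L2_norm_on lebesgue U u \<le> H1_norm U u" "L2_norm_on lebesgue U (weak_partial U i u) \<le> H1_norm U u"
proof -
  have nn: "0 \<le> (\<Sum>i\<in>UNIV. (L2_norm_on lebesgue U (weak_partial U i u))\<^sup>2)" by (intro sum_nonneg) auto
  show "L2_norm_on lebesgue U u \<le> H1_norm U u"
    unfolding H1_norm_def using nn by (intro real_le_rsqrt) simp
  have "(L2_norm_on lebesgue U (weak_partial U i u))\<^sup>2 \<le> (\<Sum>i\<in>UNIV. (L2_norm_on lebesgue U (weak_partial U i u))\<^sup>2)"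
    by (rule member_le_sum) auto
  then show "L2_norm_on lebesgue U (weak_partial U i u) \<le> H1_norm U u"
    unfolding H1_norm_def by (intro real_le_rsqrt) (simp add: add_increasing)
qed

lemma sobolev1D:
  assumes "sobolev 1 U u" "open U"
  shows "L2_on lebesgue U u" "has_weak_partial U i u (weak_partial U i u)" "L2_on lebesgue U (weak_partial U i u)"
proof -
  obtain g where g: "has_weak_partial U i u g" "L2_on lebesgue U g"
    using assms(1) unfolding One_nat_def sobolev.simps by blast
  show "L2_on lebesgue U u" using assms(1) unfolding One_nat_def sobolev.simps by blast
  show "has_weak_partial U i u (weak_partial U i u)" "L2_on lebesgue U (weak_partial U i u)"
    using weak_partialI[OF assms(2) g] by auto
qed

lemma smooth_L2:
  fixes \<phi> :: "real ^ 'n::finite \<Rightarrow> complex"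
  assumes "smooth \<phi>" "bounded U" "open U"
  shows "L2_on lebesgue U \<phi>" "L2_on lebesgue U (partial i \<phi>)"
  using assms by (auto intro!: continuous_L2_on smooth_continuous_on smooth_partial)

lemma weak_partial_smooth:
  fixes \<phi> :: "real ^ 'n::finite \<Rightarrow> complex"
  assumes "smooth \<phi>" "bounded U" "open U"
  shows "AE x in lebesgue. x \<in> U \<longrightarrow> weak_partial U i \<phi> x = partial i \<phi> x"
  by (rule weak_partialI(3)[OF assms(3) smooth_has_weak_partial[OF assms(3,1)] smooth_L2(2)[OF assms]])

lemma smooth_sobolev1:
  fixes \<phi> :: "real ^ 'n::finite \<Rightarrow> complex"
  assumes "smooth \<phi>" "bounded U" "open U"
  shows "sobolev 1 U \<phi>"
  using smooth_L2[OF assms] smooth_has_weak_partial[OF assms(3,1)]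
  unfolding One_nat_def sobolev.simps by blast

text \<open>Passage from the \<open>H1\<close> norm to L1 on a bounded set, the mode of convergence
  in the later limits. The chosen derivative of \<open>u - \<phi> n\<close> agrees with the
  difference of the derivatives only almost everywhere, hence
  \<open>L2_norm_on_cong_AE\<close>.\<close>

lemma H1_approx_L1:
  fixes \<phi> :: "nat \<Rightarrow> real ^ 'n::finite \<Rightarrow> complex"
  assumes U: "bounded U" "open U" and u: "sobolev 1 U u" and s: "\<And>n. smooth (\<phi> n)"
    and lim: "(\<lambda>n. H1_norm U (\<lambda>x. u x - \<phi> n x)) \<longlonglongrightarrow> 0"
  shows "(\<lambda>n. LINT x:U|lebesgue. norm (u x - \<phi> n x)) \<longlonglongrightarrow> 0"
    and "(\<lambda>n. LINT x:U|lebesgue. norm (weak_partial U i u x - partial i (\<phi> n) x)) \<longlonglongrightarrow> 0"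
proof -
  have fin: "U \<in> sets lebesgue" "emeasure lebesgue U < \<infinity>"
    using U bounded_emeasure_lebesgue[of U] by simp_all
  let ?c = "sqrt (measure lebesgue U)"
  have L: "L2_on lebesgue U (\<lambda>x. u x - \<phi> n x)" "L2_on lebesgue U (\<lambda>x. weak_partial U i u x - partial i (\<phi> n) x)" for n
    by (intro L2_on_diff sobolev1D[OF u U(2)] smooth_L2 U s)+
  have lim': "(\<lambda>n. ?c * H1_norm U (\<lambda>x. u x - \<phi> n x)) \<longlonglongrightarrow> 0"
    using tendsto_mult_right_zero[OF lim] .
  have nn: "0 \<le> (LINT x:U|lebesgue. norm (f x))" for f :: "real ^ 'n \<Rightarrow> complex"
    unfolding set_lebesgue_integral_def by (intro integral_nonneg_AE) auto
  have "(LINT x:U|lebesgue. norm (u x - \<phi> n x)) \<le> ?c * H1_norm U (\<lambda>x. u x - \<phi> n x)" for n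
    using L2_on_integrable(2)[OF L(1) fin] H1_norm_ge(1) by (rule order_trans[OF _ mult_left_mono]) auto
  then show "(\<lambda>n. LINT x:U|lebesgue. norm (u x - \<phi> n x)) \<longlonglongrightarrow> 0"
    using nn by (intro tendsto_sandwich[OF _ _ tendsto_const lim']) auto
  have "(LINT x:U|lebesgue. norm (weak_partial U i u x - partial i (\<phi> n) x)) \<le> ?c * H1_norm U (\<lambda>x. u x - \<phi> n x)" for n
  proof -
    have w: "has_weak_partial U i (\<lambda>x. u x - \<phi> n x) (\<lambda>x. weak_partial U i u x - partial i (\<phi> n) x)"
      by (intro has_weak_partial_diff sobolev1D[OF u U(2)] smooth_L2 U s smooth_has_weak_partial)
    note W = weak_partialI[OF U(2) w L(2)]
    have "L2_norm_on lebesgue U (\<lambda>x. weak_partial U i u x - partial i (\<phi> n) x)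
        = L2_norm_on lebesgue U (weak_partial U i (\<lambda>x. u x - \<phi> n x))"
      using W(3) W(2) L(2)[of n] by (intro L2_norm_on_cong_AE) (auto simp: L2_on_def elim!: eventually_mono)
    then show ?thesis
      using L2_on_integrable(2)[OF L(2) fin, of n]
        mult_left_mono[OF H1_norm_ge(2)[of U i "\<lambda>x. u x - \<phi> n x"], of ?c]
      by simp
  qed
  then show "(\<lambda>n. LINT x:U|lebesgue. norm (weak_partial U i u x - partial i (\<phi> n) x)) \<longlonglongrightarrow> 0"
    using nn by (intro tendsto_sandwich[OF _ _ tendsto_const lim']) auto
qed

lemma continuous_hausdorff_L2:
  fixes \<phi> :: "real ^ 'n::finite \<Rightarrow> complex"
  assumes "continuous_on UNIV \<phi>" "bounded S" "closed S" "emeasure hausdorff1 S < \<infinity>"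
  shows "L2_on hausdorff1 S \<phi>"
proof -
  obtain K where K: "\<And>x. x \<in> S \<Longrightarrow> norm (\<phi> x) \<le> K" using continuous_bounded_on[OF assms(1,2)] by blast
  have S: "S \<in> sets hausdorff1" using assms(3) by (simp add: sets_hausdorff1)
  have "\<phi> \<in> borel_measurable hausdorff1"
    using borel_measurable_continuous_onI[OF assms(1)] measurable_cong_sets[OF sets_hausdorff1 refl] by blast
  then have "set_borel_measurable hausdorff1 S \<phi>"
    unfolding set_borel_measurable_def using S by measurable
  then show ?thesis using S assms K by (intro L2_on_bounded)
qed

lemma bounded_frontier: "bounded U \<Longrightarrow> bounded (frontier U)"
  unfolding frontier_def by (meson bounded_closure bounded_subset Diff_subset)

lemma smooth_has_trace:
  fixes \<phi> :: "real ^ 2 \<Rightarrow> complex"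
  assumes s: "smooth \<phi>" and U: "bounded U" "open U" and fin: "emeasure hausdorff1 (frontier U) < \<infinity>"
  shows "has_trace U \<phi> \<phi>"
  unfolding has_trace_def
proof (intro conjI exI[of _ "\<lambda>_. \<phi>"])
  show "sobolev 1 U \<phi>" by (rule smooth_sobolev1[OF s U])
  show "L2_on hausdorff1 (frontier U) \<phi>"
    by (rule continuous_hausdorff_L2) (use U fin s in \<open>auto intro: smooth_continuous_on bounded_frontier\<close>)
  \<comment> \<open>Even for the zero function \<open>weak_partial\<close> is a choice, so the norm
    of the error of the constant approximation is not 0 by mere computation.\<close>
  have "AE x in lebesgue. x \<in> U \<longrightarrow> weak_partial U i (\<lambda>x. 0) x = 0" for i
    using weak_partial_smooth[OF smooth_const[of 0] U, of i] by (simp add: partial_def)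
  then have "L2_norm_on lebesgue U (weak_partial U i (\<lambda>x. 0)) = L2_norm_on lebesgue U (\<lambda>x. 0)" for i
    using weak_partialI(2)[OF U(2) smooth_has_weak_partial[OF U(2) smooth_const[of 0]] smooth_L2(2)[OF smooth_const[of 0] U]]
    by (intro L2_norm_on_cong_AE) (auto simp: L2_on_def set_borel_measurable_def)
  then show "(\<lambda>n. H1_norm U (\<lambda>x. \<phi> x - \<phi> x)) \<longlonglongrightarrow> 0"
    by (simp add: H1_norm_def L2_norm_on_def)
  show "(\<lambda>n. L2_norm_on hausdorff1 (frontier U) (\<lambda>x. \<phi> x - \<phi> x)) \<longlonglongrightarrow> 0"
    by (simp add: L2_norm_on_def)
qed (use s in auto)

text \<open>Take differences of the approximations of \<open>v\<close> and \<open>w\<close>: both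
  tend to the same \<open>g\<close> on the frontier, so their difference tends to 0 there. Finite
  length of the frontier turns the L2 convergence of the traces into L1 convergence.\<close>

lemma equal_traces_approx:
  fixes v w :: "real ^ 2 \<Rightarrow> complex"
  assumes U: "bounded U" "open U" and fin: "emeasure hausdorff1 (frontier U) < \<infinity>"
    and v: "has_trace U v g" and w: "has_trace U w g"
  obtains \<zeta> :: "nat \<Rightarrow> real ^ 2 \<Rightarrow> complex" where "\<And>n. smooth (\<zeta> n)"
    "(\<lambda>n. LINT x:U|lebesgue. norm ((v x - w x) - \<zeta> n x)) \<longlonglongrightarrow> 0"
    "\<And>i. (\<lambda>n. LINT x:U|lebesgue. norm ((weak_partial U i v x - weak_partial U i w x) - partial i (\<zeta> n) x)) \<longlonglongrightarrow> 0"
    "(\<lambda>n. LINT x:frontier U|hausdorff1. norm (\<zeta> n x)) \<longlonglongrightarrow> 0"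
proof -
  obtain \<phi> where \<phi>: "\<And>n. smooth (\<phi> n)" "(\<lambda>n. H1_norm U (\<lambda>x. v x - \<phi> n x)) \<longlonglongrightarrow> 0"
      "(\<lambda>n. L2_norm_on hausdorff1 (frontier U) (\<lambda>x. g x - \<phi> n x)) \<longlonglongrightarrow> 0"
    using v unfolding has_trace_def by blast
  obtain \<psi> where \<psi>: "\<And>n. smooth (\<psi> n)" "(\<lambda>n. H1_norm U (\<lambda>x. w x - \<psi> n x)) \<longlonglongrightarrow> 0"
      "(\<lambda>n. L2_norm_on hausdorff1 (frontier U) (\<lambda>x. g x - \<psi> n x)) \<longlonglongrightarrow> 0"
    using w unfolding has_trace_def by blast
  have sv: "sobolev 1 U v" and sw: "sobolev 1 U w" and g: "L2_on hausdorff1 (frontier U) g"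
    using v w unfolding has_trace_def by blast+
  have finU: "U \<in> sets lebesgue" "emeasure lebesgue U < \<infinity>"
    using U bounded_emeasure_lebesgue[of U] by simp_all
  have F: "frontier U \<in> sets hausdorff1" by (simp add: sets_hausdorff1)
  note H = L2_on_integrable
  have squeeze: "(\<lambda>n. LINT x:A|M. norm (c n x)) \<longlonglongrightarrow> 0"
    if "(\<lambda>n. LINT x:A|M. norm (a n x)) \<longlonglongrightarrow> 0" "(\<lambda>n. LINT x:A|M. norm (b n x)) \<longlonglongrightarrow> 0"
      "\<And>n. set_integrable M A (a n)" "\<And>n. set_integrable M A (b n)" "\<And>n. set_integrable M A (c n)"
      "\<And>n x. norm (c n x) \<le> norm (a n x) + norm (b n x)"
    for M :: "(real ^ 2) measure" and A and a b c :: "nat \<Rightarrow> real ^ 2 \<Rightarrow> complex"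
  proof (rule tendsto_sandwich[OF _ _ tendsto_const])
    show "\<forall>\<^sub>F n in sequentially. 0 \<le> (LINT x:A|M. norm (c n x))"
      unfolding set_lebesgue_integral_def by (intro always_eventually allI integral_nonneg_AE) auto
    show "(\<lambda>n. (LINT x:A|M. norm (a n x)) + (LINT x:A|M. norm (b n x))) \<longlonglongrightarrow> 0"
      using tendsto_add[OF that(1,2)] by simp
    have "(LINT x:A|M. norm (c n x)) \<le> (LINT x:A|M. norm (a n x) + norm (b n x))" for n
      using that(3-6) by (intro set_integral_mono set_integral_add(1) set_integrable_norm)
    also have "\<dots> n = (LINT x:A|M. norm (a n x)) + (LINT x:A|M. norm (b n x))" for n
      using that(3,4) by (intro set_integral_add(2) set_integrable_norm)
    finally show "\<forall>\<^sub>F n in sequentially. (LINT x:A|M. norm (c n x)) \<le> (LINT x:A|M. norm (a n x)) + (LINT x:A|M. norm (b n x))"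
      by auto
  qed
  have tri: "norm ((a - b) - (c - d)) \<le> norm (a - c) + norm (b - d)" for a b c d :: complex
    using norm_triangle_ineq4[of "a - c" "b - d"] by (simp add: algebra_simps)
  show ?thesis
  proof
    show "smooth (\<lambda>x. \<phi> n x - \<psi> n x)" for n by (intro smooth_diff \<phi> \<psi>)
    show "(\<lambda>n. LINT x:U|lebesgue. norm ((v x - w x) - (\<phi> n x - \<psi> n x))) \<longlonglongrightarrow> 0"
      by (rule squeeze[OF H1_approx_L1(1)[OF U sv \<phi>(1,2)] H1_approx_L1(1)[OF U sw \<psi>(1,2)]])
        (intro H(1) L2_on_diff finU sobolev1D[OF sv U(2)] sobolev1D[OF sw U(2)] smooth_L2 U \<phi> \<psi> tri)+
    show "(\<lambda>n. LINT x:U|lebesgue. norm ((weak_partial U i v x - weak_partial U i w x) - partial i (\<lambda>x. \<phi> n x - \<psi> n x) x)) \<longlonglongrightarrow> 0" for i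
    proof -
      have "partial i (\<lambda>x. \<phi> n x - \<psi> n x) x = partial i (\<phi> n) x - partial i (\<psi> n) x" for n x
        by (rule partial_eqI[THEN trans], rule has_derivative_diff; (rule smooth_has_derivative)?)
          (use \<phi> \<psi> in \<open>auto simp: partial_def\<close>)
      then have eq: "partial i (\<lambda>x. \<phi> n x - \<psi> n x) = (\<lambda>x. partial i (\<phi> n) x - partial i (\<psi> n) x)" for n
        by blast
      show ?thesis unfolding eq
        by (rule squeeze[OF H1_approx_L1(2)[OF U sv \<phi>(1,2), of i] H1_approx_L1(2)[OF U sw \<psi>(1,2), of i]])
          (intro H(1) L2_on_diff finU sobolev1D[OF sv U(2)] sobolev1D[OF sw U(2)] smooth_L2 U \<phi> \<psi> tri)+
    qed
    have L: "L2_on hausdorff1 (frontier U) (\<phi> n)" "L2_on hausdorff1 (frontier U) (\<psi> n)" for n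
      using U fin by (auto intro!: continuous_hausdorff_L2 smooth_continuous_on \<phi> \<psi> bounded_frontier)
    let ?c = "sqrt (measure hausdorff1 (frontier U))"
    have *: "(\<lambda>n. LINT x:frontier U|hausdorff1. norm (g x - f n x)) \<longlonglongrightarrow> 0"
      if "(\<lambda>n. L2_norm_on hausdorff1 (frontier U) (\<lambda>x. g x - f n x)) \<longlonglongrightarrow> 0" "\<And>n. L2_on hausdorff1 (frontier U) (f n)"
      for f :: "nat \<Rightarrow> real ^ 2 \<Rightarrow> complex"
    proof (rule tendsto_sandwich[OF _ _ tendsto_const])
      show "(\<lambda>n. ?c * L2_norm_on hausdorff1 (frontier U) (\<lambda>x. g x - f n x)) \<longlonglongrightarrow> 0"
        using tendsto_mult_right_zero[OF that(1)] .
      show "\<forall>\<^sub>F n in sequentially. 0 \<le> (LINT x:frontier U|hausdorff1. norm (g x - f n x))"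
        unfolding set_lebesgue_integral_def by (intro always_eventually allI integral_nonneg_AE) auto
      show "\<forall>\<^sub>F n in sequentially. (LINT x:frontier U|hausdorff1. norm (g x - f n x)) \<le> ?c * L2_norm_on hausdorff1 (frontier U) (\<lambda>x. g x - f n x)"
        by (intro always_eventually allI H(2) L2_on_diff g that F fin)
    qed
    show "(\<lambda>n. LINT x:frontier U|hausdorff1. norm (\<phi> n x - \<psi> n x)) \<longlonglongrightarrow> 0"
    proof (rule squeeze[OF *[OF \<phi>(3) L(1)] *[OF \<psi>(3) L(2)]])
      show "norm (\<phi> n x - \<psi> n x) \<le> norm (g x - \<phi> n x) + norm (g x - \<psi> n x)" for n x
        using norm_triangle_ineq4[of "g x - \<psi> n x" "g x - \<phi> n x"] by simp
    qed (intro H(1) L2_on_diff g L F fin)+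
  qed
qed

section \<open>Length of Lipschitz curves\<close>

text \<open>Cut \<open>{a..b}\<close> into \<open>N\<close> equal cells, with \<open>N\<close> large
  enough for images of diameter at most \<open>\<delta>\<close>; the sum of \<open>N\<close> bounds
  \<open>L * d\<close> on the diameters does not depend on \<open>N\<close>.\<close>

lemma hausdorff1_pre_lipschitz_le:
  fixes f :: "real \<Rightarrow> 'a::metric_space"
  assumes f: "L-lipschitz_on {a..b} f" and ab: "a \<le> b" and \<delta>: "0 < \<delta>"
  shows "hausdorff1_pre \<delta> (f ` {a..b}) \<le> ennreal (L * (b - a))"
proof -
  have L: "0 \<le> L" using f by (rule lipschitz_on_nonneg)
  obtain N where N: "L * (b - a) / \<delta> < real N" using reals_Archimedean2 by blast
  have "0 \<le> L * (b - a) / \<delta>" using L ab \<delta> by simp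
  then have N0: "0 < N" using N by (cases N) auto
  define d where "d = (b - a) / real N"
  have d: "0 \<le> d" "d * real N = b - a" using ab N0 by (auto simp: d_def)
  have Ld: "L * d \<le> \<delta>"
    using N \<delta> N0 by (simp add: d_def field_simps)
  define U where "U n = (if n < N then f ` ({a..b} \<inter> {a + real n * d .. a + real (Suc n) * d}) else {})" for n
  have U: "bounded (U n) \<and> diameter (U n) \<le> L * d" for n
  proof -
    have "dist x y \<le> L * d" if "x \<in> U n" "y \<in> U n" for x y
    proof -
      obtain s t where st: "s \<in> {a..b}" "t \<in> {a..b}" "s \<in> {a + real n * d .. a + real (Suc n) * d}"
          "t \<in> {a + real n * d .. a + real (Suc n) * d}" "x = f s" "y = f t"
        using \<open>x \<in> U n\<close> \<open>y \<in> U n\<close> by (auto simp: U_def split: if_splits)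
      have "dist x y \<le> L * dist s t" using lipschitz_onD[OF f st(1,2)] st by simp
      also have "\<dots> \<le> L * d"
        using st(3,4) L by (intro mult_left_mono) (auto simp: dist_real_def algebra_simps)
      finally show ?thesis .
    qed
    moreover from this have "diameter (U n) \<le> L * d"
      unfolding diameter_def using L d by (auto intro!: cSUP_least)
    ultimately show ?thesis by (auto simp: bounded_two_points)
  qed
  have "f ` {a..b} \<subseteq> (\<Union>n. U n)"
  proof
    fix y assume "y \<in> f ` {a..b}"
    then obtain t where t: "t \<in> {a..b}" "y = f t" by blast
    show "y \<in> (\<Union>n. U n)"
    proof (cases "d = 0")
      case True
      then have "t = a" "a = b" using d t by auto
      then have "y \<in> U 0" using t N0 True by (auto simp: U_def)
      then show ?thesis by blast
    next
      case False
      then have dp: "0 < d" using d by simp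
      \<comment> \<open>The minimum with \<open>N - 1\<close> puts the right end point, whose
        quotient is \<open>N\<close>, into the last cell.\<close>
      define n where "n = min (N - 1) (nat \<lfloor>(t - a) / d\<rfloor>)"
      have nn: "0 \<le> (t - a) / d" using t dp by simp
      have fl: "real (nat \<lfloor>(t - a) / d\<rfloor>) \<le> (t - a) / d" "(t - a) / d < real (nat \<lfloor>(t - a) / d\<rfloor>) + 1"
        using nn by (simp_all add: of_nat_nat)
      have "real n \<le> (t - a) / d" using fl(1) by (simp add: n_def min_def)
      moreover have "(t - a) / d \<le> real (Suc n)"
      proof (cases "nat \<lfloor>(t - a) / d\<rfloor> \<le> N - 1")
        case True then show ?thesis using fl(2) by (simp add: n_def min_def)
      next
        case False
        then have "Suc n = N" using N0 by (simp add: n_def min_def)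
        moreover have "(t - a) / d \<le> real N" using t d dp by (simp add: field_simps)
        ultimately show ?thesis by simp
      qed
      ultimately have "t \<in> {a + real n * d .. a + real (Suc n) * d}" using dp
        by (simp add: field_simps)
      then have "y \<in> U n" using t N0 by (auto simp: U_def n_def)
      then show ?thesis by blast
    qed
  qed
  then have "hausdorff1_pre \<delta> (f ` {a..b}) \<le> (\<Sum>n. ennreal (diameter (U n)))"
    unfolding hausdorff1_pre_def using U Ld by (intro INF_lower) (auto intro: order_trans)
  also have "\<dots> = (\<Sum>n<N. ennreal (diameter (U n)))"
    by (intro suminf_finite) (auto simp: U_def)
  also have "\<dots> \<le> (\<Sum>n<N. ennreal (L * d))"
    using U by (intro sum_mono ennreal_leI) auto
  also have "\<dots> = ennreal (\<Sum>n<N. L * d)"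
    using L d by (intro sum_ennreal) auto
  also have "\<dots> = ennreal (L * (b - a))" using d(2) by (simp add: mult_ac)
  finally show ?thesis .
qed

lemma hausdorff1_outer_lipschitz_le:
  fixes f :: "real \<Rightarrow> 'a::metric_space"
  assumes "L-lipschitz_on {a..b} f" "a \<le> b"
  shows "hausdorff1_outer (f ` {a..b}) \<le> ennreal (L * (b - a))"
  unfolding hausdorff1_outer_def
  by (rule SUP_least) (use hausdorff1_pre_lipschitz_le[OF assms] in auto)

text \<open>Orthonormality of the rows \<open>(p, q)\<close> and \<open>(r, s)\<close> has to be
  turned into that of the columns: \<open>(r, s)\<close> is the determinant
  \<open>p * s - q * r\<close> times \<open>(- q, p)\<close>, and the square of the determinant is
  1.\<close>

lemma orthonormal_expansion_2:
  fixes x e1 e2 :: "real ^ 2"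
  assumes "norm e1 = 1" "norm e2 = 1" "e1 \<bullet> e2 = 0"
  shows "x = (x \<bullet> e1) *\<^sub>R e1 + (x \<bullet> e2) *\<^sub>R e2"
proof -
  have e: "(e1 $ 1)\<^sup>2 + (e1 $ 2)\<^sup>2 = 1" "(e2 $ 1)\<^sup>2 + (e2 $ 2)\<^sup>2 = 1"
      "e1 $ 1 * e2 $ 1 + e1 $ 2 * e2 $ 2 = 0"
    using assms by (simp_all add: norm_eq_1 inner_vec_def sum_2 power2_eq_square)
  define p q r s where "p = e1 $ 1" and "q = e1 $ 2" and "r = e2 $ 1" and "s = e2 $ 2"
  have h: "p\<^sup>2 + q\<^sup>2 = 1" "r\<^sup>2 + s\<^sup>2 = 1" "p * r + q * s = 0" using e by (auto simp: p_def q_def r_def s_def)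
  have t: "p\<^sup>2 + r\<^sup>2 = 1" "q\<^sup>2 + s\<^sup>2 = 1" "p * q + r * s = 0"
  proof -
    have R: "r = - q * (p * s - q * r)" and S: "s = p * (p * s - q * r)" using h by algebra+
    then have D: "(p * s - q * r)\<^sup>2 = 1" using h by algebra
    show "p\<^sup>2 + r\<^sup>2 = 1" using R D h by algebra
    show "q\<^sup>2 + s\<^sup>2 = 1" using S D h by algebra
    show "p * q + r * s = 0" using R S D by algebra
  qed
  have "x $ 1 = (x $ 1 * p + x $ 2 * q) * p + (x $ 1 * r + x $ 2 * s) * r" using t by algebra
  moreover have "x $ 2 = (x $ 1 * p + x $ 2 * q) * q + (x $ 1 * r + x $ 2 * s) * s" using t by algebra
  ultimately show ?thesis
    by (simp add: vec_eq_iff forall_2 inner_vec_def sum_2 p_def q_def r_def s_def)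
qed

text \<open>In each chart the frontier lies on the graph, a Lipschitz image of an interval;
  compactness of the frontier leaves finitely many charts. Finite length makes smooth functions
  square integrable on the frontier, and so their own traces.\<close>

lemma lipschitz_domain_frontier_finite:
  assumes b: "bounded \<Omega>" and l: "lipschitz_domain \<Omega>"
  shows "emeasure hausdorff1 (frontier \<Omega>) < \<infinity>"
proof -
  have op: "open \<Omega>" using l by (simp add: lipschitz_domain_def)
  have "\<exists>r>0. hausdorff1_outer (frontier \<Omega> \<inter> ball p r) < \<infinity>" if p: "p \<in> frontier \<Omega>" for p
  proof -
    obtain e1 e2 r L \<gamma> where e: "norm e1 = 1" "norm e2 = 1" "e1 \<bullet> e2 = 0" and r: "0 < r"
      and \<gamma>: "L-lipschitz_on UNIV (\<gamma> :: real \<Rightarrow> real)"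
      and g: "\<And>x. x \<in> ball p r \<Longrightarrow> x \<in> \<Omega> \<longleftrightarrow> \<gamma> ((x - p) \<bullet> e1) < (x - p) \<bullet> e2"
      using l p unfolding lipschitz_domain_def by meson
    define G where "G t = p + t *\<^sub>R e1 + \<gamma> t *\<^sub>R e2" for t
    have L: "0 \<le> L" using \<gamma> by (rule lipschitz_on_nonneg)
    have cont: "continuous_on UNIV \<gamma>" using \<gamma> by (rule lipschitz_on_continuous_on)
    have lipG: "(1 + L)-lipschitz_on {-r..r} G"
    proof (rule lipschitz_onI)
      fix s t :: real
      have "G s - G t = (s - t) *\<^sub>R e1 + (\<gamma> s - \<gamma> t) *\<^sub>R e2" by (simp add: G_def algebra_simps)
      then have "dist (G s) (G t) \<le> norm ((s - t) *\<^sub>R e1) + norm ((\<gamma> s - \<gamma> t) *\<^sub>R e2)"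
        unfolding dist_norm by (simp only: norm_triangle_ineq)
      also have "\<dots> \<le> dist s t + L * dist s t"
        using lipschitz_onD[OF \<gamma>, of s t] e by (simp add: dist_real_def)
      finally show "dist (G s) (G t) \<le> (1 + L) * dist s t" by (simp add: algebra_simps)
    qed (use L in simp)
    have "frontier \<Omega> \<inter> ball p r \<subseteq> G ` {-r..r}"
    proof
      fix x assume x: "x \<in> frontier \<Omega> \<inter> ball p r"
      define t where "t = (x - p) \<bullet> e1"
      have "x \<notin> \<Omega>" using x op by (simp add: frontier_def interior_open)
      then have ge: "(x - p) \<bullet> e2 \<le> \<gamma> t" using g[of x] x by (simp add: t_def)
      have "\<gamma> t \<le> (x - p) \<bullet> e2"
      proof (rule ccontr)
        assume less: "\<not> \<gamma> t \<le> (x - p) \<bullet> e2"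
        \<comment> \<open>A neighbourhood of a point strictly below the graph that misses
          \<open>\<Omega>\<close>, although \<open>x\<close> lies in the closure.\<close>
        define N where "N = ball p r \<inter> {y. (y - p) \<bullet> e2 < \<gamma> ((y - p) \<bullet> e1)}"
        have "open {y. (y - p) \<bullet> e2 < \<gamma> ((y - p) \<bullet> e1)}"
          by (intro open_Collect_less continuous_intros continuous_on_compose2[OF cont]) auto
        then have "open N" unfolding N_def by (intro open_Int) auto
        moreover have "x \<in> N" using x less by (simp add: N_def t_def)
        moreover have "x \<in> closure \<Omega>" using x by (simp add: frontier_def)
        ultimately obtain y where "y \<in> N" "y \<in> \<Omega>"
          using closure_iff_nhds_not_empty[of x \<Omega>] by blast
        then show False using g[of y] by (simp add: N_def)
      qed
      then have "\<gamma> t = (x - p) \<bullet> e2" using ge by simp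
      then have "x - p = t *\<^sub>R e1 + \<gamma> t *\<^sub>R e2"
        using orthonormal_expansion_2[OF e, of "x - p"] by (simp only: t_def)
      then have "x = G t" unfolding G_def by (metis add.assoc add.commute diff_add_cancel)
      moreover have "\<bar>t\<bar> \<le> norm (x - p) * norm e1" unfolding t_def by (rule Cauchy_Schwarz_ineq2)
      then have "t \<in> {-r..r}" using x e by (simp add: dist_norm norm_minus_commute abs_le_iff)
      ultimately show "x \<in> G ` {-r..r}" by blast
    qed
    then have "hausdorff1_outer (frontier \<Omega> \<inter> ball p r) \<le> hausdorff1_outer (G ` {-r..r})"
      by (rule hausdorff1_outer_mono)
    also have "\<dots> \<le> ennreal ((1 + L) * (r - - r))"
      using r by (intro hausdorff1_outer_lipschitz_le lipG) simp
    also have "\<dots> < \<infinity>" by simp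
    finally show ?thesis using r by blast
  qed
  then obtain r where r: "\<And>p. p \<in> frontier \<Omega> \<Longrightarrow> 0 < r p \<and> hausdorff1_outer (frontier \<Omega> \<inter> ball p (r p)) < \<infinity>"
    by metis
  have cF: "compact (frontier \<Omega>)" using bounded_frontier[OF b] by (simp add: compact_eq_bounded_closed)
  have cov: "frontier \<Omega> \<subseteq> (\<Union>p\<in>frontier \<Omega>. ball p (r p))" using r by force
  obtain C where C: "C \<subseteq> frontier \<Omega>" "finite C" "frontier \<Omega> \<subseteq> (\<Union>p\<in>C. ball p (r p))"
    by (rule compactE_image[OF cF _ cov]) auto
  have fs: "hausdorff1_outer (\<Union>p\<in>D. frontier \<Omega> \<inter> ball p (r p)) < \<infinity>" if "finite D" "D \<subseteq> C" for D
    using that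
  proof (induction D)
    case empty show ?case by (simp add: hausdorff1_outer_empty)
  next
    case (insert p D)
    have "hausdorff1_outer (\<Union>p\<in>insert p D. frontier \<Omega> \<inter> ball p (r p))
        \<le> hausdorff1_outer (frontier \<Omega> \<inter> ball p (r p)) + hausdorff1_outer (\<Union>p\<in>D. frontier \<Omega> \<inter> ball p (r p))"
      using hausdorff1_outer_Un[of "frontier \<Omega> \<inter> ball p (r p)"] by simp
    also have "\<dots> < \<infinity>" using insert r[of p] C(1) by (simp add: ennreal_add_less_top subset_iff)
    finally show ?case .
  qed
  have "frontier \<Omega> = (\<Union>p\<in>C. frontier \<Omega> \<inter> ball p (r p))" using C by blast
  then have "hausdorff1_outer (frontier \<Omega>) < \<infinity>" using fs[OF C(2) subset_refl] by simp
  then show ?thesis by (subst emeasure_hausdorff1) auto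
qed

text \<open>The map sending \<open>t\<close> to \<open>t *\<^sub>R e\<close> is an isometry, so a
  covering of \<open>A\<close> pulls back to a covering by intervals no longer than the diameters.
  The mesh bound 1 is arbitrary: \<open>hausdorff1_pre\<close> for any positive mesh is below the
  outer measure.\<close>

lemma emeasure_lborel_le_hausdorff1:
  fixes e :: "'a::real_normed_vector" and A :: "'a set"
  assumes e: "norm e = 1" and A: "A \<in> sets borel"
  shows "emeasure lborel {t. t *\<^sub>R e \<in> A} \<le> emeasure hausdorff1 A"
proof -
  have "emeasure lborel {t. t *\<^sub>R e \<in> A} \<le> hausdorff1_pre 1 A"
    unfolding hausdorff1_pre_def
  proof (rule INF_greatest, clarsimp)
    fix U :: "nat \<Rightarrow> 'a set"
    assume U: "A \<subseteq> (\<Union>n. U n)" "\<forall>n. bounded (U n) \<and> diameter (U n) \<le> 1"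
    define T where "T n = {t. t *\<^sub>R e \<in> U n}" for n
    have dist: "\<bar>s - t\<bar> \<le> diameter (U n)" if "s \<in> T n" "t \<in> T n" for s t n
    proof -
      have "dist (s *\<^sub>R e) (t *\<^sub>R e) \<le> diameter (U n)"
        using U(2) that by (intro diameter_bounded_bound) (auto simp: T_def)
      moreover have "dist (s *\<^sub>R e) (t *\<^sub>R e) = \<bar>s - t\<bar>"
        using e by (simp add: dist_norm flip: scaleR_diff_left)
      ultimately show ?thesis using e by simp
    qed
    \<comment> \<open>\<open>T n\<close> need not be measurable, so it is enclosed in an interval
      that starts at its infimum; the empty set, whose infimum is meaningless, is treated
      apart.\<close>
    have "\<exists>I. I \<in> sets lborel \<and> T n \<subseteq> I \<and> emeasure lborel I \<le> ennreal (diameter (U n))" for n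
    proof (cases "T n = {}")
      case True then show ?thesis by (intro exI[of _ "{}"]) auto
    next
      case False
      then obtain t0 where t0: "t0 \<in> T n" by blast
      have bdd: "bdd_below (T n)"
        using dist[OF t0] by (intro bdd_belowI[of _ "t0 - diameter (U n)"]) (force simp: abs_le_iff)
      have "t \<in> {Inf (T n) .. Inf (T n) + diameter (U n)}" if t: "t \<in> T n" for t
      proof -
        have "t - diameter (U n) \<le> Inf (T n)"
          using dist[OF t] by (intro cInf_greatest[OF False]) (force simp: abs_le_iff)
        then show ?thesis using cInf_lower[OF t bdd] by simp
      qed
      moreover have "0 \<le> diameter (U n)" using U(2) diameter_ge_0 by blast
      ultimately show ?thesis
        by (intro exI[of _ "{Inf (T n) .. Inf (T n) + diameter (U n)}"]) auto
    qed
    then obtain I where I: "\<And>n. I n \<in> sets lborel" "\<And>n. T n \<subseteq> I n"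
        "\<And>n. emeasure lborel (I n) \<le> ennreal (diameter (U n))" by metis
    have "{t. t *\<^sub>R e \<in> A} \<subseteq> (\<Union>n. I n)" using U(1) I(2) unfolding T_def by blast
    then have "emeasure lborel {t. t *\<^sub>R e \<in> A} \<le> emeasure lborel (\<Union>n. I n)"
      using I(1) by (intro emeasure_mono) auto
    also have "\<dots> \<le> (\<Sum>n. emeasure lborel (I n))"
      using I(1) by (intro emeasure_subadditive_countably) auto
    also have "\<dots> \<le> (\<Sum>n. ennreal (diameter (U n)))" using I(3) by (intro suminf_le) auto
    finally show "emeasure lborel {t. t *\<^sub>R e \<in> A} \<le> (\<Sum>n. ennreal (diameter (U n)))" .
  qed
  also have "\<dots> \<le> hausdorff1_outer A"
    unfolding hausdorff1_outer_def by (rule SUP_upper) auto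
  finally show ?thesis using A by (simp add: emeasure_hausdorff1)
qed

text \<open>The image of Lebesgue measure on the line under scaling of \<open>e\<close> is dominated
  by \<open>hausdorff1\<close>. This brings boundary integrals, in which traces converge, back to
  ordinary integrals along a side of the sector.\<close>

lemma segment_integral_le_hausdorff1:
  fixes e :: "'a::real_normed_vector" and f :: "'a \<Rightarrow> real"
  assumes e: "norm e = 1" and f: "continuous_on UNIV f" "\<And>x. 0 \<le> f x"
    and S: "S \<in> sets borel" "\<And>t. 0 < t \<Longrightarrow> t < h \<Longrightarrow> t *\<^sub>R e \<in> S"
    and i: "set_integrable hausdorff1 S f"
  shows "integral {0..h} (\<lambda>t. f (t *\<^sub>R e)) \<le> (LINT x:S|hausdorff1. f x)"
proof -
  have ct: "continuous_on UNIV (\<lambda>t. f (t *\<^sub>R e))"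
    by (intro continuous_on_compose2[OF f(1)] continuous_intros) auto
  let ?E = "\<lambda>t. t *\<^sub>R e"
  have mE: "?E \<in> borel_measurable borel" by (intro borel_measurable_continuous_onI continuous_intros)
  have mf: "f \<in> borel_measurable borel" using f(1) by (rule borel_measurable_continuous_onI)
  have "(\<integral>\<^sup>+t\<in>{0<..<h}. ennreal (f (?E t)) \<partial>lborel) \<le> (\<integral>\<^sup>+t. ennreal (indicator S (?E t) * f (?E t)) \<partial>lborel)"
    using S(2) by (intro nn_integral_mono) (auto simp: indicator_def)
  also have "\<dots> = (\<integral>\<^sup>+x. ennreal (indicator S x * f x) \<partial>distr lborel borel ?E)"
    using mE mf S(1) by (subst nn_integral_distr) auto
  also have "\<dots> \<le> (\<integral>\<^sup>+x. ennreal (indicator S x * f x) \<partial>hausdorff1)"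
  proof (rule nn_integral_mono_measure)
    show sets_eq: "sets (distr lborel borel ?E) = sets hausdorff1" by (simp add: sets_hausdorff1)
    show "distr lborel borel ?E \<le> hausdorff1"
    proof -
      have "emeasure (distr lborel borel ?E) A \<le> emeasure hausdorff1 A" for A
      proof (cases "A \<in> sets borel")
        case True
        then show ?thesis using mE emeasure_lborel_le_hausdorff1[OF e True] by (simp add: emeasure_distr vimage_def)
      next
        case False
        then show ?thesis by (simp add: emeasure_notin_sets)
      qed
      then show ?thesis
        unfolding le_measure_iff by (simp add: sets_hausdorff1 space_hausdorff1 le_fun_def)
    qed
  qed
  also have "\<dots> = ennreal (LINT x:S|hausdorff1. f x)"
    unfolding set_lebesgue_integral_def using i f(2)
    by (subst nn_integral_eq_integral) (auto simp: set_integrable_def)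
  finally have le: "(\<integral>\<^sup>+t\<in>{0<..<h}. ennreal (f (?E t)) \<partial>lborel) \<le> ennreal (LINT x:S|hausdorff1. f x)" .
  have "((\<lambda>t. f (?E t)) has_integral (integral {0..h} (\<lambda>t. f (?E t)))) {0..h}"
    by (intro integrable_integral integrable_continuous_interval continuous_on_subset[OF ct]) auto
  then have "((\<lambda>t. f (?E t)) has_integral (integral {0..h} (\<lambda>t. f (?E t)))) {0<..<h}"
    by (simp add: has_integral_Icc_iff_Ioo)
  from nn_integral_has_integral_lebesgue[OF _ this] f(2)
  have "ennreal (integral {0..h} (\<lambda>t. f (?E t))) = (\<integral>\<^sup>+t. ennreal (indicator {0<..<h} t * f (?E t)) \<partial>lborel)"
    by simp
  also have "\<dots> = (\<integral>\<^sup>+t\<in>{0<..<h}. ennreal (f (?E t)) \<partial>lborel)"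
    by (intro nn_integral_cong) (simp add: indicator_def)
  finally have "ennreal (integral {0..h} (\<lambda>t. f (?E t))) \<le> ennreal (LINT x:S|hausdorff1. f x)" using le by simp
  moreover have "0 \<le> (LINT x:S|hausdorff1. f x)"
    unfolding set_lebesgue_integral_def using f(2) by (intro integral_nonneg_AE) auto
  ultimately show ?thesis by (simp add: ennreal_le_iff)
qed

section \<open>Polar coordinates in a sector\<close>

definition polar :: "real \<Rightarrow> real \<Rightarrow> real ^ 2" where
  "polar r \<theta> = (r * cos \<theta>) *\<^sub>R axis 1 1 + (r * sin \<theta>) *\<^sub>R axis 2 1"

definition to_complex :: "real ^ 2 \<Rightarrow> complex" where
  "to_complex x = Complex (x $ 1) (x $ 2)"

lemma polar_nth [simp]: "polar r \<theta> $ 1 = r * cos \<theta>" "polar r \<theta> $ 2 = r * sin \<theta>"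
  by (simp_all add: polar_def axis_def)

lemma norm_polar [simp]: "norm (polar r \<theta>) = \<bar>r\<bar>"
proof -
  have "(r * cos \<theta>)\<^sup>2 + (r * sin \<theta>)\<^sup>2 = r\<^sup>2 * ((cos \<theta>)\<^sup>2 + (sin \<theta>)\<^sup>2)" by algebra
  then show ?thesis by (simp add: norm_vec_def L2_set_def sum_2)
qed

lemma polar_scaleR: "polar r \<theta> = r *\<^sub>R polar 1 \<theta>"
  by (simp add: vec_eq_iff forall_2)

lemma to_complex_polar [simp]: "to_complex (polar r \<theta>) = of_real r * cis \<theta>"
  by (simp add: to_complex_def complex_eq_iff)

lemma bounded_linear_to_complex: "bounded_linear to_complex"
proof -
  have "to_complex = (\<lambda>x. of_real (x $ 1) + \<i> * of_real (x $ 2))"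
    by (auto simp: to_complex_def complex_eq_iff)
  moreover have "bounded_linear (\<lambda>x::real^2. complex_of_real (x $ 1) + \<i> * of_real (x $ 2))"
    by (intro bounded_linear_add bounded_linear_const_mult
        bounded_linear_compose[OF bounded_linear_of_real bounded_linear_vec_nth])
  ultimately show ?thesis by simp
qed

lemma norm_to_complex [simp]: "norm (to_complex x) = norm x"
  by (simp add: to_complex_def cmod_def norm_vec_def L2_set_def sum_2)

lemma continuous_on_polar: "continuous_on UNIV (\<lambda>(r, \<theta>). polar r \<theta>)"
  unfolding polar_def case_prod_unfold by (intro continuous_intros)

lemma S_sector_altdef:
  "S_sector \<theta>m \<theta>M R = {x. x \<noteq> 0 \<and> \<theta>m < Arg (to_complex x) \<and> Arg (to_complex x) < \<theta>M \<and> norm x < R}"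
  by (auto simp: S_sector_def sector_def to_complex_def)

text \<open>\<open>Arg\<close> is continuous off the nonpositive real axis, and strict bounds on the
  angle within \<open>- pi\<close> and \<open>pi\<close> exclude that axis.\<close>

lemma open_S_sector:
  assumes "- pi \<le> \<theta>m" "\<theta>M \<le> pi"
  shows "open (S_sector \<theta>m \<theta>M R)"
proof -
  have Z: "to_complex x \<noteq> 0" if "x \<noteq> 0" for x
    using that norm_to_complex[of x] by (metis norm_eq_zero)
  have eq: "S_sector \<theta>m \<theta>M R = to_complex -` ({z. z \<notin> \<real>\<^sub>\<le>\<^sub>0} \<inter> Arg -` {\<theta>m<..<\<theta>M}) \<inter> ball 0 R"
  proof (intro set_eqI iffI)
    fix x assume x: "x \<in> S_sector \<theta>m \<theta>M R"
    then have "Arg (to_complex x) < pi" "x \<noteq> 0" using assms by (auto simp: S_sector_altdef)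
    then have "to_complex x \<notin> \<real>\<^sub>\<le>\<^sub>0" using Arg_eq_pi Z
      by (metis complex_nonpos_Reals_iff complex_eq_iff less_irrefl order_le_less zero_complex.simps)
    then show "x \<in> to_complex -` ({z. z \<notin> \<real>\<^sub>\<le>\<^sub>0} \<inter> Arg -` {\<theta>m<..<\<theta>M}) \<inter> ball 0 R"
      using x by (auto simp: S_sector_altdef)
  next
    fix x assume x: "x \<in> to_complex -` ({z. z \<notin> \<real>\<^sub>\<le>\<^sub>0} \<inter> Arg -` {\<theta>m<..<\<theta>M}) \<inter> ball 0 R"
    then have "x \<noteq> 0" using linear_0[OF bounded_linear.linear[OF bounded_linear_to_complex]] by auto
    then show "x \<in> S_sector \<theta>m \<theta>M R" using x by (auto simp: S_sector_altdef)
  qed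
  have "open {z::complex. z \<notin> \<real>\<^sub>\<le>\<^sub>0}" using closed_nonpos_Reals_complex by (simp add: open_closed Compl_eq[symmetric] Collect_neg_eq)
  then have "open ({z. z \<notin> \<real>\<^sub>\<le>\<^sub>0} \<inter> Arg -` {\<theta>m<..<\<theta>M})"
    by (intro continuous_open_preimage continuous_at_imp_continuous_on ballI continuous_at_Arg) auto
  then have "open (to_complex -` ({z. z \<notin> \<real>\<^sub>\<le>\<^sub>0} \<inter> Arg -` {\<theta>m<..<\<theta>M}))"
    by (intro open_vimage linear_continuous_on bounded_linear_to_complex)
  then show ?thesis unfolding eq by auto
qed

lemma S_sector_lebesgue:
  assumes "- pi \<le> \<theta>m" "\<theta>M \<le> pi"
  shows "S_sector \<theta>m \<theta>M R \<in> sets lebesgue"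
  using borel_open[OF open_S_sector[OF assms]] by simp

lemma Arg_of_real_cis: "0 < r \<Longrightarrow> - pi < \<theta> \<Longrightarrow> \<theta> \<le> pi \<Longrightarrow> Arg (of_real r * cis \<theta>) = \<theta>"
  by (intro Arg_unique[of r]) (auto simp: cis_conv_exp mult.commute)

lemma Arg_polar: "0 < r \<Longrightarrow> - pi < \<theta> \<Longrightarrow> \<theta> \<le> pi \<Longrightarrow> Arg (to_complex (polar r \<theta>)) = \<theta>"
  unfolding to_complex_polar by (rule Arg_of_real_cis)

lemma polar_in_S_sector_iff:
  assumes "0 < r" "- pi < \<theta>" "\<theta> \<le> pi"
  shows "polar r \<theta> \<in> S_sector \<theta>m \<theta>M R \<longleftrightarrow> \<theta>m < \<theta> \<and> \<theta> < \<theta>M \<and> r < R"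
proof -
  have "polar r \<theta> \<noteq> 0" using norm_polar[of r \<theta>] assms(1) by (metis abs_of_pos less_irrefl norm_zero)
  then show ?thesis using assms by (auto simp: S_sector_altdef Arg_polar simp del: to_complex_polar)
qed

lemma polar_Arg: "polar (norm x) (Arg (to_complex x)) = x"
proof -
  have "of_real (norm x) * cis (Arg (to_complex x)) = to_complex x"
  proof (cases "x = 0")
    case False
    then have "to_complex x \<noteq> 0" using norm_to_complex[of x] by (metis norm_eq_zero)
    from Arg_eq[OF this] show ?thesis by (simp add: cis_conv_exp mult.commute)
  qed (simp add: to_complex_def complex_eq_iff)
  then have "norm x * cos (Arg (to_complex x)) = x $ 1" "norm x * sin (Arg (to_complex x)) = x $ 2"
    by (simp_all add: to_complex_def complex_eq_iff)
  then show ?thesis by (simp add: vec_eq_iff forall_2)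
qed

lemma bounded_S_sector: "bounded (S_sector \<theta>m \<theta>M R)"
  by (rule bounded_subset[of "ball 0 R"]) (auto simp: S_sector_def)

lemma set_integrable_continuous:
  fixes F :: "'a::euclidean_space \<Rightarrow> 'b::euclidean_space"
  assumes "continuous_on UNIV F" "bounded S" "S \<in> sets lebesgue"
  shows "set_integrable lebesgue S F"
proof -
  obtain a where "S \<subseteq> cbox (-a) a" using bounded_subset_cbox_symmetric[OF assms(2)] by blast
  moreover have "set_integrable lebesgue (cbox (-a) a) F"
    by (intro absolutely_integrable_continuous continuous_on_subset[OF assms(1)]) auto
  ultimately show ?thesis using assms(3) set_integrable_subset by blast
qed

text \<open>A volume preserving relabelling of coordinates: the change of variables is done on
  \<open>real ^ 2\<close>, iterated integration on pairs of reals.\<close>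

lemma has_integral_real2:
  fixes f :: "real ^ 2 \<Rightarrow> real"
  assumes "(f has_integral i) (cbox (vector [a, c]) (vector [b, d]))"
  shows "((\<lambda>(x, y). f (vector [x, y])) has_integral i) (cbox (a, c) (b, d))"
proof -
  let ?g = "\<lambda>(x::real, y::real). vector [x, y] :: real ^ 2"
  let ?h = "\<lambda>x :: real ^ 2. (x $ 1, x $ 2)"
  have g_eq: "?g = (\<lambda>p. fst p *\<^sub>R axis 1 1 + snd p *\<^sub>R axis 2 1)"
    by (auto simp: vec_eq_iff forall_2 axis_def)
  have gbox: "?g ` cbox (p1, p2) (q1, q2) = cbox (vector [p1, p2]) (vector [q1, q2])" for p1 p2 q1 q2
  proof
    show "?g ` cbox (p1, p2) (q1, q2) \<subseteq> cbox (vector [p1, p2]) (vector [q1, q2])"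
      by (auto simp: mem_box_cart forall_2 cbox_Pair_eq)
    show "cbox (vector [p1, p2]) (vector [q1, q2]) \<subseteq> ?g ` cbox (p1, p2) (q1, q2)"
    proof
      fix x :: "real ^ 2" assume "x \<in> cbox (vector [p1, p2]) (vector [q1, q2])"
      then have "(x $ 1, x $ 2) \<in> cbox (p1, p2) (q1, q2)" by (auto simp: mem_box_cart forall_2 cbox_Pair_eq)
      moreover have "x = ?g (x $ 1, x $ 2)" by (simp add: vec_eq_iff forall_2)
      ultimately show "x \<in> ?g ` cbox (p1, p2) (q1, q2)" by (rule rev_image_eqI)
    qed
  qed
  have hg: "?h (?g x) = x" for x by (cases x) simp
  have gh: "?g (?h x) = x" for x by (simp add: vec_eq_iff forall_2)
  have hbox: "?h ` cbox u v = cbox (u $ 1, u $ 2) (v $ 1, v $ 2)" for u v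
  proof -
    have "cbox u v = ?g ` cbox (u $ 1, u $ 2) (v $ 1, v $ 2)" using gh[of u] gh[of v] by (simp add: gbox)
    then show ?thesis using hg by (simp add: image_image case_prod_unfold)
  qed
  have cont: "measure lborel (?g ` cbox u v) = 1 * measure lborel (cbox u v)" for u v
  proof -
    obtain u1 u2 v1 v2 where uv: "u = (u1, u2)" "v = (v1, v2)" by (cases u, cases v)
    show ?thesis
    proof (cases "u1 \<le> v1 \<and> u2 \<le> v2")
      case True
      then have "cbox (vector [u1, u2]) (vector [v1, v2] :: real ^ 2) \<noteq> {}"
        by (simp add: interval_ne_empty_cart forall_2)
      then show ?thesis using True unfolding uv gbox
        by (simp add: content_cbox_cart content_Pair UNIV_2)
    next
      case False
      then have "cbox u v = {}" by (auto simp: uv cbox_Pair_eq)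
      then show ?thesis by simp
    qed
  qed
  have "((\<lambda>x. f (?g x)) has_integral (1 / 1) *\<^sub>R i) (?h ` cbox (vector [a, c]) (vector [b, d]))"
  proof (rule has_integral_twiddle[OF _ hg gh])
    show "continuous (at x) ?g" for x unfolding g_eq by (intro continuous_intros)
    show "\<exists>w z. ?g ` cbox u v = cbox w z" for u v using gbox by (cases u, cases v) blast
    show "\<exists>w z. ?h ` cbox u v = cbox w z" for u v using hbox by blast
  qed (use cont assms in auto)
  then show ?thesis by (simp add: hbox case_prod_unfold)
qed

text \<open>Change of variables on the open box of radii and angles, where the map is injective
  because the angles stay between \<open>- pi\<close> and \<open>pi\<close>; the Jacobian
  determinant is the radius, positive there.\<close>

lemma polar_integral_real:
  fixes F :: "real ^ 2 \<Rightarrow> real"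
  assumes F: "continuous_on UNIV F" and \<theta>: "- pi < \<theta>m" "\<theta>m < \<theta>M" "\<theta>M < pi" and R: "0 < R"
  shows "(F has_integral integral (cbox (0, \<theta>m) (R, \<theta>M)) (\<lambda>(r, \<theta>). r * F (polar r \<theta>))) (S_sector \<theta>m \<theta>M R)"
proof -
  define g where "g y = polar (y $ 1) (y $ 2)" for y :: "real ^ 2"
  define a b :: "real ^ 2" where "a = vector [0, \<theta>m]" and "b = vector [R, \<theta>M]"
  define g' where "g' y h = (h $ 1 * cos (y $ 2) - y $ 1 * sin (y $ 2) * h $ 2) *\<^sub>R axis 1 1
      + (h $ 1 * sin (y $ 2) + y $ 1 * cos (y $ 2) * h $ 2) *\<^sub>R (axis 2 1 :: real ^ 2)" for y h :: "real ^ 2"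
  have D: "y \<in> box a b \<longleftrightarrow> 0 < y $ 1 \<and> y $ 1 < R \<and> \<theta>m < y $ 2 \<and> y $ 2 < \<theta>M" for y
    by (auto simp: a_def b_def mem_box_cart forall_2)
  have der: "(g has_derivative g' y) (at y within box a b)" for y
  proof -
    have n: "((\<lambda>y. y $ i) has_derivative (\<lambda>h. h $ i)) (at y within T)" for i T
      by (rule bounded_linear_imp_has_derivative[OF bounded_linear_vec_nth])
    show ?thesis unfolding g_def[abs_def] polar_def g'_def[abs_def]
      by (rule has_derivative_eq_rhs, (rule derivative_intros n)+)
        (auto simp: algebra_simps)
  qed
  have det: "det (matrix (g' y)) = y $ 1" for y
  proof -
    have "c * (r * c) + r * s * s = r * (s\<^sup>2 + c\<^sup>2)" for r c s :: real by algebra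
    then have "cos (y $ 2) * (y $ 1 * cos (y $ 2)) + y $ 1 * sin (y $ 2) * sin (y $ 2) = y $ 1" by simp
    then show ?thesis by (simp add: det_2 matrix_def g'_def axis_def)
  qed
  have img: "g ` box a b = S_sector \<theta>m \<theta>M R"
  proof
    show "g ` box a b \<subseteq> S_sector \<theta>m \<theta>M R"
      using \<theta> by (auto simp: D g_def polar_in_S_sector_iff)
    show "S_sector \<theta>m \<theta>M R \<subseteq> g ` box a b"
    proof
      fix x assume x: "x \<in> S_sector \<theta>m \<theta>M R"
      let ?y = "vector [norm x, Arg (to_complex x)] :: real ^ 2"
      have "?y \<in> box a b" using x by (auto simp: D S_sector_altdef)
      moreover have "x = g ?y" by (simp add: g_def polar_Arg)
      ultimately show "x \<in> g ` box a b" by (rule rev_image_eqI)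
    qed
  qed
  have inj: "inj_on g (box a b)"
  proof (rule inj_onI)
    fix x y assume xy: "x \<in> box a b" "y \<in> box a b" "g x = g y"
    have "z $ 1 = norm (g z)" "z $ 2 = Arg (to_complex (g z))" if "z \<in> box a b" for z
      using that \<theta> by (auto simp: g_def D Arg_polar simp del: to_complex_polar)
    from this[OF xy(1)] this[OF xy(2)]
    show "x = y" unfolding xy(3) by (simp add: vec_eq_iff forall_2)
  qed
  \<comment> \<open>The rule applied below speaks of values in \<open>real ^ 'n\<close>; multiplying
    by this vector embeds the reals.\<close>
  let ?e = "vec 1 :: real ^ 1"
  let ?G = "\<lambda>y. y $ 1 * F (g y)"
  have cg: "continuous_on UNIV g"
    unfolding g_def[abs_def] polar_def by (intro continuous_intros)
  have cG: "continuous_on UNIV ?G"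
    by (intro continuous_intros continuous_on_compose2[OF F cg]) auto
  have iS: "set_integrable lebesgue (S_sector \<theta>m \<theta>M R) F"
    by (rule set_integrable_continuous[OF F bounded_S_sector]) (use \<theta> in \<open>auto intro: S_sector_lebesgue\<close>)
  have "integral (g ` box a b) (\<lambda>x. F x *\<^sub>R ?e) = integral (box a b) (\<lambda>y. \<bar>det (matrix (g' y))\<bar> *\<^sub>R (F (g y) *\<^sub>R ?e))"
    by (rule integral_change_of_variables[OF _ der inj])
      (use iS in \<open>auto simp: img intro: set_integrable_scaleR_left\<close>)
  also have "\<dots> = integral (box a b) (\<lambda>y. ?G y *\<^sub>R ?e)"
    by (intro integral_cong) (auto simp: D det)
  also have "\<dots> = integral (cbox a b) (\<lambda>y. ?G y *\<^sub>R ?e)"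
    by (rule integral_open_interval)
  finally have eq: "integral (S_sector \<theta>m \<theta>M R) (\<lambda>x. F x *\<^sub>R ?e) = integral (cbox a b) (\<lambda>y. ?G y *\<^sub>R ?e)"
    by (simp add: img)
  have FS: "(F has_integral integral (S_sector \<theta>m \<theta>M R) F) (S_sector \<theta>m \<theta>M R)"
    using iS by (intro integrable_integral set_lebesgue_integral_eq_integral(1))
  have GD: "(?G has_integral integral (cbox a b) ?G) (cbox a b)"
    by (intro integrable_integral integrable_continuous continuous_on_subset[OF cG]) auto
  have "integral (S_sector \<theta>m \<theta>M R) F *\<^sub>R ?e = integral (cbox a b) ?G *\<^sub>R ?e"
    using integral_unique[OF has_integral_scaleR_left[OF FS, of ?e]] integral_unique[OF has_integral_scaleR_left[OF GD, of ?e]] eq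
    by simp
  then have "integral (S_sector \<theta>m \<theta>M R) F = integral (cbox a b) ?G" by (simp add: vec_eq_iff)
  also have "\<dots> = integral (cbox (0, \<theta>m) (R, \<theta>M)) (\<lambda>(x, y). ?G (vector [x, y]))"
    using has_integral_real2[OF GD[unfolded a_def b_def]] by (simp add: integral_unique a_def b_def)
  also have "\<dots> = integral (cbox (0, \<theta>m) (R, \<theta>M)) (\<lambda>(r, \<theta>). r * F (polar r \<theta>))"
    by (simp add: g_def)
  finally show ?thesis using FS by simp
qed

text \<open>The real case applied to each component. Both orders of integration are kept: radius
  outermost for the Poincare inequality and the weight, angle outermost for the kernel.\<close>

lemma polar_integral:
  fixes F :: "real ^ 2 \<Rightarrow> 'b::euclidean_space"
  assumes F: "continuous_on UNIV F" and \<theta>: "- pi < \<theta>m" "\<theta>m < \<theta>M" "\<theta>M < pi" and R: "0 < R"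
  shows "set_integrable lebesgue (S_sector \<theta>m \<theta>M R) F"
    and "(LINT x:S_sector \<theta>m \<theta>M R|lebesgue. F x) = integral {0..R} (\<lambda>r. integral {\<theta>m..\<theta>M} (\<lambda>\<theta>. r *\<^sub>R F (polar r \<theta>)))"
    and "(LINT x:S_sector \<theta>m \<theta>M R|lebesgue. F x) = integral {\<theta>m..\<theta>M} (\<lambda>\<theta>. integral {0..R} (\<lambda>r. r *\<^sub>R F (polar r \<theta>)))"
    and "(LINT x:S_sector \<theta>m \<theta>M R|lebesgue. F x) = integral (cbox (0, \<theta>m) (R, \<theta>M)) (\<lambda>(r, \<theta>). r *\<^sub>R F (polar r \<theta>))"
proof -
  let ?S = "S_sector \<theta>m \<theta>M R" and ?C = "cbox (0, \<theta>m) (R, \<theta>M)"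
  let ?G = "\<lambda>(r, \<theta>). r *\<^sub>R F (polar r \<theta>)"
  show iS: "set_integrable lebesgue ?S F"
    by (rule set_integrable_continuous[OF F bounded_S_sector]) (use \<theta> in \<open>auto intro: S_sector_lebesgue\<close>)
  have cG: "continuous_on UNIV ?G"
    unfolding case_prod_unfold
    by (intro continuous_intros continuous_on_compose2[OF F]
        continuous_on_polar[unfolded case_prod_unfold]) auto
  have "integral ?S F \<bullet> b = integral ?C ?G \<bullet> b" if "b \<in> Basis" for b
  proof -
    have "integral ?S F \<bullet> b = integral ?S (\<lambda>x. F x \<bullet> b)"
      using set_lebesgue_integral_eq_integral(1)[OF iS] by (simp add: integral_component_eq)
    also have "\<dots> = integral ?C (\<lambda>(r, \<theta>). r * (F (polar r \<theta>) \<bullet> b))"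
      by (rule integral_unique[OF polar_integral_real[OF _ \<theta> R]]) (intro continuous_intros F)
    also have "\<dots> = integral ?C (\<lambda>p. ?G p \<bullet> b)" by (simp add: case_prod_unfold)
    also have "\<dots> = integral ?C ?G \<bullet> b"
      by (intro integral_component_eq integrable_continuous continuous_on_subset[OF cG]) auto
    finally show ?thesis .
  qed
  then have "integral ?S F = integral ?C ?G" by (rule euclidean_eqI)
  then show eq: "(LINT x:?S|lebesgue. F x) = integral ?C ?G"
    using set_lebesgue_integral_eq_integral(2)[OF iS] by simp
  have "integral ?C ?G = integral (cbox 0 R) (\<lambda>r. integral (cbox \<theta>m \<theta>M) (\<lambda>\<theta>. ?G (r, \<theta>)))"
    by (rule integral_prod_continuous) (use cG continuous_on_subset in blast)
  then show A: "(LINT x:?S|lebesgue. F x) = integral {0..R} (\<lambda>r. integral {\<theta>m..\<theta>M} (\<lambda>\<theta>. r *\<^sub>R F (polar r \<theta>)))"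
    using eq by simp
  have "integral (cbox 0 R) (\<lambda>r. integral (cbox \<theta>m \<theta>M) (\<lambda>\<theta>. r *\<^sub>R F (polar r \<theta>)))
      = integral (cbox \<theta>m \<theta>M) (\<lambda>\<theta>. integral (cbox 0 R) (\<lambda>r. r *\<^sub>R F (polar r \<theta>)))"
    by (rule integral_swap_continuous) (use cG continuous_on_subset in blast)
  then show "(LINT x:?S|lebesgue. F x) = integral {\<theta>m..\<theta>M} (\<lambda>\<theta>. integral {0..R} (\<lambda>r. r *\<^sub>R F (polar r \<theta>)))"
    using A by simp
qed

lemma smooth_frechet_2:
  fixes q :: "real ^ 2 \<Rightarrow> complex"
  assumes "smooth q"
  shows "frechet_derivative q (at x) v = v $ 1 *\<^sub>R partial 1 q x + v $ 2 *\<^sub>R partial 2 q x"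
proof -
  have l: "linear (frechet_derivative q (at x))"
    by (rule linear_frechet_derivative[OF smooth_differentiable[OF assms]])
  have "v = v $ 1 *\<^sub>R axis 1 1 + v $ 2 *\<^sub>R axis 2 1"
    by (simp add: vec_eq_iff forall_2 axis_def)
  then have "frechet_derivative q (at x) v = frechet_derivative q (at x) (v $ 1 *\<^sub>R axis 1 1 + v $ 2 *\<^sub>R axis 2 1)" by simp
  also have "\<dots> = v $ 1 *\<^sub>R partial 1 q x + v $ 2 *\<^sub>R partial 2 q x"
    by (simp add: linear_add[OF l] linear_scale[OF l] partial_def)
  finally show ?thesis .
qed

lemma smooth_has_vector_derivative_curve:
  fixes q :: "real ^ 2 \<Rightarrow> complex"
  assumes q: "smooth q" and c: "(c has_vector_derivative v) (at t within T)"
  shows "((\<lambda>t. q (c t)) has_vector_derivative (v $ 1 *\<^sub>R partial 1 q (c t) + v $ 2 *\<^sub>R partial 2 q (c t))) (at t within T)"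
proof -
  have "((\<lambda>t. q (c t)) has_derivative (\<lambda>h. frechet_derivative q (at (c t)) (h *\<^sub>R v))) (at t within T)"
    using has_derivative_compose[OF c[unfolded has_vector_derivative_def] smooth_has_derivative[OF q]] .
  then show ?thesis
    unfolding has_vector_derivative_def smooth_frechet_2[OF q] by (simp add: scaleR_add_right)
qed

lemma polar_derivative_radius: "((\<lambda>r. polar r \<theta>) has_vector_derivative polar 1 \<theta>) (at r within T)"
  unfolding polar_def
  by (auto intro!: derivative_eq_intros simp: has_real_derivative_iff_has_vector_derivative[symmetric] mult.commute)

lemma polar_derivative_angle:
  "((\<lambda>\<theta>. polar r \<theta>) has_vector_derivative (- r * sin \<theta>) *\<^sub>R axis 1 1 + (r * cos \<theta>) *\<^sub>R axis 2 1) (at \<theta> within T)"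
  unfolding polar_def
  by (auto intro!: derivative_eq_intros simp: has_real_derivative_iff_has_vector_derivative[symmetric] mult.commute)

lemma smooth_polar_radius:
  fixes q :: "real ^ 2 \<Rightarrow> complex"
  assumes "smooth q"
  shows "((\<lambda>r. q (polar r \<theta>)) has_vector_derivative
      cos \<theta> *\<^sub>R partial 1 q (polar r \<theta>) + sin \<theta> *\<^sub>R partial 2 q (polar r \<theta>)) (at r within T)"
  using smooth_has_vector_derivative_curve[OF assms polar_derivative_radius[of \<theta> r T]] by simp

lemma smooth_polar_angle:
  fixes q :: "real ^ 2 \<Rightarrow> complex"
  assumes "smooth q"
  shows "((\<lambda>\<theta>. q (polar r \<theta>)) has_vector_derivative
      (- r * sin \<theta>) *\<^sub>R partial 1 q (polar r \<theta>) + (r * cos \<theta>) *\<^sub>R partial 2 q (polar r \<theta>)) (at \<theta> within T)"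
  using smooth_has_vector_derivative_curve[OF assms polar_derivative_angle[of r \<theta> T]] by (simp add: axis_def)

lemma continuous_polar_compose:
  assumes "continuous_on UNIV F"
  shows "continuous_on S (\<lambda>p. F (polar (fst p) (snd p)))" "continuous_on T (\<lambda>r. F (polar r \<theta>))"
    "continuous_on T (\<lambda>\<theta>. F (polar r \<theta>))"
  unfolding polar_def by (intro continuous_on_compose2[OF assms] continuous_intros; simp)+

section \<open>Area, decaying weight and Poincare inequality on a sector\<close>

lemma sector_area:
  assumes \<theta>: "- pi < \<theta>m" "\<theta>m < \<theta>M" "\<theta>M < pi" and R: "0 < R"
  shows "measure lebesgue (S_sector \<theta>m \<theta>M R) = (\<theta>M - \<theta>m) * R\<^sup>2 / 2"
proof -
  have fin: "emeasure lebesgue (S_sector \<theta>m \<theta>M R) < \<infinity>"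
    by (rule bounded_emeasure_lebesgue[OF bounded_S_sector S_sector_lebesgue]) (use \<theta> in auto)
  have "measure lebesgue (S_sector \<theta>m \<theta>M R) = (LINT x:S_sector \<theta>m \<theta>M R|lebesgue. 1)"
    using fin S_sector_lebesgue[of \<theta>m \<theta>M R] \<theta> by (subst set_integral_const) auto
  also have "\<dots> = integral {0..R} (\<lambda>r. integral {\<theta>m..\<theta>M} (\<lambda>\<theta>. r *\<^sub>R 1))"
    by (rule polar_integral(2)[OF _ \<theta> R]) auto
  also have "\<dots> = integral {0..R} (\<lambda>r. (\<theta>M - \<theta>m) * r)"
    using \<theta> by (intro integral_cong) simp
  also have "\<dots> = (\<theta>M - \<theta>m) * R\<^sup>2 / 2 - (\<theta>M - \<theta>m) * 0\<^sup>2 / 2"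
    using R by (intro integral_unique fundamental_theorem_of_calculus)
      (auto intro!: derivative_eq_intros simp: has_real_derivative_iff_has_vector_derivative[symmetric])
  finally show ?thesis by simp
qed

text \<open>This weight majorises the errors tested against the kernel; its bound has the size
  \<open>s ^ (-2)\<close> of the main term and is uniform in \<open>R\<close>.\<close>

lemma sector_weight_integral:
  assumes \<theta>: "- pi < \<theta>m" "\<theta>m < \<theta>M" "\<theta>M < pi" and R: "0 < R" and s: "0 < s"
  shows "set_integrable lebesgue (S_sector \<theta>m \<theta>M R) (\<lambda>x. inverse (1 + s * norm x) ^ 3)"
    and "(LINT x:S_sector \<theta>m \<theta>M R|lebesgue. inverse (1 + s * norm x) ^ 3) \<le> (\<theta>M - \<theta>m) / (2 * s\<^sup>2)"
proof -
  have p: "1 + s * norm x \<noteq> 0" for x :: "real ^ 2" using s by (smt (verit) mult_nonneg_nonneg norm_ge_zero)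
  have c: "continuous_on UNIV (\<lambda>x :: real ^ 2. inverse (1 + s * norm x) ^ 3)"
    by (intro continuous_intros) (use p in auto)
  show "set_integrable lebesgue (S_sector \<theta>m \<theta>M R) (\<lambda>x. inverse (1 + s * norm x) ^ 3)"
    by (rule polar_integral(1)[OF c \<theta> R])
  have "(LINT x:S_sector \<theta>m \<theta>M R|lebesgue. inverse (1 + s * norm x) ^ 3)
      = integral {0..R} (\<lambda>r. integral {\<theta>m..\<theta>M} (\<lambda>\<theta>. r *\<^sub>R inverse (1 + s * norm (polar r \<theta>)) ^ 3))"
    by (rule polar_integral(2)[OF c \<theta> R])
  also have "\<dots> = integral {0..R} (\<lambda>r. (\<theta>M - \<theta>m) * (r * inverse (1 + s * r) ^ 3))"
    using \<theta> by (intro integral_cong) simp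
  also have "\<dots> = (\<theta>M - \<theta>m) * (R\<^sup>2 * inverse (1 + s * R) ^ 2 / 2) - (\<theta>M - \<theta>m) * (0\<^sup>2 * inverse (1 + s * 0) ^ 2 / 2)"
  proof (intro integral_unique fundamental_theorem_of_calculus)
    fix r assume r: "r \<in> {0..R}"
    have "1 + s * r > 0" using r s by (smt (verit) atLeastAtMost_iff mult_nonneg_nonneg)
    \<comment> \<open>Since \<open>r * (1 + s * r) - s * r\<^sup>2 = r\<close>, the function
      \<open>r\<^sup>2 / (2 * (1 + s * r)\<^sup>2)\<close> is an antiderivative of the radial
      integrand.\<close>
    then have "((\<lambda>r. (\<theta>M - \<theta>m) * (r\<^sup>2 * inverse (1 + s * r) ^ 2 / 2)) has_real_derivative
        (\<theta>M - \<theta>m) * (r * inverse (1 + s * r) ^ 3)) (at r within {0..R})"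
      by (auto intro!: derivative_eq_intros simp: divide_simps power2_eq_square power3_eq_cube)
        (simp add: algebra_simps)
    then show "((\<lambda>r. (\<theta>M - \<theta>m) * (r\<^sup>2 * inverse (1 + s * r) ^ 2 / 2)) has_vector_derivative
        (\<theta>M - \<theta>m) * (r * inverse (1 + s * r) ^ 3)) (at r within {0..R})"
      by (simp add: has_real_derivative_iff_has_vector_derivative)
  qed (use R in simp)
  also have "\<dots> \<le> (\<theta>M - \<theta>m) / (2 * s\<^sup>2)"
  proof -
    have "R * inverse (1 + s * R) \<le> 1 / s" using R s by (simp add: field_simps add_pos_pos)
    moreover have "0 \<le> R * inverse (1 + s * R)" using R s by (simp add: add_nonneg_nonneg)
    ultimately have "(R * inverse (1 + s * R))\<^sup>2 \<le> (1 / s)\<^sup>2" by (rule power_mono)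
    then have "(\<theta>M - \<theta>m) * ((R * inverse (1 + s * R))\<^sup>2 / 2) \<le> (\<theta>M - \<theta>m) * ((1 / s)\<^sup>2 / 2)"
      using \<theta> by (intro mult_left_mono divide_right_mono) auto
    then show ?thesis by (simp add: power_mult_distrib power_divide)
  qed
  finally show "(LINT x:S_sector \<theta>m \<theta>M R|lebesgue. inverse (1 + s * norm x) ^ 3) \<le> (\<theta>M - \<theta>m) / (2 * s\<^sup>2)" .
qed

text \<open>Integrate along arcs starting at the side \<open>\<theta>m\<close>: the angular
  derivative is at most \<open>r\<close> times the gradient, and this \<open>r\<close> is just the
  Jacobian of the area integral. The factor \<open>R\<close> bounds the Jacobian on the left, and
  the opening angle comes from integrating a bound that does not depend on the angle.\<close>

lemma sector_poincare:
  fixes q :: "real ^ 2 \<Rightarrow> complex"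
  assumes \<theta>: "- pi < \<theta>m" "\<theta>m < \<theta>M" "\<theta>M < pi" and R: "0 < R" and q: "smooth q"
  shows "(LINT x:S_sector \<theta>m \<theta>M R|lebesgue. norm (q x)) \<le> (\<theta>M - \<theta>m) * R *
    (integral {0..R} (\<lambda>r. norm (q (polar r \<theta>m))) +
     (LINT x:S_sector \<theta>m \<theta>M R|lebesgue. norm (partial 1 q x) + norm (partial 2 q x)))"
proof -
  let ?G = "\<lambda>x. norm (partial 1 q x) + norm (partial 2 q x)"
  have cq: "continuous_on UNIV (\<lambda>x. norm (q x))" and cG: "continuous_on UNIV ?G"
    by (intro continuous_intros smooth_continuous_on smooth_partial q)+
  have cGr: "continuous_on T (\<lambda>\<tau>. r *\<^sub>R ?G (polar r \<tau>))" for r T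
    by (intro continuous_intros continuous_polar_compose(3)[OF cG])
  have pw: "norm (q (polar r \<theta>)) \<le> norm (q (polar r \<theta>m)) + integral {\<theta>m..\<theta>M} (\<lambda>\<tau>. r *\<^sub>R ?G (polar r \<tau>))"
    if r: "0 \<le> r" and t: "\<theta> \<in> {\<theta>m..\<theta>M}" for r \<theta>
  proof -
    let ?d = "\<lambda>\<tau>. (- r * sin \<tau>) *\<^sub>R partial 1 q (polar r \<tau>) + (r * cos \<tau>) *\<^sub>R partial 2 q (polar r \<tau>)"
    have ftc: "(?d has_integral q (polar r \<theta>) - q (polar r \<theta>m)) {\<theta>m..\<theta>}"
      using t by (intro fundamental_theorem_of_calculus smooth_polar_angle q) auto
    have "norm (q (polar r \<theta>) - q (polar r \<theta>m)) \<le> integral {\<theta>m..\<theta>} (\<lambda>\<tau>. r *\<^sub>R ?G (polar r \<tau>))"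
      unfolding integral_unique[OF ftc, symmetric]
    proof (rule integral_norm_bound_integral)
      show "?d integrable_on {\<theta>m..\<theta>}" using ftc by blast
      show "(\<lambda>\<tau>. r *\<^sub>R ?G (polar r \<tau>)) integrable_on {\<theta>m..\<theta>}"
        by (intro integrable_continuous_interval cGr)
      fix \<tau>
      have "norm (?d \<tau>) \<le> norm ((- r * sin \<tau>) *\<^sub>R partial 1 q (polar r \<tau>)) + norm ((r * cos \<tau>) *\<^sub>R partial 2 q (polar r \<tau>))"
        by (rule norm_triangle_ineq)
      also have "\<dots> = r * (\<bar>sin \<tau>\<bar> * norm (partial 1 q (polar r \<tau>)) + \<bar>cos \<tau>\<bar> * norm (partial 2 q (polar r \<tau>)))"
        using r by (simp add: abs_mult algebra_simps)
      also have "\<dots> \<le> r * (1 * norm (partial 1 q (polar r \<tau>)) + 1 * norm (partial 2 q (polar r \<tau>)))"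
        using r by (intro mult_left_mono add_mono mult_right_mono) auto
      finally show "norm (?d \<tau>) \<le> r *\<^sub>R ?G (polar r \<tau>)" by simp
    qed
    also have "\<dots> \<le> integral {\<theta>m..\<theta>M} (\<lambda>\<tau>. r *\<^sub>R ?G (polar r \<tau>))"
      using t r by (intro integral_subset_le integrable_continuous_interval cGr) auto
    finally show ?thesis using norm_triangle_sub[of "q (polar r \<theta>)" "q (polar r \<theta>m)"] by linarith
  qed
  let ?J = "\<lambda>r. integral {\<theta>m..\<theta>M} (\<lambda>\<tau>. r *\<^sub>R ?G (polar r \<tau>))"
  have cJ: "continuous_on {0..R} ?J"
  proof -
    have "continuous_on (cbox 0 R \<times> cbox \<theta>m \<theta>M) (\<lambda>(r, \<tau>). r *\<^sub>R ?G (polar r \<tau>))"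
      unfolding case_prod_unfold by (intro continuous_intros continuous_polar_compose(1)[OF cG])
    from integral_continuous_on_param[OF this] show ?thesis by simp
  qed
  have cq': "continuous_on T (\<lambda>r. norm (q (polar r \<theta>m)))" for T by (rule continuous_polar_compose(2)[OF cq])
  have cL: "continuous_on {0..R} (\<lambda>r. integral {\<theta>m..\<theta>M} (\<lambda>\<theta>. r *\<^sub>R norm (q (polar r \<theta>))))"
  proof -
    have "continuous_on (cbox 0 R \<times> cbox \<theta>m \<theta>M) (\<lambda>(r, \<tau>). r *\<^sub>R norm (q (polar r \<tau>)))"
      unfolding case_prod_unfold by (intro continuous_intros continuous_polar_compose(1)[OF cq])
    from integral_continuous_on_param[OF this] show ?thesis by simp
  qed
  have "(LINT x:S_sector \<theta>m \<theta>M R|lebesgue. norm (q x))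
      = integral {0..R} (\<lambda>r. integral {\<theta>m..\<theta>M} (\<lambda>\<theta>. r *\<^sub>R norm (q (polar r \<theta>))))"
    by (rule polar_integral(2)[OF cq \<theta> R])
  also have "\<dots> \<le> integral {0..R} (\<lambda>r. (\<theta>M - \<theta>m) * R * (norm (q (polar r \<theta>m)) + ?J r))"
  proof (rule integral_le)
    show "(\<lambda>r. integral {\<theta>m..\<theta>M} (\<lambda>\<theta>. r *\<^sub>R norm (q (polar r \<theta>)))) integrable_on {0..R}"
      by (rule integrable_continuous_interval[OF cL])
    show "(\<lambda>r. (\<theta>M - \<theta>m) * R * (norm (q (polar r \<theta>m)) + ?J r)) integrable_on {0..R}"
      by (intro integrable_continuous_interval continuous_intros cJ cq')
    fix r assume r: "r \<in> {0..R}"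
    let ?K = "norm (q (polar r \<theta>m)) + ?J r"
    have K0: "0 \<le> ?K" using pw[of r \<theta>m] r \<theta> norm_ge_zero[of "q (polar r \<theta>m)"] by (smt (verit) atLeastAtMost_iff)
    have "integral {\<theta>m..\<theta>M} (\<lambda>\<theta>. r *\<^sub>R norm (q (polar r \<theta>))) \<le> integral {\<theta>m..\<theta>M} (\<lambda>\<theta>. R * ?K)"
    proof (rule integral_le)
      show "(\<lambda>\<theta>. r *\<^sub>R norm (q (polar r \<theta>))) integrable_on {\<theta>m..\<theta>M}"
        by (intro integrable_continuous_interval continuous_intros continuous_polar_compose(3)[OF cq])
      fix t assume t: "t \<in> {\<theta>m..\<theta>M}"
      show "r *\<^sub>R norm (q (polar r t)) \<le> R * ?K"
        unfolding real_scaleR_def using pw[OF _ t, of r] r K0 by (intro mult_mono) auto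
    qed (rule integrable_const_ivl)
    then show "integral {\<theta>m..\<theta>M} (\<lambda>\<theta>. r *\<^sub>R norm (q (polar r \<theta>))) \<le> (\<theta>M - \<theta>m) * R * ?K"
      using \<theta> by (simp add: mult_ac)
  qed
  also have "\<dots> = (\<theta>M - \<theta>m) * R * (integral {0..R} (\<lambda>r. norm (q (polar r \<theta>m))) + integral {0..R} ?J)"
    unfolding integral_mult_right
      integral_add[OF integrable_continuous_interval[OF cq'] integrable_continuous_interval[OF cJ]] ..
  also have "integral {0..R} ?J = (LINT x:S_sector \<theta>m \<theta>M R|lebesgue. ?G x)"
    by (rule polar_integral(2)[OF cG \<theta> R, symmetric])
  finally show ?thesis .
qed

text \<open>In polar coordinates
  \<open>r (\<partial>\<^sub>1 + \<i> \<partial>\<^sub>2) Q = \<partial>\<^sub>r (r exp (\<i> \<theta>) Q) + \<partial>\<^sub>\<theta> (\<i> exp (\<i> \<theta>) Q)\<close>.\<close>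

lemma sector_green:
  fixes Q :: "real ^ 2 \<Rightarrow> complex"
  assumes \<theta>: "- pi < \<theta>m" "\<theta>m < \<theta>M" "\<theta>M < pi" and R: "0 < R" and Q: "smooth Q"
    and z: "\<And>x. norm x = R \<Longrightarrow> Q x = 0"
  shows "norm (LINT x:S_sector \<theta>m \<theta>M R|lebesgue. partial 1 Q x + \<i> * partial 2 Q x)
     \<le> integral {0..R} (\<lambda>r. norm (Q (polar r \<theta>M)) + norm (Q (polar r \<theta>m)))"
proof -
  let ?C = "cbox (0, \<theta>m) (R, \<theta>M)"
  define A where "A r \<theta> = cis \<theta> * (Q (polar r \<theta>) + r *\<^sub>R (cos \<theta> *\<^sub>R partial 1 Q (polar r \<theta>) + sin \<theta> *\<^sub>R partial 2 Q (polar r \<theta>)))" for r \<theta>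
  define B where "B r \<theta> = \<i> * cis \<theta> * ((- r * sin \<theta>) *\<^sub>R partial 1 Q (polar r \<theta>) + (r * cos \<theta>) *\<^sub>R partial 2 Q (polar r \<theta>))
      + \<i> * (\<i> * cis \<theta>) * Q (polar r \<theta>)" for r \<theta>
  note cont = smooth_continuous_on[OF Q, of UNIV] smooth_continuous_on[OF smooth_partial[OF Q], of UNIV]
  have ccis: "continuous_on T (\<lambda>x. cis (f x))" if "continuous_on T f" for T :: "'z::topological_space set" and f
    using that unfolding cis_conv_exp by (intro continuous_intros)
  have cA: "continuous_on UNIV (\<lambda>p. A (fst p) (snd p))" and cB: "continuous_on UNIV (\<lambda>p. B (fst p) (snd p))"
    unfolding A_def B_def by (intro continuous_intros ccis continuous_polar_compose(1) cont)+
  have AB: "r *\<^sub>R (partial 1 Q (polar r \<theta>) + \<i> * partial 2 Q (polar r \<theta>)) = A r \<theta> + B r \<theta>" for r \<theta>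
  proof -
    have c: "cis \<theta> = of_real (cos \<theta>) + \<i> * of_real (sin \<theta>)" by (simp add: complex_eq_iff)
    have "(of_real (cos \<theta>) + \<i> * of_real (sin \<theta>)) * (of_real (cos \<theta>) - \<i> * of_real (sin \<theta>)) = (1 :: complex)"
      using sin_cos_squared_add3[of \<theta>] by (simp add: complex_eq_iff)
    moreover have "(c + \<i> * s) * (q + r * (c * p1 + s * p2)) + (\<i> * (c + \<i> * s) * (- r * s * p1 + r * c * p2)
        + \<i> * (\<i> * (c + \<i> * s)) * q) = r * ((c + \<i> * s) * (c - \<i> * s)) * (p1 + \<i> * p2)" for c s q r p1 p2 :: complex
      by (simp add: algebra_simps)
    ultimately show ?thesis unfolding A_def B_def c scaleR_conv_of_real of_real_mult of_real_minus by simp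
  qed
  have "(LINT x:S_sector \<theta>m \<theta>M R|lebesgue. partial 1 Q x + \<i> * partial 2 Q x) = integral ?C (\<lambda>p. A (fst p) (snd p) + B (fst p) (snd p))"
    by (subst polar_integral(4)[OF _ \<theta> R])
      (auto simp: AB case_prod_unfold intro!: continuous_intros cont)
  also have "\<dots> = integral ?C (\<lambda>p. A (fst p) (snd p)) + integral ?C (\<lambda>p. B (fst p) (snd p))"
    by (intro integral_add integrable_continuous continuous_on_subset[OF cA] continuous_on_subset[OF cB]) auto
  \<comment> \<open>The radial part is an \<open>r\<close>-derivative of
    \<open>r * cis \<theta> * Q\<close>, which vanishes at \<open>r = 0\<close> by the factor
    \<open>r\<close> and at \<open>r = R\<close> by the assumption on \<open>Q\<close>.\<close>
  also have "integral ?C (\<lambda>p. A (fst p) (snd p)) = 0"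
  proof -
    have "integral ?C (\<lambda>p. A (fst p) (snd p)) = integral (cbox 0 R) (\<lambda>r. integral (cbox \<theta>m \<theta>M) (\<lambda>\<theta>. A r \<theta>))"
      by (subst integral_prod_continuous) (auto intro: continuous_on_subset[OF cA])
    also have "\<dots> = integral (cbox \<theta>m \<theta>M) (\<lambda>\<theta>. integral (cbox 0 R) (\<lambda>r. A r \<theta>))"
      by (rule integral_swap_continuous) (auto simp: case_prod_unfold intro: continuous_on_subset[OF cA])
    also have "\<dots> = integral (cbox \<theta>m \<theta>M) (\<lambda>\<theta>. 0)"
    proof (rule integral_cong)
      fix \<theta>
      have "((\<lambda>r. A r \<theta>) has_integral cis \<theta> * (R *\<^sub>R Q (polar R \<theta>)) - cis \<theta> * (0 *\<^sub>R Q (polar 0 \<theta>))) {0..R}"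
        unfolding A_def
        by (rule fundamental_theorem_of_calculus)
          (use R in \<open>auto intro!: derivative_eq_intros smooth_polar_radius[OF Q] simp: algebra_simps\<close>)
      then show "integral (cbox 0 R) (\<lambda>r. A r \<theta>) = 0" using z[of "polar R \<theta>"] R by (simp add: integral_unique)
    qed
    finally show ?thesis by simp
  qed
  also have "integral ?C (\<lambda>p. B (fst p) (snd p)) = integral (cbox 0 R) (\<lambda>r. integral (cbox \<theta>m \<theta>M) (\<lambda>\<theta>. B r \<theta>))"
    by (subst integral_prod_continuous) (auto intro: continuous_on_subset[OF cB])
  \<comment> \<open>The other part is a derivative in the angle and leaves the values on the two
    sides.\<close>
  also have "\<dots> = integral (cbox 0 R) (\<lambda>r. \<i> * cis \<theta>M * Q (polar r \<theta>M) - \<i> * cis \<theta>m * Q (polar r \<theta>m))"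
  proof (rule integral_cong)
    fix r
    have cisd: "(cis has_vector_derivative \<i> * cis t) (at t within T)" for t T
      unfolding has_vector_derivative_complex_iff
      by (auto intro!: derivative_eq_intros simp: has_real_derivative_iff_has_vector_derivative[symmetric])
    have "((\<lambda>\<theta>. B r \<theta>) has_integral \<i> * cis \<theta>M * Q (polar r \<theta>M) - \<i> * cis \<theta>m * Q (polar r \<theta>m)) {\<theta>m..\<theta>M}"
      unfolding B_def
      by (rule fundamental_theorem_of_calculus)
        (use \<theta> in \<open>auto intro!: derivative_eq_intros cisd smooth_polar_angle[OF Q] simp: algebra_simps\<close>)
    then show "integral (cbox \<theta>m \<theta>M) (\<lambda>\<theta>. B r \<theta>) = \<i> * cis \<theta>M * Q (polar r \<theta>M) - \<i> * cis \<theta>m * Q (polar r \<theta>m)"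
      by (simp add: integral_unique)
  qed
  finally have eq: "(LINT x:S_sector \<theta>m \<theta>M R|lebesgue. partial 1 Q x + \<i> * partial 2 Q x)
      = integral {0..R} (\<lambda>r. \<i> * cis \<theta>M * Q (polar r \<theta>M) - \<i> * cis \<theta>m * Q (polar r \<theta>m))" by simp
  show ?thesis unfolding eq
  proof (rule integral_norm_bound_integral)
    show "(\<lambda>r. \<i> * cis \<theta>M * Q (polar r \<theta>M) - \<i> * cis \<theta>m * Q (polar r \<theta>m)) integrable_on {0..R}"
      "(\<lambda>r. norm (Q (polar r \<theta>M)) + norm (Q (polar r \<theta>m))) integrable_on {0..R}"
      by (intro integrable_continuous_interval continuous_intros continuous_polar_compose(2) cont)+
    show "norm (\<i> * cis \<theta>M * Q (polar r \<theta>M) - \<i> * cis \<theta>m * Q (polar r \<theta>m)) \<le> norm (Q (polar r \<theta>M)) + norm (Q (polar r \<theta>m))" for r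
      by (rule order_trans[OF norm_triangle_ineq4]) (simp add: norm_mult)
  qed
qed

section \<open>Holomorphic test functions with decay\<close>

text \<open>For angles between \<open>- pi\<close> and \<open>pi\<close> this is
  \<open>cos (m / 2)\<close>, by the half-angle formula, with \<open>m\<close> the larger of
  \<open>\<bar>\<theta>m\<bar>\<close> and \<open>\<bar>\<theta>M\<bar>\<close>. It is the minimum
  of \<open>norm (1 + t * cis m) / (1 + t)\<close> over \<open>0 \<le> t\<close>, attained at
  \<open>t = 1\<close>.\<close>

definition sector_gap :: "real \<Rightarrow> real \<Rightarrow> real" where
  "sector_gap \<theta>m \<theta>M = sqrt ((1 + cos (max \<bar>\<theta>m\<bar> \<bar>\<theta>M\<bar>)) / 2)"

lemma sector_gap_pos:
  assumes "- pi < \<theta>m" "\<theta>m < \<theta>M" "\<theta>M < pi"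
  shows "0 < sector_gap \<theta>m \<theta>M"
proof -
  have "cos pi < cos (max \<bar>\<theta>m\<bar> \<bar>\<theta>M\<bar>)" using assms by (intro cos_monotone_0_pi) auto
  then show ?thesis by (simp add: sector_gap_def)
qed

lemma sector_gap_le:
  assumes \<theta>: "- pi < \<theta>m" "\<theta>m < \<theta>M" "\<theta>M < pi" and t: "0 \<le> t" "\<theta>m \<le> \<theta>" "\<theta> \<le> \<theta>M"
  shows "sector_gap \<theta>m \<theta>M * (1 + t) \<le> norm (1 + of_real t * cis \<theta>)"
proof -
  define c where "c = cos (max \<bar>\<theta>m\<bar> \<bar>\<theta>M\<bar>)"
  have c: "- 1 \<le> c" "c \<le> 1" by (auto simp: c_def)
  have "c \<le> cos \<bar>\<theta>\<bar>" unfolding c_def using \<theta> t by (intro cos_monotone_0_pi_le) auto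
  then have cle: "c \<le> cos \<theta>" by simp
  have "(sector_gap \<theta>m \<theta>M * (1 + t))\<^sup>2 = (1 + c) / 2 * (1 + t)\<^sup>2"
    using c unfolding sector_gap_def c_def[symmetric] by (simp add: power_mult_distrib)
  also have "\<dots> \<le> 1 + 2 * t * c + t\<^sup>2"
  proof -
    \<comment> \<open>The gap is a nonnegative multiple of a square that vanishes at
      \<open>t = 1\<close>, so the constant in \<open>sector_gap\<close> is sharp for the extreme
      angle.\<close>
    have "1 + 2 * t * c + t\<^sup>2 - (1 + c) / 2 * (1 + t)\<^sup>2 = (1 - c) / 2 * (1 - t)\<^sup>2"
      by (simp add: power2_eq_square field_simps)
    moreover have "0 \<le> (1 - c) / 2 * (1 - t)\<^sup>2" using c by simp
    ultimately show ?thesis by linarith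
  qed
  also have "\<dots> \<le> 1 + 2 * t * cos \<theta> + t\<^sup>2" using cle t by (simp add: mult_left_mono)
  also have "\<dots> = (1 + t * cos \<theta>)\<^sup>2 + (t * sin \<theta>)\<^sup>2"
  proof -
    have "(1 + t * cos \<theta>)\<^sup>2 + (t * sin \<theta>)\<^sup>2 = 1 + 2 * t * cos \<theta> + t\<^sup>2 * ((sin \<theta>)\<^sup>2 + (cos \<theta>)\<^sup>2)" by algebra
    then show ?thesis by simp
  qed
  also have "\<dots> = (norm (1 + of_real t * cis \<theta>))\<^sup>2" by (simp add: cmod_power2)
  finally show ?thesis by (rule power2_le_imp_le) simp
qed

text \<open>Only the values \<open>1 / (1 + s z)\<close> on the closed sector matter. The term \<open>flat_exp\<close> vanishes there
  and keeps the denominator positive at the pole, so that the function is smooth on the whole plane.\<close>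

definition cgo :: "real \<Rightarrow> real \<Rightarrow> real ^ 2 \<Rightarrow> complex" where
  "cgo \<delta> s x = (let w = 1 + of_real s * to_complex x in
     cnj w * inverse (of_real ((norm w)\<^sup>2 + flat_exp (\<delta>\<^sup>2 - (norm w)\<^sup>2))))"

lemma smooth_cgo:
  assumes "0 < \<delta>" shows "smooth (cgo \<delta> s)"
proof -
  let ?N = "\<lambda>x :: real ^ 2. (1 + s * x $ 1) ^ 2 + (s * x $ 2) ^ 2"
  have N: "(norm (1 + of_real s * to_complex x))\<^sup>2 = ?N x" for x
    by (simp add: cmod_power2 to_complex_def)
  have eq: "cgo \<delta> s = (\<lambda>x. (of_real (1 + s * x $ 1) + - \<i> * of_real (s * x $ 2))
      * inverse (of_real (?N x + flat_exp (\<delta>\<^sup>2 + - 1 * ?N x))))"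
  proof
    fix x
    have "cnj (1 + of_real s * to_complex x) = of_real (1 + s * x $ 1) + - \<i> * of_real (s * x $ 2)"
      by (simp add: to_complex_def complex_eq_iff)
    moreover have "\<delta>\<^sup>2 - ?N x = \<delta>\<^sup>2 + - 1 * ?N x" by simp
    ultimately show "cgo \<delta> s x = (of_real (1 + s * x $ 1) + - \<i> * of_real (s * x $ 2))
      * inverse (of_real (?N x + flat_exp (\<delta>\<^sup>2 + - 1 * ?N x)))"
      unfolding cgo_def Let_def N by (simp only:)
  qed
  have pos: "0 < ?N x + flat_exp (\<delta>\<^sup>2 + - 1 * ?N x)" for x
  proof (cases "?N x = 0")
    case True
    show ?thesis unfolding True using assms flat_exp_pos_iff[of "\<delta>\<^sup>2"] by simp
  next
    case False
    then have "0 < ?N x" by (smt (verit) zero_le_power2)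
    then show ?thesis using flat_exp_nonneg by (rule add_pos_nonneg)
  qed
  have "smooth ?N" by (intro smooth_add smooth_power smooth_mult smooth_const smooth_nth)
  then show ?thesis unfolding eq
    by (intro smooth_add smooth_mult smooth_inverse smooth_of_real smooth_const smooth_nth smooth_power smooth_flat_exp)
      (use pos in \<open>auto simp del: of_real_add of_real_power simp: less_imp_neq[symmetric]\<close>)
qed

lemma cgo_eq:
  assumes "0 < \<delta>" "\<delta> \<le> norm (1 + of_real s * to_complex x)"
  shows "cgo \<delta> s x = inverse (1 + of_real s * to_complex x)"
proof -
  define w where "w = 1 + of_real s * to_complex x"
  have "\<delta>\<^sup>2 \<le> (norm w)\<^sup>2" using assms by (intro power_mono) (auto simp: w_def)
  then have "flat_exp (\<delta>\<^sup>2 - (norm w)\<^sup>2) = 0" by (simp add: flat_exp_eq_0_iff)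
  moreover have "w \<noteq> 0" using assms by (auto simp: w_def)
  moreover have "of_real ((norm w)\<^sup>2) = w * cnj w" using complex_norm_square[of w] by simp
  ultimately show ?thesis unfolding cgo_def Let_def w_def[symmetric] by simp
qed

lemma cgo_polar:
  assumes \<theta>: "- pi < \<theta>m" "\<theta>m < \<theta>M" "\<theta>M < pi" and r: "0 \<le> r" "\<theta>m \<le> \<theta>" "\<theta> \<le> \<theta>M" and s: "0 < s"
  defines "\<delta> \<equiv> sector_gap \<theta>m \<theta>M"
  shows "cgo \<delta> s (polar r \<theta>) = inverse (1 + of_real (s * r) * cis \<theta>)"
    and "\<delta> * (1 + s * r) \<le> norm (1 + of_real (s * r) * cis \<theta>)"
    and "norm (cgo \<delta> s (polar r \<theta>)) \<le> inverse (\<delta> * (1 + s * r))"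
proof -
  have \<delta>: "0 < \<delta>" unfolding \<delta>_def by (rule sector_gap_pos[OF \<theta>])
  have sr: "0 \<le> s * r" using s r by simp
  show le: "\<delta> * (1 + s * r) \<le> norm (1 + of_real (s * r) * cis \<theta>)"
    unfolding \<delta>_def by (rule sector_gap_le[OF \<theta> sr r(2,3)])
  moreover have "\<delta> * 1 \<le> \<delta> * (1 + s * r)" using sr \<delta> by (intro mult_left_mono) auto
  ultimately show eq: "cgo \<delta> s (polar r \<theta>) = inverse (1 + of_real (s * r) * cis \<theta>)"
    using cgo_eq[OF \<delta>, of s "polar r \<theta>"] by (simp add: mult.assoc)
  show "norm (cgo \<delta> s (polar r \<theta>)) \<le> inverse (\<delta> * (1 + s * r))"
    unfolding eq norm_inverse using le \<delta> sr by (intro le_imp_inverse_le) auto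
qed

text \<open>The bounds come from \<open>cgo_polar\<close> by writing the point in polar coordinates.
  As the sector is open, \<open>cgo\<close> may be differentiated there like the rational function;
  the two derivatives satisfy the Cauchy-Riemann equation, the second being \<open>\<i>\<close>
  times the first.\<close>

lemma cgo_sector:
  assumes \<theta>: "- pi < \<theta>m" "\<theta>m < \<theta>M" "\<theta>M < pi" and x: "x \<in> S_sector \<theta>m \<theta>M R" and s: "0 < s"
  defines "\<delta> \<equiv> sector_gap \<theta>m \<theta>M"
  shows "cgo \<delta> s x = inverse (1 + of_real s * to_complex x)"
    and "1 + of_real s * to_complex x \<noteq> 0"
    and "norm (cgo \<delta> s x) \<le> inverse (\<delta> * (1 + s * norm x))"
    and "partial 1 (cgo \<delta> s) x = - of_real s * cgo \<delta> s x ^ 2"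
    and "partial 2 (cgo \<delta> s) x = - \<i> * of_real s * cgo \<delta> s x ^ 2"
proof -
  have \<delta>: "0 < \<delta>" unfolding \<delta>_def by (rule sector_gap_pos[OF \<theta>])
  have A: "cgo \<delta> s y = inverse (1 + of_real s * to_complex y)" "1 + of_real s * to_complex y \<noteq> 0"
    "norm (cgo \<delta> s y) \<le> inverse (\<delta> * (1 + s * norm y))"
    if y: "y \<in> S_sector \<theta>m \<theta>M R" for y
  proof -
    have a: "0 \<le> norm y" "\<theta>m \<le> Arg (to_complex y)" "Arg (to_complex y) \<le> \<theta>M"
      using y by (auto simp: S_sector_altdef)
    note P = cgo_polar[OF \<theta> a s, folded \<delta>_def]
    have "of_real (s * norm y) * cis (Arg (to_complex y)) = of_real s * to_complex (polar (norm y) (Arg (to_complex y)))"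
      by (simp only: to_complex_polar of_real_mult mult.assoc)
    then have z: "of_real (s * norm y) * cis (Arg (to_complex y)) = of_real s * to_complex y"
      by (simp only: polar_Arg)
    show "cgo \<delta> s y = inverse (1 + of_real s * to_complex y)" using P(1) unfolding z polar_Arg .
    show "norm (cgo \<delta> s y) \<le> inverse (\<delta> * (1 + s * norm y))" using P(3) unfolding polar_Arg .
    have "0 < \<delta> * (1 + s * norm y)" using \<delta> s by (intro mult_pos_pos add_pos_nonneg) auto
    then show "1 + of_real s * to_complex y \<noteq> 0" using P(2) unfolding z by auto
  qed
  show 1: "cgo \<delta> s x = inverse (1 + of_real s * to_complex x)" and nz: "1 + of_real s * to_complex x \<noteq> 0"
    and "norm (cgo \<delta> s x) \<le> inverse (\<delta> * (1 + s * norm x))" by (rule A[OF x])+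
  have "((\<lambda>y. inverse (1 + of_real s * to_complex y)) has_derivative
      (\<lambda>h. - (inverse (1 + of_real s * to_complex x) * (of_real s * to_complex h) * inverse (1 + of_real s * to_complex x)))) (at x)"
  proof (rule Deriv.has_derivative_inverse[where f = "\<lambda>y. 1 + of_real s * to_complex y"])
    show "1 + of_real s * to_complex x \<noteq> 0" by (rule nz)
    have "((\<lambda>y. 1 + of_real s * to_complex y) has_derivative (\<lambda>h. 0 + of_real s * to_complex h)) (at x)"
      by (intro has_derivative_add has_derivative_const has_derivative_mult_right
          bounded_linear_imp_has_derivative bounded_linear_to_complex)
    then show "((\<lambda>y. 1 + of_real s * to_complex y) has_derivative (\<lambda>h. of_real s * to_complex h)) (at x)" by simp
  qed
  then have D: "(cgo \<delta> s has_derivative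
      (\<lambda>h. - (inverse (1 + of_real s * to_complex x) * (of_real s * to_complex h) * inverse (1 + of_real s * to_complex x)))) (at x)"
    by (rule has_derivative_transform_within_open[OF _ open_S_sector x]) (use \<theta> A in auto)
  have "to_complex (axis 1 1) = 1" "to_complex (axis 2 1) = \<i>"
    by (auto simp: to_complex_def axis_def complex_eq_iff)
  then show "partial 1 (cgo \<delta> s) x = - of_real s * cgo \<delta> s x ^ 2"
    "partial 2 (cgo \<delta> s) x = - \<i> * of_real s * cgo \<delta> s x ^ 2"
    unfolding partial_eqI[OF D] 1 by (simp_all add: power2_eq_square)
qed

lemma partial_power:
  fixes f :: "real ^ 'n::finite \<Rightarrow> complex"
  assumes "f differentiable (at x)"
  shows "partial i (\<lambda>x. f x ^ n) x = of_nat n * f x ^ (n - 1) * partial i f x"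
  by (rule partial_eqI[THEN trans], rule has_derivative_power)
    (use assms in \<open>auto intro!: has_derivative_differentiable simp: partial_def\<close>)

lemma partial_locally_const:
  assumes "open N" "x \<in> N" "\<And>y. y \<in> N \<Longrightarrow> f y = c"
  shows "partial i f x = 0"
proof -
  have "(f has_derivative (\<lambda>_. 0)) (at x)"
    by (rule has_derivative_transform_within_open[OF has_derivative_const[of c] assms(1,2)]) (use assms(3) in auto)
  then show ?thesis by (rule partial_eqI)
qed

text \<open>With \<open>G\<close> for \<open>cgo\<close>, holomorphy turns \<open>\<nabla>q \<bullet> \<nabla>(\<eta> G\<^sup>4)\<close> into
  \<open>- 4 s (\<partial>\<^sub>1 + \<i> \<partial>\<^sub>2) (q \<eta> G\<^sup>5)\<close> plus terms with a derivative of \<open>\<eta>\<close>, which live away from the vertex.\<close>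

lemma cgo_green_bound:
  fixes \<eta> :: "real ^ 2 \<Rightarrow> complex"
  assumes \<theta>: "- pi < \<theta>m" "\<theta>m < \<theta>M" "\<theta>M < pi" and h: "0 < h"
    and \<eta>: "smooth \<eta>" "\<And>x. norm x \<le> h / 2 \<Longrightarrow> \<eta> x = 1" "\<And>x. norm x = h \<Longrightarrow> \<eta> x = 0"
  defines "\<delta> \<equiv> sector_gap \<theta>m \<theta>M"
  shows "\<exists>K\<ge>0. \<forall>s>0. \<exists>B. \<forall>q. smooth q \<longrightarrow>
    norm (LINT x:S_sector \<theta>m \<theta>M h|lebesgue. \<Sum>i\<in>UNIV. partial i q x * partial i (\<lambda>x. \<eta> x * cgo \<delta> s x ^ 4) x)
    \<le> K / s ^ 4 * (LINT x:S_sector \<theta>m \<theta>M h|lebesgue. norm (partial 1 q x) + norm (partial 2 q x) + norm (q x))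
      + B * integral {0..h} (\<lambda>r. norm (q (polar r \<theta>M)) + norm (q (polar r \<theta>m)))"
proof -
  let ?S = "S_sector \<theta>m \<theta>M h"
  have \<delta>: "0 < \<delta>" unfolding \<delta>_def by (rule sector_gap_pos[OF \<theta>])
  note cont = smooth_continuous_on[of _ UNIV]
  obtain K1 where K1: "\<And>x. x \<in> ?S \<Longrightarrow> norm (partial 1 \<eta> x) \<le> K1" "0 < K1"
    using continuous_bounded_on[OF cont[OF smooth_partial[OF \<eta>(1)]] bounded_S_sector] by blast
  obtain K2 where K2: "\<And>x. x \<in> ?S \<Longrightarrow> norm (partial 2 \<eta> x) \<le> K2" "0 < K2"
    using continuous_bounded_on[OF cont[OF smooth_partial[OF \<eta>(1)]] bounded_S_sector] by blast
  define K0 where "K0 = K1 + K2"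
  have K0: "0 < K0" "\<And>x. x \<in> ?S \<Longrightarrow> norm (partial 1 \<eta> x) \<le> K0" "\<And>x. x \<in> ?S \<Longrightarrow> norm (partial 2 \<eta> x) \<le> K0"
    using K1 K2 unfolding K0_def by (auto intro: add_increasing add_increasing2 less_imp_le)
  have \<eta>0: "partial i \<eta> x = 0" if "norm x < h / 2" for i x
    by (rule partial_locally_const[of "ball 0 (h / 2)" _ _ 1]) (use that \<eta>(2) in auto)
  \<comment> \<open>Where \<open>\<eta>\<close> varies one has \<open>h / 2 \<le> norm x\<close>,
    and there \<open>norm (cgo \<delta> s x) \<le> D / s\<close>.\<close>
  define D where "D = 2 / (\<delta> * h)"
  have D: "0 < D" using \<delta> h by (simp add: D_def)
  \<comment> \<open>\<open>D ^ 4\<close> comes from the fourth power of the kernel;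
    \<open>8 * D ^ 5\<close> is the factor 4 times two derivatives of \<open>\<eta>\<close>, where
    \<open>s * (D / s) ^ 5\<close> leaves again \<open>s ^ (-4)\<close>.\<close>
  define K where "K = K0 * (D ^ 4 + 8 * D ^ 5)"
  have "\<exists>B. \<forall>q. smooth q \<longrightarrow>
    norm (LINT x:?S|lebesgue. \<Sum>i\<in>UNIV. partial i q x * partial i (\<lambda>x. \<eta> x * cgo \<delta> s x ^ 4) x)
    \<le> K / s ^ 4 * (LINT x:?S|lebesgue. norm (partial 1 q x) + norm (partial 2 q x) + norm (q x))
      + B * integral {0..h} (\<lambda>r. norm (q (polar r \<theta>M)) + norm (q (polar r \<theta>m)))"
    if s: "0 < s" for s
  proof -
    let ?g = "cgo \<delta> s"
    let ?\<phi> = "\<lambda>x. \<eta> x * ?g x ^ 4"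
    have g: "smooth ?g" by (rule smooth_cgo[OF \<delta>])
    have \<phi>: "smooth ?\<phi>" by (intro smooth_mult smooth_power \<eta> g)
    have \<eta>g: "smooth (\<lambda>x. \<eta> x * ?g x ^ 5)" by (intro smooth_mult smooth_power \<eta> g)
    \<comment> \<open>This bound depends on \<open>s\<close> without control; it multiplies only the
      side integral, which later tends to 0 for fixed \<open>s\<close>.\<close>
    obtain B where B: "\<And>x. x \<in> cball 0 h \<Longrightarrow> norm (\<eta> x * ?g x ^ 5) \<le> B" "0 < B"
      using continuous_bounded_on[OF cont[OF \<eta>g] bounded_cball] by blast
    note G = cgo_sector[OF \<theta> _ s, folded \<delta>_def]
    have "norm (LINT x:?S|lebesgue. \<Sum>i\<in>UNIV. partial i q x * partial i ?\<phi> x)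
      \<le> K / s ^ 4 * (LINT x:?S|lebesgue. norm (partial 1 q x) + norm (partial 2 q x) + norm (q x))
      + 4 * s * B * integral {0..h} (\<lambda>r. norm (q (polar r \<theta>M)) + norm (q (polar r \<theta>m)))"
      if q: "smooth q" for q
    proof -
      define Q where "Q x = q x * (\<eta> x * ?g x ^ 5)" for x
      have Q: "smooth Q" unfolding Q_def[abs_def] by (intro smooth_mult q \<eta>g)
      define E where "E x = ?g x ^ 4 * (partial 1 q x * partial 1 \<eta> x + partial 2 q x * partial 2 \<eta> x)
          + 4 * of_real s * (?g x ^ 5 * q x * (partial 1 \<eta> x + \<i> * partial 2 \<eta> x))" for x
      have cE: "continuous_on UNIV E" unfolding E_def[abs_def]
        by (intro continuous_intros cont smooth_partial q \<eta> g)
      have cQ: "continuous_on UNIV (\<lambda>x. 4 * of_real s * (partial 1 Q x + \<i> * partial 2 Q x))"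
        by (intro continuous_intros cont smooth_partial Q)
      have d: "smooth f \<Longrightarrow> f differentiable (at x)" for f :: "real ^ 2 \<Rightarrow> complex" and x
        by (rule smooth_differentiable)
      have pw: "(\<Sum>i\<in>UNIV. partial i q x * partial i ?\<phi> x) = E x - 4 * of_real s * (partial 1 Q x + \<i> * partial 2 Q x)"
        if x: "x \<in> ?S" for x
      proof -
        have p4: "partial i ?\<phi> x = partial i \<eta> x * ?g x ^ 4 + \<eta> x * (4 * ?g x ^ 3 * partial i ?g x)" for i
          using d[OF g] d[OF \<eta>(1)] d[OF smooth_power[OF g]] by (simp add: partial_mult partial_power)
        have p5: "partial i Q x = partial i q x * (\<eta> x * ?g x ^ 5)
            + q x * (partial i \<eta> x * ?g x ^ 5 + \<eta> x * (5 * ?g x ^ 4 * partial i ?g x))" for i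
          unfolding Q_def[abs_def]
          using d[OF g] d[OF \<eta>(1)] d[OF smooth_power[OF g]] d[OF q] d[OF \<eta>g] by (simp add: partial_mult partial_power)
        \<comment> \<open>The terms with a derivative neither of \<open>q\<close> nor of
          \<open>\<eta>\<close> carry the factor \<open>1 + I * I\<close> and cancel; this is where
          holomorphy of the kernel enters.\<close>
        have "q1 * (n1 * g ^ 4 + n * (4 * g ^ 3 * (- S * g\<^sup>2))) + q2 * (n2 * g ^ 4 + n * (4 * g ^ 3 * (- I * S * g\<^sup>2)))
            = g ^ 4 * (q1 * n1 + q2 * n2) + 4 * S * (g ^ 5 * y * (n1 + I * n2))
              - 4 * S * ((q1 * (n * g ^ 5) + y * (n1 * g ^ 5 + n * (5 * g ^ 4 * (- S * g\<^sup>2))))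
                + I * (q2 * (n * g ^ 5) + y * (n2 * g ^ 5 + n * (5 * g ^ 4 * (- I * S * g\<^sup>2)))))"
          if "I * I = - 1" for q1 q2 n1 n2 g n S y I :: complex
          using that by algebra
        from this[OF i_squared]
        show ?thesis unfolding sum_2 E_def p4 p5 G(4,5)[OF x] .
      qed
      have "(LINT x:?S|lebesgue. \<Sum>i\<in>UNIV. partial i q x * partial i ?\<phi> x)
          = (LINT x:?S|lebesgue. E x - 4 * of_real s * (partial 1 Q x + \<i> * partial 2 Q x))"
        by (rule set_lebesgue_integral_cong) (use pw \<theta> in \<open>auto intro: S_sector_lebesgue\<close>)
      also have "\<dots> = (LINT x:?S|lebesgue. E x) - (LINT x:?S|lebesgue. 4 * of_real s * (partial 1 Q x + \<i> * partial 2 Q x))"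
        by (intro set_integral_diff(2) polar_integral(1)[OF cE \<theta> h] polar_integral(1)[OF cQ \<theta> h])
      also have "\<dots> = (LINT x:?S|lebesgue. E x) - 4 * of_real s * (LINT x:?S|lebesgue. partial 1 Q x + \<i> * partial 2 Q x)"
        by (simp only: set_integral_mult_right)
      finally have "norm (LINT x:?S|lebesgue. \<Sum>i\<in>UNIV. partial i q x * partial i ?\<phi> x)
          \<le> norm (LINT x:?S|lebesgue. E x) + norm (4 * of_real s * (LINT x:?S|lebesgue. partial 1 Q x + \<i> * partial 2 Q x))"
        by (simp only: norm_triangle_ineq4)
      also have "norm (4 * of_real s * (LINT x:?S|lebesgue. partial 1 Q x + \<i> * partial 2 Q x))
          \<le> 4 * s * (B * integral {0..h} (\<lambda>r. norm (q (polar r \<theta>M)) + norm (q (polar r \<theta>m))))"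
      proof -
        have cq: "continuous_on UNIV (\<lambda>x. norm (q x))" "continuous_on UNIV (\<lambda>x. norm (Q x))"
          by (intro continuous_intros cont q Q)+
        have "norm (LINT x:?S|lebesgue. partial 1 Q x + \<i> * partial 2 Q x)
            \<le> integral {0..h} (\<lambda>r. norm (Q (polar r \<theta>M)) + norm (Q (polar r \<theta>m)))"
          by (rule sector_green[OF \<theta> h Q]) (simp add: Q_def \<eta>)
        also have "\<dots> \<le> integral {0..h} (\<lambda>r. B * (norm (q (polar r \<theta>M)) + norm (q (polar r \<theta>m))))"
        proof (rule integral_le)
          show "(\<lambda>r. norm (Q (polar r \<theta>M)) + norm (Q (polar r \<theta>m))) integrable_on {0..h}"
            "(\<lambda>r. B * (norm (q (polar r \<theta>M)) + norm (q (polar r \<theta>m)))) integrable_on {0..h}"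
            by (intro integrable_continuous_interval continuous_intros continuous_polar_compose(2) cq)+
          fix r assume r: "r \<in> {0..h}"
          have "norm (Q (polar r t)) \<le> B * norm (q (polar r t))" for t
            unfolding Q_def norm_mult[of "q _"] using B(1)[of "polar r t"] r
            by (subst mult.commute) (intro mult_right_mono, auto)
          from add_mono[OF this this]
          show "norm (Q (polar r \<theta>M)) + norm (Q (polar r \<theta>m)) \<le> B * (norm (q (polar r \<theta>M)) + norm (q (polar r \<theta>m)))"
            unfolding distrib_left .
        qed
        finally have "norm (LINT x:?S|lebesgue. partial 1 Q x + \<i> * partial 2 Q x)
            \<le> B * integral {0..h} (\<lambda>r. norm (q (polar r \<theta>M)) + norm (q (polar r \<theta>m)))" by simp
        from mult_left_mono[OF this, of "4 * s"] show ?thesis using s by (simp add: norm_mult)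
      qed
      also have "norm (LINT x:?S|lebesgue. E x) \<le> K / s ^ 4 * (LINT x:?S|lebesgue. norm (partial 1 q x) + norm (partial 2 q x) + norm (q x))"
      proof -
        let ?N = "\<lambda>x. norm (partial 1 q x) + norm (partial 2 q x) + norm (q x)"
        have cN: "continuous_on UNIV ?N" by (intro continuous_intros cont smooth_partial q)
        have "norm (LINT x:?S|lebesgue. E x) \<le> (LINT x:?S|lebesgue. norm (E x))"
          by (rule set_integral_norm_bound[OF polar_integral(1)[OF cE \<theta> h]])
        also have "\<dots> \<le> (LINT x:?S|lebesgue. K / s ^ 4 * ?N x)"
        proof (rule set_integral_mono)
          show "set_integrable lebesgue ?S (\<lambda>x. norm (E x))"
            by (rule set_integrable_norm[OF polar_integral(1)[OF cE \<theta> h]])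
          show "set_integrable lebesgue ?S (\<lambda>x. K / s ^ 4 * ?N x)"
            by (intro set_integrable_mult_right polar_integral(1)[OF cN \<theta> h])
          fix x assume x: "x \<in> ?S"
          show "norm (E x) \<le> K / s ^ 4 * ?N x"
          proof (cases "norm x < h / 2")
            case True
            then have "E x = 0" by (simp add: E_def \<eta>0)
            then show ?thesis using K0 D s by (simp add: K_def)
          next
            case False
            have "norm (?g x) \<le> inverse (\<delta> * (1 + s * norm x))" by (rule G(3)[OF x])
            also have "\<dots> \<le> inverse (\<delta> * (s * (h / 2)))"
            proof (rule le_imp_inverse_le)
              show "0 < \<delta> * (s * (h / 2))" using \<delta> s h by simp
              have "s * (h / 2) \<le> s * norm x" using False s by (intro mult_left_mono) auto
              then show "\<delta> * (s * (h / 2)) \<le> \<delta> * (1 + s * norm x)" using \<delta> by (intro mult_left_mono) auto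
            qed
            also have "\<dots> = D / s" by (simp add: D_def field_simps)
            finally have gD: "norm (?g x) \<le> D / s" .
            have g4: "norm (?g x) ^ 4 \<le> (D / s) ^ 4" and g5: "norm (?g x) ^ 5 \<le> (D / s) ^ 5"
              using gD by (intro power_mono; simp)+
            let ?P = "norm (partial 1 q x) + norm (partial 2 q x)"
            have "norm (E x) \<le> norm (?g x) ^ 4 * norm (partial 1 q x * partial 1 \<eta> x + partial 2 q x * partial 2 \<eta> x)
                + 4 * s * (norm (?g x) ^ 5 * norm (q x) * norm (partial 1 \<eta> x + \<i> * partial 2 \<eta> x))"
              unfolding E_def by (rule order_trans[OF norm_triangle_ineq]) (use s in \<open>simp add: norm_mult norm_power\<close>)
            also have "\<dots> \<le> (D / s) ^ 4 * (K0 * ?P) + 4 * s * ((D / s) ^ 5 * norm (q x) * (K0 + K0))"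
            proof (intro add_mono mult_mono)
              show "norm (partial 1 q x * partial 1 \<eta> x + partial 2 q x * partial 2 \<eta> x) \<le> K0 * ?P"
              proof -
                have "norm (partial 1 q x * partial 1 \<eta> x + partial 2 q x * partial 2 \<eta> x)
                    \<le> norm (partial 1 q x) * norm (partial 1 \<eta> x) + norm (partial 2 q x) * norm (partial 2 \<eta> x)"
                  by (rule order_trans[OF norm_triangle_ineq]) (simp add: norm_mult)
                also have "\<dots> \<le> norm (partial 1 q x) * K0 + norm (partial 2 q x) * K0"
                  by (intro add_mono mult_left_mono K0 x) auto
                finally show ?thesis by (simp add: algebra_simps)
              qed
              show "norm (partial 1 \<eta> x + \<i> * partial 2 \<eta> x) \<le> K0 + K0"
                by (rule order_trans[OF norm_triangle_ineq add_mono]) (use K0(2,3)[OF x] in \<open>auto simp: norm_mult\<close>)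
            qed (use g4 g5 s D K0 in auto)
            also have "\<dots> = K0 * D ^ 4 / s ^ 4 * ?P + K0 * (8 * D ^ 5) / s ^ 4 * norm (q x)"
              using s by (simp add: power_divide field_simps eval_nat_numeral)
            also have "\<dots> \<le> K / s ^ 4 * ?P + K / s ^ 4 * norm (q x)"
              using K0 D s unfolding K_def by (intro add_mono mult_right_mono divide_right_mono mult_left_mono) auto
            finally show ?thesis by (simp add: algebra_simps)
          qed
        qed
        also have "\<dots> = K / s ^ 4 * (LINT x:?S|lebesgue. ?N x)" by (rule set_integral_mult_right)
        finally show ?thesis .
      qed
      finally show ?thesis by (simp add: mult.assoc)
    qed
    then show ?thesis by blast
  qed
  moreover have "0 \<le> K" using K0 D by (simp add: K_def)
  ultimately show ?thesis by blast
qed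

text \<open>With \<open>w = 1 + r * a\<close> the integrand is \<open>(w - 1) / (a * w ^ 4)\<close>,
  and the identity \<open>w ^ 3 - 3 * w + 2 = (w - 1)\<^sup>2 * (w + 2)\<close> brings the
  antiderivative that vanishes at 0 into a form without division by \<open>a\<close>.\<close>

lemma cgo_radial_integral:
  fixes a :: complex
  assumes nz: "\<And>r. r \<in> {0..h} \<Longrightarrow> 1 + of_real r * a \<noteq> 0" and h: "0 \<le> h"
  shows "((\<lambda>r. r *\<^sub>R inverse (1 + of_real r * a) ^ 4) has_integral
    (of_real h)\<^sup>2 * (3 + of_real h * a) * inverse (1 + of_real h * a) ^ 3 / 6) {0..h}"
proof -
  let ?J = "\<lambda>z :: complex. z\<^sup>2 * (3 + z * a) * inverse (1 + z * a) ^ 3 / 6"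
  have "((\<lambda>r. ?J (of_real r)) has_vector_derivative r *\<^sub>R inverse (1 + of_real r * a) ^ 4) (at r within {0..h})"
    if r: "r \<in> {0..h}" for r
  proof (rule has_vector_derivative_real_field)
    define w where "w = 1 + of_real r * a"
    have w: "w \<noteq> 0" using nz[OF r] by (simp add: w_def)
    have "(?J has_field_derivative ((2 * of_real r * (3 + of_real r * a) + (of_real r)\<^sup>2 * a) * inverse w ^ 3
        - (of_real r)\<^sup>2 * (3 + of_real r * a) * (3 * inverse w ^ 2 * (inverse w * a * inverse w))) / 6) (at (of_real r))"
    proof -
      have D1: "((\<lambda>z. z\<^sup>2 * (3 + z * a)) has_field_derivative 2 * of_real r * (3 + of_real r * a) + (of_real r)\<^sup>2 * a) (at (of_real r))"
        by (auto intro!: derivative_eq_intros simp: algebra_simps)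
      have "((\<lambda>z. 1 + z * a) has_field_derivative a) (at (of_real r))"
        by (auto intro!: derivative_eq_intros)
      from DERIV_power[OF DERIV_inverse'[OF this], of 3] w
      have D2: "((\<lambda>z. inverse (1 + z * a) ^ 3) has_field_derivative 3 * (inverse w ^ 2 * - (inverse w * a * inverse w))) (at (of_real r))"
        by (simp add: w_def mult_ac)
      show ?thesis
        by (rule DERIV_cong[OF DERIV_cdivide[OF DERIV_mult[OF D1 D2]]]) (simp add: w_def algebra_simps)
    qed
    moreover have "((2 * of_real r * (3 + of_real r * a) + (of_real r)\<^sup>2 * a) * inverse w ^ 3
        - (of_real r)\<^sup>2 * (3 + of_real r * a) * (3 * inverse w ^ 2 * (inverse w * a * inverse w))) / 6
        = r *\<^sub>R inverse w ^ 4"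
    proof -
      have "(2 * of_real r * (3 + of_real r * a) + (of_real r)\<^sup>2 * a) * w
          - (of_real r)\<^sup>2 * (3 + of_real r * a) * (3 * a) = 6 * of_real r"
        unfolding w_def by (simp add: algebra_simps power2_eq_square)
      then have "((2 * of_real r * (3 + of_real r * a) + (of_real r)\<^sup>2 * a) * w
          - (of_real r)\<^sup>2 * (3 + of_real r * a) * (3 * a)) / (6 * w ^ 4) = 6 * of_real r / (6 * w ^ 4)" by simp
      then show ?thesis using w by (simp add: field_simps eval_nat_numeral scaleR_conv_of_real)
    qed
    ultimately have "(?J has_field_derivative r *\<^sub>R inverse w ^ 4) (at (of_real r))" by (rule DERIV_cong)
    then show "(?J has_field_derivative r *\<^sub>R inverse (1 + of_real r * a) ^ 4) (at (of_real r))"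
      unfolding w_def .
  qed
  from fundamental_theorem_of_calculus[OF h this] show ?thesis by simp
qed

text \<open>After scaling by \<open>s\<^sup>2\<close> the radial integral tends to
  \<open>cis (- 2 * \<theta>) / 6\<close> uniformly in the angle, with error
  \<open>O(1 / s)\<close>; integration over the angle gives the limit. It vanishes only if the
  opening is a multiple of \<open>pi\<close>, and the opening lies strictly between 0 and
  \<open>2 * pi\<close>.\<close>

lemma cgo_integral_limit:
  assumes \<theta>: "- pi < \<theta>m" "\<theta>m < \<theta>M" "\<theta>M < pi" "\<theta>M - \<theta>m \<noteq> pi" and h: "0 < h"
  obtains c where "c \<noteq> 0"
    "(\<lambda>n. of_real ((real n)\<^sup>2) * (LINT x:S_sector \<theta>m \<theta>M h|lebesgue. cgo (sector_gap \<theta>m \<theta>M) (real n) x ^ 4)) \<longlonglongrightarrow> c"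
proof
  let ?\<delta> = "sector_gap \<theta>m \<theta>M"
  let ?c = "\<i> * (cis (- 2 * \<theta>M) - cis (- 2 * \<theta>m)) / 12"
  have \<delta>: "0 < ?\<delta>" by (rule sector_gap_pos[OF \<theta>(1-3)])
  show "?c \<noteq> 0"
  proof
    assume "?c = 0"
    then have "cis (- 2 * \<theta>M) = cis (- 2 * \<theta>m)" by simp
    then have "cis (- 2 * \<theta>m) * cis (2 * \<theta>M) = cis (- 2 * \<theta>M) * cis (2 * \<theta>M)" by simp
    then have "cis (2 * (\<theta>M - \<theta>m)) = 1" by (simp add: cis_mult algebra_simps)
    then have "cos (2 * (\<theta>M - \<theta>m)) = 1" by (simp add: complex_eq_iff)
    then have s0: "sin (\<theta>M - \<theta>m) = 0" using cos_double_sin[of "\<theta>M - \<theta>m"] by simp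
    consider "\<theta>M - \<theta>m < pi" | "\<theta>M - \<theta>m > pi" using \<theta> by linarith
    then show False
    proof cases
      case 1 then show ?thesis using sin_gt_zero[of "\<theta>M - \<theta>m"] \<theta> s0 by simp
    next
      case 2
      then have "0 < sin (\<theta>M - \<theta>m - pi)" using \<theta> by (intro sin_gt_zero) auto
      then show ?thesis using s0 by (simp add: sin_diff)
    qed
  qed
  have hc: "((\<lambda>\<theta>. cis (- 2 * \<theta>) / 6) has_integral ?c) {\<theta>m..\<theta>M}"
  proof -
    have d: "((\<lambda>t. \<i> * cis (- 2 * t) / 12) has_vector_derivative cis (- 2 * t) / 6) (at t within T)" for t T
      unfolding has_vector_derivative_complex_iff
      by (auto intro!: derivative_eq_intros simp: has_real_derivative_iff_has_vector_derivative[symmetric])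
    have "((\<lambda>\<theta>. cis (- 2 * \<theta>) / 6) has_integral (\<i> * cis (- 2 * \<theta>M) / 12 - \<i> * cis (- 2 * \<theta>m) / 12)) {\<theta>m..\<theta>M}"
      by (rule fundamental_theorem_of_calculus) (use \<theta> d in auto)
    then show ?thesis by (simp add: algebra_simps diff_divide_distrib)
  qed
  have bnd: "norm (of_real (s\<^sup>2) * (LINT x:S_sector \<theta>m \<theta>M h|lebesgue. cgo ?\<delta> s x ^ 4) - ?c)
      \<le> (\<theta>M - \<theta>m) * (1 / (2 * ?\<delta> ^ 3 * h) / s)" if s: "0 < s" for s
  proof -
    have c4: "continuous_on UNIV (\<lambda>x. cgo ?\<delta> s x ^ 4)"
      by (intro smooth_continuous_on smooth_power smooth_cgo \<delta>)
    let ?T = "s * h"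
    have T: "0 < ?T" using s h by simp
    define X where "X \<theta> = (of_real ?T)\<^sup>2 * (3 + of_real ?T * cis \<theta>) * inverse (1 + of_real ?T * cis \<theta>) ^ 3 / 6" for \<theta>
    have nz: "1 + of_real (s * r) * cis \<theta> \<noteq> 0" if "0 \<le> r" "\<theta> \<in> {\<theta>m..\<theta>M}" for r \<theta>
    proof -
      have "0 < ?\<delta> * (1 + s * r)" using \<delta> s that by (intro mult_pos_pos add_pos_nonneg) auto
      then show ?thesis using cgo_polar(2)[OF \<theta>(1-3) that(1) _ _ s, of \<theta>] that by auto
    qed
    have "(LINT x:S_sector \<theta>m \<theta>M h|lebesgue. cgo ?\<delta> s x ^ 4)
        = integral {\<theta>m..\<theta>M} (\<lambda>\<theta>. integral {0..h} (\<lambda>r. r *\<^sub>R cgo ?\<delta> s (polar r \<theta>) ^ 4))"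
      by (rule polar_integral(3)[OF c4 \<theta>(1-3) h])
    also have "\<dots> = integral {\<theta>m..\<theta>M} (\<lambda>\<theta>. X \<theta> / of_real (s\<^sup>2))"
    proof (rule integral_cong)
      fix \<theta> assume t: "\<theta> \<in> {\<theta>m..\<theta>M}"
      have "integral {0..h} (\<lambda>r. r *\<^sub>R cgo ?\<delta> s (polar r \<theta>) ^ 4)
          = integral {0..h} (\<lambda>r. r *\<^sub>R inverse (1 + of_real r * (of_real s * cis \<theta>)) ^ 4)"
      proof (rule integral_cong)
        fix r assume "r \<in> {0..h}"
        then show "r *\<^sub>R cgo ?\<delta> s (polar r \<theta>) ^ 4 = r *\<^sub>R inverse (1 + of_real r * (of_real s * cis \<theta>)) ^ 4"
          using cgo_polar(1)[OF \<theta>(1-3) _ _ _ s, of r \<theta>] t by (simp add: mult_ac)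
      qed
      also have "\<dots> = (of_real h)\<^sup>2 * (3 + of_real h * (of_real s * cis \<theta>)) * inverse (1 + of_real h * (of_real s * cis \<theta>)) ^ 3 / 6"
        by (intro integral_unique cgo_radial_integral) (use nz t h in \<open>auto simp: mult_ac\<close>)
      also have "\<dots> = X \<theta> / of_real (s\<^sup>2)" using s by (simp add: X_def mult_ac power_mult_distrib)
      finally show "integral {0..h} (\<lambda>r. r *\<^sub>R cgo ?\<delta> s (polar r \<theta>) ^ 4) = X \<theta> / of_real (s\<^sup>2)" .
    qed
    finally have I: "of_real (s\<^sup>2) * (LINT x:S_sector \<theta>m \<theta>M h|lebesgue. cgo ?\<delta> s x ^ 4) = integral {\<theta>m..\<theta>M} X"
      using s by simp
    have cX: "continuous_on {\<theta>m..\<theta>M} X"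
      unfolding X_def[abs_def] cis_conv_exp
      by (intro continuous_intros) (use nz[of h] h in \<open>auto simp: cis_conv_exp\<close>)
    have Xd: "norm (X \<theta> - cis (- 2 * \<theta>) / 6) \<le> 1 / (2 * ?\<delta> ^ 3 * h) / s" if t: "\<theta> \<in> {\<theta>m..\<theta>M}" for \<theta>
    proof -
      define e w where "e = cis \<theta>" and "w = 1 + of_real ?T * e"
      have w: "w \<noteq> 0" using nz[of h \<theta>] h t by (simp add: w_def e_def)
      have e: "e \<noteq> 0" "norm e = 1" by (auto simp: e_def)
      have "e\<^sup>2 = cis (2 * \<theta>)" by (simp add: e_def power2_eq_square cis_mult)
      then have "cis (- 2 * \<theta>) = inverse (e\<^sup>2)" by simp
      then have "X \<theta> - cis (- 2 * \<theta>) / 6 = (e\<^sup>2 * (of_real ?T)\<^sup>2 * (3 + of_real ?T * e) - w ^ 3) / (6 * e\<^sup>2 * w ^ 3)"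
        unfolding X_def e_def[symmetric] w_def[symmetric] using e w by (simp add: field_simps power_inverse)
      \<comment> \<open>The terms of order \<open>?T ^ 3\<close> and \<open>?T\<^sup>2\<close>
        cancel, so the distance from the limit is of order \<open>?T ^ (-2)\<close>.\<close>
      also have "e\<^sup>2 * (of_real ?T)\<^sup>2 * (3 + of_real ?T * e) - w ^ 3 = - (1 + 3 * of_real ?T * e)"
        unfolding w_def by (simp add: algebra_simps power2_eq_square power3_eq_cube)
      finally have Xeq: "X \<theta> - cis (- 2 * \<theta>) / 6 = - (1 + 3 * of_real ?T * e) / (6 * e\<^sup>2 * w ^ 3)" .
      have "norm (X \<theta> - cis (- 2 * \<theta>) / 6) = norm (1 + 3 * of_real ?T * e) / (6 * norm w ^ 3)"
        unfolding Xeq norm_divide norm_minus_cancel using e by (simp add: norm_mult norm_power)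
      also have "\<dots> \<le> (3 * (1 + ?T)) / (6 * (?\<delta> * (1 + ?T)) ^ 3)"
      proof (rule frac_le)
        have "norm (1 + 3 * of_real ?T * e) \<le> norm (1::complex) + norm (3 * of_real ?T * e)" by (rule norm_triangle_ineq)
        also have "\<dots> = 1 + 3 * ?T" using e s h by (simp add: norm_mult)
        finally show "norm (1 + 3 * of_real ?T * e) \<le> 3 * (1 + ?T)" by simp
        have le: "?\<delta> * (1 + ?T) \<le> norm w"
          using cgo_polar(2)[OF \<theta>(1-3) _ _ _ s, of h \<theta>] h t by (simp add: w_def e_def)
        have p: "0 < ?\<delta> * (1 + ?T)" using \<delta> T by (intro mult_pos_pos) auto
        show "6 * (?\<delta> * (1 + ?T)) ^ 3 \<le> 6 * norm w ^ 3" using le p by (intro mult_left_mono power_mono) auto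
        show "0 < 6 * (?\<delta> * (1 + ?T)) ^ 3" using p by simp
        show "0 \<le> 3 * (1 + ?T)" using T by simp
      qed
      also have "\<dots> = 1 / (2 * ?\<delta> ^ 3 * (1 + ?T)\<^sup>2)"
      proof -
        have "3 * u / (6 * (?\<delta> * u) ^ 3) = 1 / (2 * ?\<delta> ^ 3 * u\<^sup>2)" if "u \<noteq> 0" for u
          using \<delta> that by (simp add: power_mult_distrib field_simps eval_nat_numeral)
        from this[of "1 + ?T"] show ?thesis using T by simp
      qed
      \<comment> \<open>One order of decay is given away for a simpler bound; the rate
        \<open>1 / s\<close> is enough.\<close>
      also have "\<dots> \<le> 1 / (2 * ?\<delta> ^ 3 * (h * s))"
      proof (rule divide_left_mono)
        have "(1 + ?T)\<^sup>2 = 1 + 2 * ?T + ?T\<^sup>2" by algebra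
        then have "?T \<le> (1 + ?T)\<^sup>2" using T zero_le_power2[of ?T] by linarith
        then show "2 * ?\<delta> ^ 3 * (h * s) \<le> 2 * ?\<delta> ^ 3 * (1 + ?T)\<^sup>2"
          using \<delta> by (intro mult_left_mono) (auto simp: mult.commute)
        show "0 < 2 * ?\<delta> ^ 3 * (1 + ?T)\<^sup>2 * (2 * ?\<delta> ^ 3 * (h * s))"
          using \<delta> s h T by (intro mult_pos_pos zero_less_power add_pos_pos) auto
      qed simp
      finally show ?thesis by (simp add: mult.assoc)
    qed
    have "((\<lambda>\<theta>. X \<theta> - cis (- 2 * \<theta>) / 6) has_integral (integral {\<theta>m..\<theta>M} X - ?c)) {\<theta>m..\<theta>M}"
      by (intro has_integral_diff hc integrable_integral integrable_continuous_interval cX)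
    then have "norm (integral {\<theta>m..\<theta>M} X - ?c) \<le> (1 / (2 * ?\<delta> ^ 3 * h) / s) * measure lborel (cbox \<theta>m \<theta>M)"
      using \<delta> h s Xd by (intro has_integral_bound[of _ "\<lambda>\<theta>. X \<theta> - cis (- 2 * \<theta>) / 6"]) auto
    then show ?thesis unfolding I using \<theta> by (simp add: mult.commute)
  qed
  have "(\<lambda>n. of_real ((real n)\<^sup>2) * (LINT x:S_sector \<theta>m \<theta>M h|lebesgue. cgo ?\<delta> (real n) x ^ 4) - ?c) \<longlonglongrightarrow> 0"
  proof (rule Lim_null_comparison)
    show "\<forall>\<^sub>F n in sequentially. norm (of_real ((real n)\<^sup>2) * (LINT x:S_sector \<theta>m \<theta>M h|lebesgue. cgo ?\<delta> (real n) x ^ 4) - ?c)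
        \<le> (\<theta>M - \<theta>m) * (1 / (2 * ?\<delta> ^ 3 * h) / real n)"
      by (rule eventually_sequentiallyI[of 1], rule bnd) simp
    show "(\<lambda>n. (\<theta>M - \<theta>m) * (1 / (2 * ?\<delta> ^ 3 * h) / real n)) \<longlonglongrightarrow> 0"
      by (intro tendsto_mult_right_zero lim_const_over_n)
  qed
  then show "(\<lambda>n. of_real ((real n)\<^sup>2) * (LINT x:S_sector \<theta>m \<theta>M h|lebesgue. cgo ?\<delta> (real n) x ^ 4)) \<longlonglongrightarrow> ?c"
    by (rule LIM_zero_cancel)
qed

section \<open>Herglotz waves\<close>

lemma norm_exp_i_diff_le: "norm (exp (\<i> * of_real a) - exp (\<i> * of_real b)) \<le> \<bar>a - b\<bar>"
proof -
  have "exp (\<i> * of_real a) - exp (\<i> * of_real b) = exp (\<i> * of_real b) * (exp (\<i> * of_real (a - b)) - 1)"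
    by (simp add: algebra_simps flip: exp_add)
  then have "norm (exp (\<i> * of_real a) - exp (\<i> * of_real b)) = 2 * \<bar>sin ((a - b) / 2)\<bar>"
    by (simp only: norm_mult norm_exp_i_times dist_exp_i_1)
  also have "\<dots> \<le> 2 * \<bar>(a - b) / 2\<bar>" by (intro mult_left_mono abs_sin_x_le_abs_x) auto
  finally show ?thesis by simp
qed

lemma sphere_circle_measure:
  "sphere 0 1 \<in> sets circle_measure" "emeasure circle_measure (sphere 0 1) < \<infinity>"
  "measure circle_measure (sphere 0 1) = 2 * pi"
  by (simp_all add: emeasure_circle_measure measure_def circle_measure_def)
    (simp_all flip: circle_measure_def add: emeasure_circle_measure)

text \<open>The phases are Lipschitz with constant \<open>k\<close> for directions on the unit
  circle, and Cauchy-Schwarz on a circle of length \<open>2 * pi\<close> yields the kernel norm.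
  Thus the growth allowed to the kernels in \<open>j\<close> is also that of the Lipschitz
  constants.\<close>

lemma herglotz_lipschitz:
  assumes g: "L2_on circle_measure (sphere 0 1) g" and k: "0 \<le> k"
  shows "norm (herglotz k g x - herglotz k g y)
    \<le> k * sqrt (2 * pi) * L2_norm_on circle_measure (sphere 0 1) g * norm (x - y)"
proof -
  let ?M = circle_measure and ?S = "sphere 0 1 :: (real ^ 2) set"
  let ?e = "\<lambda>x \<xi>. exp (\<i> * complex_of_real (k * (\<xi> \<bullet> x)))"
  have me: "set_borel_measurable ?M ?S (?e x)" for x
  proof -
    have "continuous_on UNIV (?e x)" by (intro continuous_intros)
    then have "?e x \<in> borel_measurable ?M"
      using borel_measurable_continuous_onI by (simp add: circle_measure_def)
    then show ?thesis unfolding set_borel_measurable_def using sphere_circle_measure(1) by measurable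
  qed
  have "norm (?e x \<xi>) \<le> 1" for x \<xi> by simp
  then have i: "set_integrable ?M ?S (\<lambda>\<xi>. ?e x \<xi> * g \<xi>)" for x
    by (intro L2_on_integrable(1)[OF L2_on_bounded_mult[OF g me]] sphere_circle_measure)
  have "norm (herglotz k g x - herglotz k g y) = norm (LINT \<xi>:?S|?M. ?e x \<xi> * g \<xi> - ?e y \<xi> * g \<xi>)"
    unfolding herglotz_def by (simp only: set_integral_diff(2)[OF i i])
  also have "\<dots> \<le> (LINT \<xi>:?S|?M. norm (?e x \<xi> * g \<xi> - ?e y \<xi> * g \<xi>))"
    by (intro set_integral_norm_bound set_integral_diff(1) i)
  also have "\<dots> \<le> (LINT \<xi>:?S|?M. k * norm (x - y) * norm (g \<xi>))"
  proof (rule set_integral_mono)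
    show "set_integrable ?M ?S (\<lambda>\<xi>. norm (?e x \<xi> * g \<xi> - ?e y \<xi> * g \<xi>))"
      by (intro set_integrable_norm set_integral_diff(1) i)
    show "set_integrable ?M ?S (\<lambda>\<xi>. k * norm (x - y) * norm (g \<xi>))"
      by (intro set_integrable_mult_right set_integrable_norm L2_on_integrable(1)[OF g] sphere_circle_measure)
    fix \<xi> :: "real ^ 2" assume \<xi>: "\<xi> \<in> ?S"
    have "norm (?e x \<xi> - ?e y \<xi>) \<le> \<bar>k * (\<xi> \<bullet> x) - k * (\<xi> \<bullet> y)\<bar>" by (rule norm_exp_i_diff_le)
    also have "\<dots> = k * \<bar>\<xi> \<bullet> (x - y)\<bar>" using k by (simp add: inner_diff_right abs_mult flip: right_diff_distrib)
    also have "\<dots> \<le> k * (norm \<xi> * norm (x - y))" using k by (intro mult_left_mono Cauchy_Schwarz_ineq2)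
    also have "\<dots> = k * norm (x - y)" using \<xi> by simp
    finally have "norm (?e x \<xi> - ?e y \<xi>) * norm (g \<xi>) \<le> k * norm (x - y) * norm (g \<xi>)"
      by (rule mult_right_mono) simp
    then show "norm (?e x \<xi> * g \<xi> - ?e y \<xi> * g \<xi>) \<le> k * norm (x - y) * norm (g \<xi>)"
      by (simp only: norm_mult flip: left_diff_distrib)
  qed
  also have "\<dots> = k * norm (x - y) * (LINT \<xi>:?S|?M. norm (g \<xi>))" by (rule set_integral_mult_right)
  also have "\<dots> \<le> k * norm (x - y) * (sqrt (2 * pi) * L2_norm_on ?M ?S g)"
    using L2_on_integrable(2)[OF g sphere_circle_measure(1,2)] k unfolding sphere_circle_measure(3)
    by (intro mult_left_mono) auto
  finally show ?thesis by (simp add: mult_ac)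
qed

lemma L2_norm_on_nonneg: "0 \<le> L2_norm_on M S f"
  unfolding L2_norm_on_def set_lebesgue_integral_def
  by (intro real_sqrt_ge_zero integral_nonneg_AE) auto

lemma herglotz_continuous:
  assumes g: "L2_on circle_measure (sphere 0 1) g" and k: "0 \<le> k"
  shows "continuous_on UNIV (herglotz k g)"
proof -
  have "(k * sqrt (2 * pi) * L2_norm_on circle_measure (sphere 0 1) g)-lipschitz_on UNIV (herglotz k g)"
    using herglotz_lipschitz[OF g k] k L2_norm_on_nonneg
    by (intro lipschitz_onI) (auto simp: dist_norm intro!: mult_nonneg_nonneg)
  then show ?thesis by (rule lipschitz_on_continuous_on)
qed

text \<open>Points of a side lie outside the open sector but are limits of points of the sector at
  the same radius and slightly turned angles. Hence integrals along the sides are controlled by the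
  boundary measure of \<open>\<Omega>\<close>.\<close>

lemma ray_in_frontier:
  assumes \<theta>: "- pi < \<theta>m" "\<theta>m < \<theta>M" "\<theta>M < pi" and S: "\<Omega> \<inter> ball 0 h = S_sector \<theta>m \<theta>M h"
    and r: "0 < r" "r < h" and t: "\<theta> = \<theta>m \<or> \<theta> = \<theta>M"
  shows "polar r \<theta> \<in> frontier \<Omega>"
proof -
  have "polar r \<theta> \<notin> S_sector \<theta>m \<theta>M h" using \<theta> r t by (subst polar_in_S_sector_iff) auto
  moreover have "polar r \<theta> \<in> ball 0 h" using r by simp
  ultimately have nin: "polar r \<theta> \<notin> \<Omega>" using S by blast
  \<comment> \<open>At most half of the opening, so that turning inwards by \<open>a n\<close> stays
    strictly between the two angles.\<close>
  define a where "a n = (\<theta>M - \<theta>m) / 2 / real (Suc n)" for n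
  define d where "d n = (if \<theta> = \<theta>m then \<theta> + a n else \<theta> - a n)" for n
  have a: "0 < a n" "a n \<le> (\<theta>M - \<theta>m) / 2" for n
    using \<theta> divide_left_mono[of 1 "real (Suc n)" "(\<theta>M - \<theta>m) / 2"] by (auto simp: a_def)
  have d: "\<theta>m < d n \<and> d n < \<theta>M" for n
    using a[of n] t \<theta> by (cases "\<theta> = \<theta>m") (simp_all add: d_def field_simps)
  have "polar r (d n) \<in> \<Omega>" for n
  proof -
    have "polar r (d n) \<in> S_sector \<theta>m \<theta>M h" using d[of n] \<theta> r by (subst polar_in_S_sector_iff) auto
    then show ?thesis using S by blast
  qed
  moreover have "(\<lambda>n. polar r (d n)) \<longlonglongrightarrow> polar r \<theta>"
  proof -
    have "a \<longlonglongrightarrow> 0" unfolding a_def by (rule LIMSEQ_Suc[OF lim_const_over_n])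
    then have "(\<lambda>n. \<theta> + a n) \<longlonglongrightarrow> \<theta> + 0" "(\<lambda>n. \<theta> - a n) \<longlonglongrightarrow> \<theta> - 0"
      by (intro tendsto_add tendsto_diff tendsto_const; assumption)+
    then have "d \<longlonglongrightarrow> \<theta>" unfolding d_def by (cases "\<theta> = \<theta>m") simp_all
    then show ?thesis unfolding polar_def by (intro tendsto_intros) auto
  qed
  ultimately have "polar r \<theta> \<in> closure \<Omega>"
    unfolding closure_sequential by (intro exI[of _ "\<lambda>n. polar r (d n)"]) auto
  then show ?thesis using nin interior_subset by (auto simp: frontier_def)
qed

section \<open>Functions with zero Cauchy data at a corner\<close>

lemma set_integral_cong_AE_integrable:
  fixes f g :: "'a \<Rightarrow> complex"
  assumes "set_integrable M A f" "set_integrable M A g" "AE x in M. x \<in> A \<longrightarrow> f x = g x"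
  shows "(LINT x:A|M. f x) = (LINT x:A|M. g x)"
  unfolding set_lebesgue_integral_def
proof (rule integral_cong_AE)
  show "AE x in M. indicator A x *\<^sub>R f x = indicator A x *\<^sub>R g x"
    using assms(3) by (rule eventually_mono) (auto simp: indicator_def)
qed (use assms(1,2) in \<open>auto simp: set_integrable_def\<close>)

lemma set_integral_nonneg':
  fixes f :: "'a \<Rightarrow> real"
  assumes "\<And>x. x \<in> A \<Longrightarrow> 0 \<le> f x" shows "0 \<le> (LINT x:A|M. f x)"
  unfolding set_lebesgue_integral_def using assms
  by (intro integral_nonneg_AE) (auto simp: indicator_def)

lemma set_integral_mono_set:
  fixes f :: "'a \<Rightarrow> real"
  assumes "set_integrable M A f" "B \<in> sets M" "B \<subseteq> A" "\<And>x. 0 \<le> f x"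
  shows "(LINT x:B|M. f x) \<le> (LINT x:A|M. f x)"
  unfolding set_lebesgue_integral_def
proof (rule integral_mono)
  show "integrable M (\<lambda>x. indicator B x *\<^sub>R f x)"
    using set_integrable_subset[OF assms(1-3)] by (simp add: set_integrable_def)
qed (use assms in \<open>auto simp: indicator_def set_integrable_def\<close>)

lemma L1_tendsto_mult:
  fixes f b :: "'a \<Rightarrow> complex" and F :: "nat \<Rightarrow> 'a \<Rightarrow> complex"
  assumes lim: "(\<lambda>n. LINT x:A|M. norm (f x - F n x)) \<longlonglongrightarrow> 0"
    and f: "set_integrable M A f" and F: "\<And>n. set_integrable M A (F n)"
    and B: "B \<in> sets M" "B \<subseteq> A" and b: "\<And>x. x \<in> B \<Longrightarrow> norm (b x) \<le> P" and P: "0 \<le> P"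
    and i: "set_integrable M B (\<lambda>x. f x * b x)" "\<And>n. set_integrable M B (\<lambda>x. F n x * b x)"
  shows "(\<lambda>n. LINT x:B|M. F n x * b x) \<longlonglongrightarrow> (LINT x:B|M. f x * b x)"
proof (rule LIM_zero_cancel, rule Lim_null_comparison)
  have "norm ((LINT x:B|M. F n x * b x) - (LINT x:B|M. f x * b x)) \<le> P * (LINT x:A|M. norm (f x - F n x))" for n
  proof -
    have d: "set_integrable M A (\<lambda>x. norm (f x - F n x))" by (intro set_integrable_norm set_integral_diff(1) f F)
    have "norm ((LINT x:B|M. F n x * b x) - (LINT x:B|M. f x * b x)) = norm (LINT x:B|M. F n x * b x - f x * b x)"
      by (simp only: set_integral_diff(2)[OF i(2) i(1)])
    also have "\<dots> \<le> (LINT x:B|M. norm (F n x * b x - f x * b x))"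
      by (intro set_integral_norm_bound set_integral_diff(1) i)
    also have "\<dots> \<le> (LINT x:B|M. P * norm (f x - F n x))"
    proof (rule set_integral_mono)
      show "set_integrable M B (\<lambda>x. norm (F n x * b x - f x * b x))"
        by (intro set_integrable_norm set_integral_diff(1) i)
      show "set_integrable M B (\<lambda>x. P * norm (f x - F n x))"
        by (intro set_integrable_mult_right set_integrable_subset[OF d B])
      fix x assume x: "x \<in> B"
      have "F n x * b x - f x * b x = - (b x * (f x - F n x))" by (simp add: algebra_simps)
      then have "norm (F n x * b x - f x * b x) = norm (b x) * norm (f x - F n x)"
        by (simp only: norm_minus_cancel norm_mult)
      also have "\<dots> \<le> P * norm (f x - F n x)" using b[OF x] by (rule mult_right_mono) simp
      finally show "norm (F n x * b x - f x * b x) \<le> P * norm (f x - F n x)" .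
    qed
    also have "\<dots> = P * (LINT x:B|M. norm (f x - F n x))" by (rule set_integral_mult_right)
    also have "\<dots> \<le> P * (LINT x:A|M. norm (f x - F n x))"
      using P by (intro mult_left_mono set_integral_mono_set d B) auto
    finally show ?thesis .
  qed
  then show "\<forall>\<^sub>F n in sequentially. norm ((LINT x:B|M. F n x * b x) - (LINT x:B|M. f x * b x)) \<le> P * (LINT x:A|M. norm (f x - F n x))"
    by simp
  show "(\<lambda>n. P * (LINT x:A|M. norm (f x - F n x))) \<longlonglongrightarrow> 0" using tendsto_mult_right_zero[OF lim] .
qed

lemma L1_tendsto_norm:
  fixes f :: "'a \<Rightarrow> complex" and F :: "nat \<Rightarrow> 'a \<Rightarrow> complex"
  assumes lim: "(\<lambda>n. LINT x:A|M. norm (f x - F n x)) \<longlonglongrightarrow> 0"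
    and f: "set_integrable M A f" and F: "\<And>n. set_integrable M A (F n)"
    and B: "B \<in> sets M" "B \<subseteq> A"
  shows "(\<lambda>n. LINT x:B|M. norm (F n x)) \<longlonglongrightarrow> (LINT x:B|M. norm (f x))"
proof (rule LIM_zero_cancel, rule Lim_null_comparison[OF _ lim])
  have "norm ((LINT x:B|M. norm (F n x)) - (LINT x:B|M. norm (f x))) \<le> (LINT x:A|M. norm (f x - F n x))" for n
  proof -
    have d: "set_integrable M A (\<lambda>x. norm (f x - F n x))" by (intro set_integrable_norm set_integral_diff(1) f F)
    have iB: "set_integrable M B (\<lambda>x. norm (F n x))" "set_integrable M B (\<lambda>x. norm (f x))"
      by (intro set_integrable_norm set_integrable_subset[OF f B] set_integrable_subset[OF F B])+
    have "norm ((LINT x:B|M. norm (F n x)) - (LINT x:B|M. norm (f x))) = norm (LINT x:B|M. norm (F n x) - norm (f x))"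
      by (simp only: set_integral_diff(2)[OF iB])
    also have "\<dots> \<le> (LINT x:B|M. norm (norm (F n x) - norm (f x)))"
      by (intro set_integral_norm_bound set_integral_diff(1) iB)
    also have "\<dots> \<le> (LINT x:B|M. norm (f x - F n x))"
    proof (rule set_integral_mono)
      show "norm (norm (F n x) - norm (f x)) \<le> norm (f x - F n x)" for x
        using norm_triangle_ineq3[of "F n x" "f x"] by (simp add: norm_minus_commute)
    qed (intro set_integrable_norm set_integral_diff(1) iB set_integrable_subset[OF d B])+
    also have "\<dots> \<le> (LINT x:A|M. norm (f x - F n x))"
      by (intro set_integral_mono_set d B) auto
    finally show ?thesis .
  qed
  then show "\<forall>\<^sub>F n in sequentially. norm ((LINT x:B|M. norm (F n x)) - (LINT x:B|M. norm (f x))) \<le> (LINT x:A|M. norm (f x - F n x))"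
    by simp
qed

text \<open>Both normal derivatives are the same functional \<open>F\<close>, and a smooth
  \<open>\<phi>\<close> is its own trace, so the two Green formulas may be equated. The Laplacian
  inside \<open>has_normal_derivative\<close> is given only existentially; uniqueness almost
  everywhere lets \<open>a\<close> and \<open>b\<close> replace it.\<close>

lemma equal_normal_derivatives:
  fixes v w a b :: "real ^ 2 \<Rightarrow> complex"
  assumes U: "bounded U" "open U" and fin: "emeasure hausdorff1 (frontier U) < \<infinity>"
    and la: "has_weak_laplacian U v a" and lb: "has_weak_laplacian U w b"
    and nv: "has_normal_derivative U v F" and nw: "has_normal_derivative U w F"
    and \<phi>: "smooth \<phi>"
  shows "(LINT x:U|lebesgue. (a x - b x) * \<phi> x)
    = - (LINT x:U|lebesgue. \<Sum>i\<in>UNIV. (weak_partial U i v x - weak_partial U i w x) * partial i \<phi> x)"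
proof -
  have Lp: "L2_on lebesgue U \<phi>" "L2_on lebesgue U (partial i \<phi>)" for i by (intro smooth_L2 \<phi> U)+
  have key: "F \<phi> = (LINT x:U|lebesgue. a x * \<phi> x) + (LINT x:U|lebesgue. \<Sum>i\<in>UNIV. weak_partial U i v x * partial i \<phi> x)"
    "set_integrable lebesgue U (\<lambda>x. a x * \<phi> x)"
    "set_integrable lebesgue U (\<lambda>x. weak_partial U i v x * partial i \<phi> x)"
    if la: "has_weak_laplacian U v a" and nv: "has_normal_derivative U v F" for v a :: "real ^ 2 \<Rightarrow> complex" and i
  proof -
    have sv: "sobolev 1 U v" using nv by (simp add: has_normal_derivative_def)
    obtain f where f: "has_weak_laplacian U v f" and Ff: "\<And>\<phi> g. has_trace U \<phi> g \<Longrightarrow> F g = (LINT x:U|lebesgue.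
          f x * \<phi> x + (\<Sum>i\<in>UNIV. weak_partial U i v x * weak_partial U i \<phi> x))"
      using nv unfolding has_normal_derivative_def by blast
    have L: "L2_on lebesgue U a" "L2_on lebesgue U f" "L2_on lebesgue U (weak_partial U i v)" for i
      using la f sobolev1D(3)[OF sv U(2)] by (auto simp: has_weak_laplacian_def)
    have Lw: "L2_on lebesgue U (weak_partial U i \<phi>)" for i
      by (rule weak_partialI(2)[OF U(2) smooth_has_weak_partial[OF U(2) \<phi>] Lp(2)])
    show ia: "set_integrable lebesgue U (\<lambda>x. a x * \<phi> x)"
      and ip: "\<And>i. set_integrable lebesgue U (\<lambda>x. weak_partial U i v x * partial i \<phi> x)"
      by (intro L2_on_mult_integrable L Lp)+
    have iw: "set_integrable lebesgue U (\<lambda>x. weak_partial U i v x * weak_partial U i \<phi> x)" for i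
      by (intro L2_on_mult_integrable L Lw)
    have "F \<phi> = (LINT x:U|lebesgue. f x * \<phi> x + (\<Sum>i\<in>UNIV. weak_partial U i v x * weak_partial U i \<phi> x))"
      by (rule Ff[OF smooth_has_trace[OF \<phi> U fin]])
    also have "\<dots> = (LINT x:U|lebesgue. a x * \<phi> x + (\<Sum>i\<in>UNIV. weak_partial U i v x * partial i \<phi> x))"
    proof (rule set_integral_cong_AE_integrable)
      show "set_integrable lebesgue U (\<lambda>x. f x * \<phi> x + (\<Sum>i\<in>UNIV. weak_partial U i v x * weak_partial U i \<phi> x))"
        unfolding sum_2 by (intro set_integral_add(1) iw L2_on_mult_integrable L Lp)
      show "set_integrable lebesgue U (\<lambda>x. a x * \<phi> x + (\<Sum>i\<in>UNIV. weak_partial U i v x * partial i \<phi> x))"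
        unfolding sum_2 by (intro set_integral_add(1) ip ia)
      have "AE x in lebesgue. x \<in> U \<longrightarrow> f x = a x" by (rule has_weak_laplacian_unique[OF U(2) f la])
      moreover note weak_partial_smooth[OF \<phi> U, of 1] weak_partial_smooth[OF \<phi> U, of 2]
      ultimately show "AE x in lebesgue. x \<in> U \<longrightarrow> f x * \<phi> x + (\<Sum>i\<in>UNIV. weak_partial U i v x * weak_partial U i \<phi> x)
          = a x * \<phi> x + (\<Sum>i\<in>UNIV. weak_partial U i v x * partial i \<phi> x)"
        by eventually_elim (simp add: sum_2)
    qed
    also have "\<dots> = (LINT x:U|lebesgue. a x * \<phi> x) + (LINT x:U|lebesgue. \<Sum>i\<in>UNIV. weak_partial U i v x * partial i \<phi> x)"
      unfolding sum_2 by (intro set_integral_add(2) set_integral_add(1) ia ip)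
    finally show "F \<phi> = (LINT x:U|lebesgue. a x * \<phi> x) + (LINT x:U|lebesgue. \<Sum>i\<in>UNIV. weak_partial U i v x * partial i \<phi> x)" .
  qed
  note kv = key[OF la nv] and kw = key[OF lb nw]
  let ?V = "\<lambda>x. \<Sum>i\<in>UNIV. weak_partial U i v x * partial i \<phi> x"
  let ?W = "\<lambda>x. \<Sum>i\<in>UNIV. weak_partial U i w x * partial i \<phi> x"
  have A: "(LINT x:U|lebesgue. (a x - b x) * \<phi> x) = (LINT x:U|lebesgue. a x * \<phi> x) - (LINT x:U|lebesgue. b x * \<phi> x)"
    unfolding left_diff_distrib by (intro set_integral_diff(2) kv(2) kw(2))
  have B: "(LINT x:U|lebesgue. ?V x - ?W x) = (LINT x:U|lebesgue. ?V x) - (LINT x:U|lebesgue. ?W x)"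
    unfolding sum_2 by (intro set_integral_diff(2) set_integral_add(1) kv(3) kw(3))
  have C: "(\<lambda>x. \<Sum>i\<in>UNIV. (weak_partial U i v x - weak_partial U i w x) * partial i \<phi> x) = (\<lambda>x. ?V x - ?W x)"
    by (simp add: left_diff_distrib sum_subtractf)
  have E: "(LINT x:U|lebesgue. a x * \<phi> x) + (LINT x:U|lebesgue. ?V x) = (LINT x:U|lebesgue. b x * \<phi> x) + (LINT x:U|lebesgue. ?W x)"
    using kv(1) kw(1) by simp
  have "x + p = y + q \<Longrightarrow> x - y = - (p - q)" for x y p q :: complex by (simp add: algebra_simps)
  from this[OF E] show ?thesis unfolding A B C .
qed

text \<open>The sides of the sector belong to the frontier, so the L1 norm on the frontier dominates
  the integral along a ray.\<close>

lemma ray_integral_tendsto_0: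
  fixes \<zeta> :: "nat \<Rightarrow> real ^ 2 \<Rightarrow> complex"
  assumes \<theta>: "- pi < \<theta>m" "\<theta>m < \<theta>M" "\<theta>M < pi" and S: "\<Omega> \<inter> ball 0 h = S_sector \<theta>m \<theta>M h"
    and U: "bounded \<Omega>" and fin: "emeasure hausdorff1 (frontier \<Omega>) < \<infinity>"
    and s: "\<And>n. smooth (\<zeta> n)" and lim: "(\<lambda>n. LINT x:frontier \<Omega>|hausdorff1. norm (\<zeta> n x)) \<longlonglongrightarrow> 0"
    and R: "0 < R" "R \<le> h" and t: "\<theta> = \<theta>m \<or> \<theta> = \<theta>M"
  shows "(\<lambda>n. integral {0..R} (\<lambda>r. norm (\<zeta> n (polar r \<theta>)))) \<longlonglongrightarrow> 0"
proof (rule tendsto_sandwich[OF _ _ tendsto_const lim])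
  show "\<forall>\<^sub>F n in sequentially. 0 \<le> integral {0..R} (\<lambda>r. norm (\<zeta> n (polar r \<theta>)))"
    by (intro always_eventually allI integral_nonneg integrable_continuous_interval continuous_polar_compose(2)
        continuous_intros smooth_continuous_on s) auto
  have "integral {0..R} (\<lambda>r. norm (\<zeta> n (polar r \<theta>))) \<le> (LINT x:frontier \<Omega>|hausdorff1. norm (\<zeta> n x))" for n
  proof -
    have "integral {0..R} (\<lambda>r. norm (\<zeta> n (r *\<^sub>R polar 1 \<theta>))) \<le> (LINT x:frontier \<Omega>|hausdorff1. norm (\<zeta> n x))"
    proof (rule segment_integral_le_hausdorff1)
      show "continuous_on UNIV (\<lambda>x. norm (\<zeta> n x))" by (intro continuous_intros smooth_continuous_on s)
      show "r *\<^sub>R polar 1 \<theta> \<in> frontier \<Omega>" if "0 < r" "r < R" for r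
        using ray_in_frontier[OF \<theta> S _ _ t, of r] that R polar_scaleR[of r \<theta>] by simp
      have "L2_on hausdorff1 (frontier \<Omega>) (\<zeta> n)"
        using U fin by (intro continuous_hausdorff_L2 smooth_continuous_on s bounded_frontier) auto
      then show "set_integrable hausdorff1 (frontier \<Omega>) (\<lambda>x. norm (\<zeta> n x))"
        using fin by (intro set_integrable_norm L2_on_integrable(1)) (auto simp: sets_hausdorff1)
    qed auto
    then show ?thesis unfolding polar_scaleR[symmetric] .
  qed
  then show "\<forall>\<^sub>F n in sequentially. integral {0..R} (\<lambda>r. norm (\<zeta> n (polar r \<theta>))) \<le> (LINT x:frontier \<Omega>|hausdorff1. norm (\<zeta> n x))"
    by simp
qed

lemma sector_subset:
  assumes "\<Omega> \<inter> ball 0 h = S_sector \<theta>m \<theta>M h" "R \<le> h"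
  shows "ball 0 R \<inter> \<Omega> = S_sector \<theta>m \<theta>M R" "S_sector \<theta>m \<theta>M R \<subseteq> \<Omega>" "S_sector \<theta>m \<theta>M R \<subseteq> S_sector \<theta>m \<theta>M h"
proof -
  have eq: "x \<in> \<Omega> \<longleftrightarrow> x \<in> sector \<theta>m \<theta>M" if "norm x < h" for x
    using assms(1) that unfolding S_sector_def set_eq_iff by auto
  then show "ball 0 R \<inter> \<Omega> = S_sector \<theta>m \<theta>M R" "S_sector \<theta>m \<theta>M R \<subseteq> \<Omega>"
    using assms(2) by (auto simp: S_sector_def)
  show "S_sector \<theta>m \<theta>M R \<subseteq> S_sector \<theta>m \<theta>M h" using assms(2) by (auto simp: S_sector_def)
qed

text \<open>This is \<open>sector_poincare\<close> for \<open>\<zeta> n\<close> in the limit: the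
  side term disappears, so \<open>u\<close> obeys the inequality without having pointwise boundary
  values.\<close>

lemma zero_trace_poincare:
  fixes \<zeta> :: "nat \<Rightarrow> real ^ 2 \<Rightarrow> complex" and D :: "2 \<Rightarrow> real ^ 2 \<Rightarrow> complex"
  assumes \<theta>: "- pi < \<theta>m" "\<theta>m < \<theta>M" "\<theta>M < pi" and S: "\<Omega> \<inter> ball 0 h = S_sector \<theta>m \<theta>M h"
    and U: "bounded \<Omega>" "open \<Omega>" and fin: "emeasure hausdorff1 (frontier \<Omega>) < \<infinity>"
    and s: "\<And>n. smooth (\<zeta> n)" and lim: "(\<lambda>n. LINT x:frontier \<Omega>|hausdorff1. norm (\<zeta> n x)) \<longlonglongrightarrow> 0"
    and u: "set_integrable lebesgue \<Omega> u" "(\<lambda>n. LINT x:\<Omega>|lebesgue. norm (u x - \<zeta> n x)) \<longlonglongrightarrow> 0"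
    and D: "\<And>i. set_integrable lebesgue \<Omega> (D i)" "\<And>i. (\<lambda>n. LINT x:\<Omega>|lebesgue. norm (D i x - partial i (\<zeta> n) x)) \<longlonglongrightarrow> 0"
    and R: "0 < R" "R \<le> h"
  shows "(LINT x:S_sector \<theta>m \<theta>M R|lebesgue. norm (u x)) \<le> (\<theta>M - \<theta>m) * R *
    ((LINT x:S_sector \<theta>m \<theta>M R|lebesgue. norm (D 1 x)) + (LINT x:S_sector \<theta>m \<theta>M R|lebesgue. norm (D 2 x)))"
proof (rule LIMSEQ_le)
  let ?S = "S_sector \<theta>m \<theta>M R"
  have mS: "?S \<in> sets lebesgue" "?S \<subseteq> \<Omega>" using S_sector_lebesgue[of \<theta>m \<theta>M R] \<theta> sector_subset(2)[OF S R(2)] by auto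
  have i\<zeta>: "set_integrable lebesgue \<Omega> (\<zeta> n)" "set_integrable lebesgue \<Omega> (partial i (\<zeta> n))" for n i
    using U by (intro set_integrable_continuous smooth_continuous_on smooth_partial s; simp)+
  show "(\<lambda>n. LINT x:?S|lebesgue. norm (\<zeta> n x)) \<longlonglongrightarrow> (LINT x:?S|lebesgue. norm (u x))"
    by (rule L1_tendsto_norm[OF u(2,1) i\<zeta>(1) mS])
  have lD: "(\<lambda>n. LINT x:?S|lebesgue. norm (partial i (\<zeta> n) x)) \<longlonglongrightarrow> (LINT x:?S|lebesgue. norm (D i x))" for i
    by (rule L1_tendsto_norm[OF D(2,1) i\<zeta>(2) mS])
  have "(\<lambda>n. (\<theta>M - \<theta>m) * R * (integral {0..R} (\<lambda>r. norm (\<zeta> n (polar r \<theta>m)))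
      + ((LINT x:?S|lebesgue. norm (partial 1 (\<zeta> n) x)) + (LINT x:?S|lebesgue. norm (partial 2 (\<zeta> n) x)))))
    \<longlonglongrightarrow> (\<theta>M - \<theta>m) * R * (0 + ((LINT x:?S|lebesgue. norm (D 1 x)) + (LINT x:?S|lebesgue. norm (D 2 x))))"
    by (intro tendsto_mult tendsto_const tendsto_add lD ray_integral_tendsto_0[OF \<theta> S U(1) fin s lim R]) simp
  then show "(\<lambda>n. (\<theta>M - \<theta>m) * R * (integral {0..R} (\<lambda>r. norm (\<zeta> n (polar r \<theta>m)))
      + ((LINT x:?S|lebesgue. norm (partial 1 (\<zeta> n) x)) + (LINT x:?S|lebesgue. norm (partial 2 (\<zeta> n) x)))))
    \<longlonglongrightarrow> (\<theta>M - \<theta>m) * R * ((LINT x:?S|lebesgue. norm (D 1 x)) + (LINT x:?S|lebesgue. norm (D 2 x)))" by simp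
  have ip: "set_integrable lebesgue ?S (\<lambda>x. norm (partial i (\<zeta> n) x))" for i n
    by (intro set_integrable_norm set_integrable_subset[OF i\<zeta>(2) mS])
  have "(LINT x:?S|lebesgue. norm (\<zeta> n x)) \<le> (\<theta>M - \<theta>m) * R * (integral {0..R} (\<lambda>r. norm (\<zeta> n (polar r \<theta>m)))
      + ((LINT x:?S|lebesgue. norm (partial 1 (\<zeta> n) x)) + (LINT x:?S|lebesgue. norm (partial 2 (\<zeta> n) x))))" for n
    using sector_poincare[OF \<theta> R(1) s, of n] unfolding set_integral_add(2)[OF ip ip] .
  then show "\<exists>N. \<forall>n\<ge>N. (LINT x:?S|lebesgue. norm (\<zeta> n x)) \<le> (\<theta>M - \<theta>m) * R * (integral {0..R} (\<lambda>r. norm (\<zeta> n (polar r \<theta>m)))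
      + ((LINT x:?S|lebesgue. norm (partial 1 (\<zeta> n) x)) + (LINT x:?S|lebesgue. norm (partial 2 (\<zeta> n) x))))" by blast
qed

text \<open>Here \<open>n\<close> tends to infinity in \<open>cgo_green_bound\<close> for fixed
  \<open>t\<close>. The factor \<open>B\<close> of the side integrals depends on \<open>t\<close>
  but not on \<open>n\<close>, so it disappears with them, and the constant \<open>K * M\<close>
  that is left is uniform in \<open>t\<close>.\<close>

lemma zero_trace_cgo_bound:
  fixes \<zeta> :: "nat \<Rightarrow> real ^ 2 \<Rightarrow> complex" and D :: "2 \<Rightarrow> real ^ 2 \<Rightarrow> complex"
  assumes \<theta>: "- pi < \<theta>m" "\<theta>m < \<theta>M" "\<theta>M < pi" and h: "0 < h" and S: "\<Omega> \<inter> ball 0 h = S_sector \<theta>m \<theta>M h"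
    and U: "bounded \<Omega>" "open \<Omega>" and fin: "emeasure hausdorff1 (frontier \<Omega>) < \<infinity>"
    and s: "\<And>n. smooth (\<zeta> n)" and lim: "(\<lambda>n. LINT x:frontier \<Omega>|hausdorff1. norm (\<zeta> n x)) \<longlonglongrightarrow> 0"
    and u: "set_integrable lebesgue \<Omega> u" "(\<lambda>n. LINT x:\<Omega>|lebesgue. norm (u x - \<zeta> n x)) \<longlonglongrightarrow> 0"
    and D: "\<And>i. set_integrable lebesgue \<Omega> (D i)" "\<And>i. (\<lambda>n. LINT x:\<Omega>|lebesgue. norm (D i x - partial i (\<zeta> n) x)) \<longlonglongrightarrow> 0"
    and \<eta>: "smooth \<eta>" "\<And>x. norm x \<le> h / 2 \<Longrightarrow> \<eta> x = 1" "\<And>x. norm x = h \<Longrightarrow> \<eta> x = 0"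
  defines "\<delta> \<equiv> sector_gap \<theta>m \<theta>M"
  shows "\<exists>K\<ge>0. \<forall>t>0. norm (LINT x:S_sector \<theta>m \<theta>M h|lebesgue. \<Sum>i\<in>UNIV. D i x * partial i (\<lambda>x. \<eta> x * cgo \<delta> t x ^ 4) x) \<le> K / t ^ 4"
proof -
  let ?S = "S_sector \<theta>m \<theta>M h"
  have \<delta>: "0 < \<delta>" unfolding \<delta>_def by (rule sector_gap_pos[OF \<theta>])
  have mS: "?S \<in> sets lebesgue" "?S \<subseteq> \<Omega>" using S_sector_lebesgue[of \<theta>m \<theta>M h] \<theta> sector_subset(2)[OF S order_refl] by auto
  have i\<zeta>: "set_integrable lebesgue \<Omega> (\<zeta> n)" "set_integrable lebesgue \<Omega> (partial i (\<zeta> n))" for n i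
    using U by (intro set_integrable_continuous smooth_continuous_on smooth_partial s; simp)+
  define N where "N n = (LINT x:?S|lebesgue. norm (partial 1 (\<zeta> n) x) + norm (partial 2 (\<zeta> n) x) + norm (\<zeta> n x))" for n
  define M where "M = (LINT x:?S|lebesgue. norm (D 1 x)) + (LINT x:?S|lebesgue. norm (D 2 x)) + (LINT x:?S|lebesgue. norm (u x))"
  have ip: "set_integrable lebesgue ?S (\<lambda>x. norm (partial i (\<zeta> n) x))" "set_integrable lebesgue ?S (\<lambda>x. norm (\<zeta> n x))" for i n
    by (intro set_integrable_norm set_integrable_subset[OF i\<zeta>(2) mS] set_integrable_subset[OF i\<zeta>(1) mS])+
  have Neq: "N n = (LINT x:?S|lebesgue. norm (partial 1 (\<zeta> n) x)) + (LINT x:?S|lebesgue. norm (partial 2 (\<zeta> n) x)) + (LINT x:?S|lebesgue. norm (\<zeta> n x))" for n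
    unfolding N_def by (simp only: set_integral_add[OF ip(1) ip(1)] set_integral_add(2)[OF set_integral_add(1)[OF ip(1) ip(1)] ip(2)])
  have limN: "N \<longlonglongrightarrow> M"
    unfolding Neq M_def
    by (intro tendsto_add L1_tendsto_norm[OF D(2,1) i\<zeta>(2) mS] L1_tendsto_norm[OF u(2,1) i\<zeta>(1) mS])
  obtain K where K: "0 \<le> K" and KB: "\<And>t. 0 < t \<Longrightarrow> \<exists>B. \<forall>q. smooth q \<longrightarrow>
    norm (LINT x:?S|lebesgue. \<Sum>i\<in>UNIV. partial i q x * partial i (\<lambda>x. \<eta> x * cgo \<delta> t x ^ 4) x)
    \<le> K / t ^ 4 * (LINT x:?S|lebesgue. norm (partial 1 q x) + norm (partial 2 q x) + norm (q x))
      + B * integral {0..h} (\<lambda>r. norm (q (polar r \<theta>M)) + norm (q (polar r \<theta>m)))"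
    using cgo_green_bound[OF \<theta> h \<eta>, folded \<delta>_def] by blast
  have "norm (LINT x:?S|lebesgue. \<Sum>i\<in>UNIV. D i x * partial i (\<lambda>x. \<eta> x * cgo \<delta> t x ^ 4) x) \<le> K / t ^ 4 * M"
    if t: "0 < t" for t
  proof -
    let ?\<phi> = "\<lambda>x. \<eta> x * cgo \<delta> t x ^ 4"
    have \<phi>: "smooth ?\<phi>" by (intro smooth_mult smooth_power \<eta> smooth_cgo \<delta>)
    obtain B where B: "\<And>q. smooth q \<Longrightarrow>
      norm (LINT x:?S|lebesgue. \<Sum>i\<in>UNIV. partial i q x * partial i ?\<phi> x)
      \<le> K / t ^ 4 * (LINT x:?S|lebesgue. norm (partial 1 q x) + norm (partial 2 q x) + norm (q x))
        + B * integral {0..h} (\<lambda>r. norm (q (polar r \<theta>M)) + norm (q (polar r \<theta>m)))"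
      using KB[OF t] by blast
    have iD\<phi>: "set_integrable lebesgue ?S (\<lambda>x. f x * partial i ?\<phi> x)"
      "\<exists>P\<ge>0. \<forall>x\<in>?S. norm (partial i ?\<phi> x) \<le> P" if f: "set_integrable lebesgue ?S f" for f i
    proof -
      have c: "continuous_on UNIV (partial i ?\<phi>)" by (rule smooth_continuous_on[OF smooth_partial[OF \<phi>]])
      obtain P where P: "\<And>x. x \<in> ?S \<Longrightarrow> norm (partial i ?\<phi> x) \<le> P" "0 < P"
        using continuous_bounded_on[OF c bounded_S_sector] by blast
      then show "\<exists>P\<ge>0. \<forall>x\<in>?S. norm (partial i ?\<phi> x) \<le> P" by (auto intro!: exI[of _ P])
      show "set_integrable lebesgue ?S (\<lambda>x. f x * partial i ?\<phi> x)"
        unfolding set_integrable_def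
      proof (rule Bochner_Integration.integrable_bound)
        show "integrable lebesgue (\<lambda>x. P *\<^sub>R (indicator ?S x *\<^sub>R f x))"
          using f by (intro integrable_scaleR_right) (simp add: set_integrable_def)
        have "(\<lambda>x. (indicator ?S x *\<^sub>R f x) * (indicator ?S x *\<^sub>R partial i ?\<phi> x)) \<in> borel_measurable lebesgue"
          using f continuous_set_borel_measurable[OF c mS(1)]
          by (intro borel_measurable_times) (auto simp: set_integrable_def set_borel_measurable_def)
        moreover have "(\<lambda>x. (indicator ?S x *\<^sub>R f x) * (indicator ?S x *\<^sub>R partial i ?\<phi> x)) = (\<lambda>x. indicator ?S x *\<^sub>R (f x * partial i ?\<phi> x))"
          by (auto simp: indicator_def)
        ultimately show "(\<lambda>x. indicator ?S x *\<^sub>R (f x * partial i ?\<phi> x)) \<in> borel_measurable lebesgue" by simp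
        show "AE x in lebesgue. norm (indicator ?S x *\<^sub>R (f x * partial i ?\<phi> x)) \<le> norm (P *\<^sub>R (indicator ?S x *\<^sub>R f x))"
        proof (rule always_eventually, rule allI)
          fix x
          show "norm (indicator ?S x *\<^sub>R (f x * partial i ?\<phi> x)) \<le> norm (P *\<^sub>R (indicator ?S x *\<^sub>R f x))"
            using mult_right_mono[OF P(1), of x "norm (f x)"] P(2)
            by (cases "x \<in> ?S") (auto simp: norm_mult mult.commute)
        qed
      qed
    qed
    have iS: "set_integrable lebesgue ?S (D i)" "set_integrable lebesgue ?S (partial i (\<zeta> n))" for i n
      by (rule set_integrable_subset[OF D(1) mS], rule set_integrable_subset[OF i\<zeta>(2) mS])
    have lim1: "(\<lambda>n. LINT x:?S|lebesgue. partial i (\<zeta> n) x * partial i ?\<phi> x) \<longlonglongrightarrow> (LINT x:?S|lebesgue. D i x * partial i ?\<phi> x)" for i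
    proof -
      obtain P where P: "\<And>x. x \<in> ?S \<Longrightarrow> norm (partial i ?\<phi> x) \<le> P" and P0: "0 \<le> P"
        using iD\<phi>(2)[OF iS(1)] by blast
      show ?thesis
        by (rule L1_tendsto_mult[OF D(2,1) i\<zeta>(2) mS P P0 iD\<phi>(1)[OF iS(1)] iD\<phi>(1)[OF iS(2)]])
    qed
    have "(\<lambda>n. LINT x:?S|lebesgue. \<Sum>i\<in>UNIV. partial i (\<zeta> n) x * partial i ?\<phi> x)
        \<longlonglongrightarrow> (LINT x:?S|lebesgue. \<Sum>i\<in>UNIV. D i x * partial i ?\<phi> x)"
      unfolding sum_2 set_integral_add(2)[OF iD\<phi>(1)[OF iS(1)] iD\<phi>(1)[OF iS(1)]]
        set_integral_add(2)[OF iD\<phi>(1)[OF iS(2)] iD\<phi>(1)[OF iS(2)]]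
      by (intro tendsto_add lim1)
    note l1 = tendsto_norm[OF this]
    have sides: "integral {0..h} (\<lambda>r. norm (\<zeta> n (polar r \<theta>M)) + norm (\<zeta> n (polar r \<theta>m)))
        = integral {0..h} (\<lambda>r. norm (\<zeta> n (polar r \<theta>M))) + integral {0..h} (\<lambda>r. norm (\<zeta> n (polar r \<theta>m)))" for n
      by (intro integral_add integrable_continuous_interval continuous_polar_compose(2) continuous_intros smooth_continuous_on s)
    have l2: "(\<lambda>n. K / t ^ 4 * N n + B * integral {0..h} (\<lambda>r. norm (\<zeta> n (polar r \<theta>M)) + norm (\<zeta> n (polar r \<theta>m))))
        \<longlonglongrightarrow> K / t ^ 4 * M + B * (0 + 0)"
      unfolding sides
      by (intro tendsto_add tendsto_mult tendsto_const limN ray_integral_tendsto_0[OF \<theta> S U(1) fin s lim h order_refl]) auto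
    have "norm (LINT x:?S|lebesgue. \<Sum>i\<in>UNIV. D i x * partial i ?\<phi> x) \<le> K / t ^ 4 * M + B * (0 + 0)"
      by (rule LIMSEQ_le[OF l1 l2]) (use B[OF s] in \<open>auto simp: N_def\<close>)
    then show ?thesis by simp
  qed
  moreover have "0 \<le> M" unfolding M_def by (intro add_nonneg_nonneg set_integral_nonneg') auto
  ultimately show ?thesis using K by (intro exI[of _ "K * M"]) auto
qed

section \<open>Limits at the vertex\<close>

lemma cgo_pow4_le:
  assumes \<theta>: "- pi < \<theta>m" "\<theta>m < \<theta>M" "\<theta>M < pi" and x: "x \<in> S_sector \<theta>m \<theta>M R" and s: "0 < s"
  defines "\<delta> \<equiv> sector_gap \<theta>m \<theta>M"
  shows "norm (cgo \<delta> s x ^ 4) \<le> inverse (\<delta> ^ 4) * inverse (1 + s * norm x) ^ 4"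
  using power_mono[OF cgo_sector(3)[OF \<theta> x s] norm_ge_zero, of 4]
  by (simp add: \<delta>_def norm_power inverse_mult_distrib power_mult_distrib power_inverse)

text \<open>Since \<open>norm x powr \<beta> \<le> s powr (- \<beta>) * (1 + s * norm x)\<close> for
  \<open>\<beta> \<le> 1\<close>, the growth of \<open>f\<close> costs one of the four decaying
  factors; the remaining cube is the weight with integral \<open>O(s ^ (-2))\<close>.\<close>

lemma cgo_weighted_bound:
  fixes f :: "real ^ 2 \<Rightarrow> complex"
  assumes \<theta>: "- pi < \<theta>m" "\<theta>m < \<theta>M" "\<theta>M < pi" and R: "0 < R" and s: "0 < s"
    and \<beta>: "0 < \<beta>" "\<beta> \<le> 1" and A: "0 \<le> A"
    and f: "AE x in lebesgue. x \<in> S_sector \<theta>m \<theta>M R \<longrightarrow> norm (f x) \<le> A * norm x powr \<beta>"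
  defines "\<delta> \<equiv> sector_gap \<theta>m \<theta>M"
  assumes i: "set_integrable lebesgue (S_sector \<theta>m \<theta>M R) (\<lambda>x. f x * cgo \<delta> s x ^ 4)"
  shows "norm (LINT x:S_sector \<theta>m \<theta>M R|lebesgue. f x * cgo \<delta> s x ^ 4)
    \<le> A * inverse (\<delta> ^ 4) * ((\<theta>M - \<theta>m) / 2) * s powr (- 2 - \<beta>)"
proof -
  let ?S = "S_sector \<theta>m \<theta>M R"
  let ?c = "A * inverse (\<delta> ^ 4) * s powr (- \<beta>)"
  have \<delta>: "0 < \<delta>" unfolding \<delta>_def by (rule sector_gap_pos[OF \<theta>])
  note W = sector_weight_integral[OF \<theta> R s]
  have "norm (LINT x:?S|lebesgue. f x * cgo \<delta> s x ^ 4) \<le> (LINT x:?S|lebesgue. norm (f x * cgo \<delta> s x ^ 4))"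
    by (rule set_integral_norm_bound[OF i])
  also have "\<dots> \<le> (LINT x:?S|lebesgue. ?c * inverse (1 + s * norm x) ^ 3)"
  proof (rule set_integral_mono_AE)
    show "AE x\<in>?S in lebesgue. norm (f x * cgo \<delta> s x ^ 4) \<le> ?c * inverse (1 + s * norm x) ^ 3"
      using f
    proof (rule eventually_mono, intro impI)
      fix x assume *: "x \<in> ?S \<longrightarrow> norm (f x) \<le> A * norm x powr \<beta>" and x: "x \<in> ?S"
      let ?t = "1 + s * norm x"
      have t: "1 \<le> ?t" using s by simp
      have "norm x powr \<beta> = s powr (- \<beta>) * (s * norm x) powr \<beta>"
        using s by (simp add: powr_mult powr_minus)
      also have "\<dots> \<le> s powr (- \<beta>) * ?t"
      proof (rule mult_left_mono)
        have "(s * norm x) powr \<beta> \<le> ?t powr \<beta>" using s \<beta> by (intro powr_mono2) auto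
        also have "\<dots> \<le> ?t powr 1" using t \<beta> by (intro powr_mono) auto
        finally show "(s * norm x) powr \<beta> \<le> ?t" using t by simp
      qed simp
      finally have "norm (f x) \<le> A * (s powr (- \<beta>) * ?t)"
        using * x A by (meson mult_left_mono order_trans)
      then have "norm (f x * cgo \<delta> s x ^ 4) \<le> (A * (s powr (- \<beta>) * ?t)) * (inverse (\<delta> ^ 4) * inverse ?t ^ 4)"
        unfolding norm_mult using cgo_pow4_le[OF \<theta> x s] A t by (intro mult_mono) (auto simp: \<delta>_def)
      also have "\<dots> = ?c * (?t * inverse ?t ^ 4)" by (simp only: mult_ac)
      also have "?t * inverse ?t ^ 4 = inverse ?t ^ 3"
        using t by (simp add: eval_nat_numeral)
      finally show "norm (f x * cgo \<delta> s x ^ 4) \<le> ?c * inverse ?t ^ 3" .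
    qed
  qed (intro set_integrable_norm i set_integrable_mult_right W(1))+
  also have "\<dots> = ?c * (LINT x:?S|lebesgue. inverse (1 + s * norm x) ^ 3)" by (rule set_integral_mult_right)
  also have "\<dots> \<le> ?c * ((\<theta>M - \<theta>m) / (2 * s\<^sup>2))"
    using A \<delta> by (intro mult_left_mono W(2)) auto
  also have "\<dots> = A * inverse (\<delta> ^ 4) * ((\<theta>M - \<theta>m) / 2) * (s powr (- \<beta>) / s\<^sup>2)" by simp
  also have "s powr (- \<beta>) / s\<^sup>2 = s powr (- 2 - \<beta>)"
    using s by (simp add: powr_diff powr_minus powr_numeral field_simps)
  finally show ?thesis .
qed

text \<open>Squaring gives the eighth power, of which three factors suffice to reuse the weight; the
  root of its integral explains the rate \<open>1 / s\<close>.\<close>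

lemma cgo_L2_norm_le:
  assumes \<theta>: "- pi < \<theta>m" "\<theta>m < \<theta>M" "\<theta>M < pi" and R: "0 < R" and s: "0 < s"
  defines "\<delta> \<equiv> sector_gap \<theta>m \<theta>M"
  shows "L2_norm_on lebesgue (S_sector \<theta>m \<theta>M R) (\<lambda>x. cgo \<delta> s x ^ 4) \<le> inverse (\<delta> ^ 4) * sqrt ((\<theta>M - \<theta>m) / 2) / s"
proof -
  let ?S = "S_sector \<theta>m \<theta>M R"
  have \<delta>: "0 < \<delta>" unfolding \<delta>_def by (rule sector_gap_pos[OF \<theta>])
  note W = sector_weight_integral[OF \<theta> R s]
  have "(LINT x:?S|lebesgue. (norm (cgo \<delta> s x ^ 4))\<^sup>2) \<le> (LINT x:?S|lebesgue. (inverse (\<delta> ^ 4))\<^sup>2 * inverse (1 + s * norm x) ^ 3)"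
  proof (rule set_integral_mono)
    show "set_integrable lebesgue ?S (\<lambda>x. (norm (cgo \<delta> s x ^ 4))\<^sup>2)"
      by (intro polar_integral(1)[OF _ \<theta> R] continuous_intros smooth_continuous_on smooth_cgo \<delta>)
    show "set_integrable lebesgue ?S (\<lambda>x. (inverse (\<delta> ^ 4))\<^sup>2 * inverse (1 + s * norm x) ^ 3)"
      by (intro set_integrable_mult_right W(1))
    fix x assume x: "x \<in> ?S"
    let ?t = "1 + s * norm x"
    have t: "1 \<le> ?t" using s by simp
    have "(norm (cgo \<delta> s x ^ 4))\<^sup>2 \<le> (inverse (\<delta> ^ 4) * inverse ?t ^ 4)\<^sup>2"
      using cgo_pow4_le[OF \<theta> x s] by (intro power_mono) (auto simp: \<delta>_def)
    also have "\<dots> = (inverse (\<delta> ^ 4))\<^sup>2 * inverse ?t ^ 8" by (simp add: power_mult_distrib flip: power_mult)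
    also have "\<dots> \<le> (inverse (\<delta> ^ 4))\<^sup>2 * inverse ?t ^ 3"
      using t by (intro mult_left_mono power_decreasing) (auto simp: inverse_le_1_iff)
    finally show "(norm (cgo \<delta> s x ^ 4))\<^sup>2 \<le> (inverse (\<delta> ^ 4))\<^sup>2 * inverse ?t ^ 3" .
  qed
  also have "\<dots> = (inverse (\<delta> ^ 4))\<^sup>2 * (LINT x:?S|lebesgue. inverse (1 + s * norm x) ^ 3)" by (rule set_integral_mult_right)
  also have "\<dots> \<le> (inverse (\<delta> ^ 4))\<^sup>2 * ((\<theta>M - \<theta>m) / (2 * s\<^sup>2))" by (intro mult_left_mono W(2)) auto
  finally have "L2_norm_on lebesgue ?S (\<lambda>x. cgo \<delta> s x ^ 4) \<le> sqrt ((inverse (\<delta> ^ 4))\<^sup>2 * ((\<theta>M - \<theta>m) / (2 * s\<^sup>2)))"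
    unfolding L2_norm_on_def by (rule real_sqrt_le_mono)
  also have "\<dots> = inverse (\<delta> ^ 4) * sqrt ((\<theta>M - \<theta>m) / 2) / s"
    using s \<delta> by (simp add: real_sqrt_mult real_sqrt_divide)
  finally show ?thesis .
qed

text \<open>The number \<open>c0 - V j 0\<close>, multiplied by the integral of the kernel with
  \<open>s = j\<close>, is a sum of four errors: the transmission identity, the Hoelder modulus of
  \<open>F\<close>, the Herglotz approximation and the Lipschitz bound of \<open>V j\<close>. After
  scaling by \<open>s\<^sup>2\<close> they are powers of \<open>j\<close> with exponents
  \<open>- 2\<close>, \<open>- \<alpha>\<close>, \<open>- \<Upsilon> - 1\<close> and
  \<open>r - 1\<close>, while the kernel integral tends to a nonzero constant.\<close>

lemma herglotz_value_limit:
  fixes F v :: "real ^ 2 \<Rightarrow> complex" and V :: "nat \<Rightarrow> real ^ 2 \<Rightarrow> complex"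
  assumes \<theta>: "- pi < \<theta>m" "\<theta>m < \<theta>M" "\<theta>M < pi" "\<theta>M - \<theta>m \<noteq> pi" and h: "0 < h"
  defines "S \<equiv> S_sector \<theta>m \<theta>M h" and "\<delta> \<equiv> sector_gap \<theta>m \<theta>M"
  assumes F: "L2_on lebesgue S F" and v: "L2_on lebesgue S v"
    and \<alpha>: "0 < \<alpha>" "\<alpha> < 1" and A: "0 \<le> A"
    and F\<alpha>: "AE x in lebesgue. x \<in> S \<longrightarrow> norm (F x - c0) \<le> A * norm x powr \<alpha>"
    and Vc: "\<And>j. 1 \<le> j \<Longrightarrow> continuous_on UNIV (V j)"
    and VL: "\<And>j x. 1 \<le> j \<Longrightarrow> norm (V j x - V j 0) \<le> B * real j powr r * norm x" and B: "0 \<le> B" and r: "r < 1"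
    and vV: "\<And>j. 1 \<le> j \<Longrightarrow> L2_norm_on lebesgue S (\<lambda>x. v x - V j x) \<le> real j powr (- 2 - \<Upsilon>)" and \<Upsilon>: "0 < \<Upsilon>"
    and K: "\<And>s. 0 < s \<Longrightarrow> norm (LINT x:S|lebesgue. (F x - v x) * cgo \<delta> s x ^ 4) \<le> K / s ^ 4"
  shows "(\<lambda>j. V j 0) \<longlonglongrightarrow> c0"
proof -
  have \<delta>: "0 < \<delta>" unfolding \<delta>_def by (rule sector_gap_pos[OF \<theta>(1-3)])
  have mS: "S \<in> sets lebesgue" unfolding S_def using \<theta> by (intro S_sector_lebesgue) auto
  have bS: "bounded S" unfolding S_def by (rule bounded_S_sector)
  define I where "I s = (LINT x:S|lebesgue. cgo \<delta> s x ^ 4)" for s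
  obtain c where c: "c \<noteq> 0" and lim: "(\<lambda>n. of_real ((real n)\<^sup>2) * I (real n)) \<longlonglongrightarrow> c"
    using cgo_integral_limit[OF \<theta> h] unfolding I_def S_def \<delta>_def by blast
  define E where "E = inverse (\<delta> ^ 4) * ((\<theta>M - \<theta>m) / 2)"
  define E' where "E' = inverse (\<delta> ^ 4) * sqrt ((\<theta>M - \<theta>m) / 2)"
  have E: "0 \<le> E" "0 \<le> E'" using \<theta> \<delta> by (auto simp: E_def E'_def)
  have bound: "norm (of_real ((real j)\<^sup>2) * ((c0 - V j 0) * I (real j)))
      \<le> K * real j powr (- 2) + A * E * real j powr (- \<alpha>) + E' * real j powr (- \<Upsilon> - 1) + B * E * real j powr (r - 1)"
    if j: "1 \<le> j" for j
  proof -
    let ?s = "real j"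
    have s: "0 < ?s" using j by simp
    let ?U = "\<lambda>x. cgo \<delta> ?s x ^ 4"
    have cU: "continuous_on UNIV ?U" by (intro smooth_continuous_on smooth_power smooth_cgo \<delta>)
    have LU: "L2_on lebesgue S ?U" by (rule continuous_L2_on[OF cU bS mS])
    have LV: "L2_on lebesgue S (V j)" by (rule continuous_L2_on[OF Vc[OF j] bS mS])
    have Lc: "L2_on lebesgue S (\<lambda>x. a)" for a :: complex by (rule continuous_L2_on[OF continuous_on_const bS mS])
    have i1: "set_integrable lebesgue S (\<lambda>x. (F x - v x) * ?U x)"
      and i2: "set_integrable lebesgue S (\<lambda>x. (F x - c0) * ?U x)"
      and i3: "set_integrable lebesgue S (\<lambda>x. (v x - V j x) * ?U x)"
      and i4: "set_integrable lebesgue S (\<lambda>x. (V j x - V j 0) * ?U x)"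
      by (intro L2_on_mult_integrable L2_on_diff F v LU LV Lc)+
    have "(c0 - V j 0) * I ?s = (LINT x:S|lebesgue. (c0 - V j 0) * ?U x)" by (simp add: I_def)
    also have "\<dots> = (LINT x:S|lebesgue. (F x - v x) * ?U x - (F x - c0) * ?U x + (v x - V j x) * ?U x + (V j x - V j 0) * ?U x)"
      by (intro arg_cong[where f = "set_lebesgue_integral lebesgue S"] ext) (simp add: algebra_simps)
    also have "\<dots> = (LINT x:S|lebesgue. (F x - v x) * ?U x) - (LINT x:S|lebesgue. (F x - c0) * ?U x)
        + (LINT x:S|lebesgue. (v x - V j x) * ?U x) + (LINT x:S|lebesgue. (V j x - V j 0) * ?U x)"
      by (simp only: set_integral_add(2)[OF set_integral_add(1)[OF set_integral_diff(1)[OF i1 i2] i3] i4]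
          set_integral_add(2)[OF set_integral_diff(1)[OF i1 i2] i3] set_integral_diff(2)[OF i1 i2])
    finally have eq: "(c0 - V j 0) * I ?s = \<dots>" .
    have "norm ((c0 - V j 0) * I ?s) \<le> norm (LINT x:S|lebesgue. (F x - v x) * ?U x) + norm (LINT x:S|lebesgue. (F x - c0) * ?U x)
        + norm (LINT x:S|lebesgue. (v x - V j x) * ?U x) + norm (LINT x:S|lebesgue. (V j x - V j 0) * ?U x)"
      unfolding eq by (intro norm_triangle_le add_mono norm_triangle_ineq4 order_refl)
    also have "\<dots> \<le> K / ?s ^ 4 + A * E * ?s powr (- 2 - \<alpha>) + ?s powr (- 2 - \<Upsilon>) * (E' / ?s) + B * E * ?s powr r * ?s powr (- 2 - 1)"
    proof (intro add_mono)
      show "norm (LINT x:S|lebesgue. (F x - v x) * ?U x) \<le> K / ?s ^ 4" by (rule K[OF s])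
      show "norm (LINT x:S|lebesgue. (F x - c0) * ?U x) \<le> A * E * ?s powr (- 2 - \<alpha>)"
        using cgo_weighted_bound[OF \<theta>(1-3) h s \<alpha>(1) _ A F\<alpha>[unfolded S_def] i2[unfolded S_def \<delta>_def]] \<alpha>
        by (simp add: E_def S_def \<delta>_def mult_ac)
      have "norm (LINT x:S|lebesgue. (v x - V j x) * ?U x) \<le> (LINT x:S|lebesgue. norm ((v x - V j x) * ?U x))"
        by (rule set_integral_norm_bound[OF i3])
      also have "\<dots> \<le> L2_norm_on lebesgue S (\<lambda>x. v x - V j x) * L2_norm_on lebesgue S ?U"
        using L2_on_Cauchy_Schwarz[OF L2_on_diff[OF v LV] LU] by (simp only: norm_mult)
      also have "\<dots> \<le> ?s powr (- 2 - \<Upsilon>) * (E' / ?s)"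
        using vV[OF j] cgo_L2_norm_le[OF \<theta>(1-3) h s] unfolding S_def \<delta>_def E'_def
        by (intro mult_mono L2_norm_on_nonneg) auto
      finally show "norm (LINT x:S|lebesgue. (v x - V j x) * ?U x) \<le> ?s powr (- 2 - \<Upsilon>) * (E' / ?s)" .
      have *: "AE x in lebesgue. x \<in> S_sector \<theta>m \<theta>M h \<longrightarrow> norm (V j x - V j 0) \<le> B * ?s powr r * norm x powr 1"
        using VL[OF j] by (intro always_eventually allI impI) (simp add: powr_one_gt_zero_iff)
      show "norm (LINT x:S|lebesgue. (V j x - V j 0) * ?U x) \<le> B * E * ?s powr r * ?s powr (- 2 - 1)"
        using cgo_weighted_bound[OF \<theta>(1-3) h s _ _ _ * i4[unfolded S_def \<delta>_def]] B
        by (simp add: E_def S_def \<delta>_def mult_ac)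
    qed
    finally have "?s\<^sup>2 * norm ((c0 - V j 0) * I ?s)
        \<le> ?s\<^sup>2 * (K / ?s ^ 4 + A * E * ?s powr (- 2 - \<alpha>) + ?s powr (- 2 - \<Upsilon>) * (E' / ?s) + B * E * ?s powr r * ?s powr (- 2 - 1))"
      by (rule mult_left_mono) simp
    also have "\<dots> = K * ?s powr (- 2) + A * E * ?s powr (- \<alpha>) + E' * ?s powr (- \<Upsilon> - 1) + B * E * ?s powr (r - 1)"
    proof -
      have p: "?s\<^sup>2 = ?s powr 2" "?s ^ 4 = ?s powr 4" "1 / ?s = ?s powr (- 1)"
        using s by (simp_all add: powr_numeral powr_minus field_simps)
      have q: "?s powr a * ?s powr b = ?s powr (a + b)" for a b by (rule powr_add[symmetric])
      have "K / ?s ^ 4 = K * ?s powr (- 4)" using s by (simp add: powr_minus powr_numeral field_simps)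
      moreover have "E' / ?s = E' * ?s powr (- 1)" using s by (simp add: powr_minus field_simps)
      moreover have "?s powr 2 * (K * ?s powr (- 4) + A * E * ?s powr (- 2 - \<alpha>) + ?s powr (- 2 - \<Upsilon>) * (E' * ?s powr (- 1)) + B * E * ?s powr r * ?s powr (- 2 - 1))
        = K * (?s powr 2 * ?s powr (- 4)) + A * E * (?s powr 2 * ?s powr (- 2 - \<alpha>)) + E' * (?s powr 2 * ?s powr (- 2 - \<Upsilon>) * ?s powr (- 1))
          + B * E * (?s powr 2 * ?s powr r * ?s powr (- 2 - 1))"
        by (simp only: distrib_left mult_ac)
      ultimately show ?thesis unfolding p(1) q by simp
    qed
    finally show ?thesis by (simp add: norm_mult norm_power)
  qed
  have "(\<lambda>j. of_real ((real j)\<^sup>2) * ((c0 - V j 0) * I (real j))) \<longlonglongrightarrow> 0"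
  proof (rule Lim_null_comparison)
    show "\<forall>\<^sub>F j in sequentially. norm (of_real ((real j)\<^sup>2) * ((c0 - V j 0) * I (real j)))
        \<le> K * real j powr (- 2) + A * E * real j powr (- \<alpha>) + E' * real j powr (- \<Upsilon> - 1) + B * E * real j powr (r - 1)"
      by (rule eventually_sequentiallyI[of 1], rule bound)
    have p: "(\<lambda>j. real j powr a) \<longlonglongrightarrow> 0" if "a < 0" for a
      by (rule tendsto_neg_powr[OF that filterlim_real_sequentially])
    have "(\<lambda>j. K * real j powr (- 2) + A * E * real j powr (- \<alpha>) + E' * real j powr (- \<Upsilon> - 1) + B * E * real j powr (r - 1))
        \<longlonglongrightarrow> K * 0 + A * E * 0 + E' * 0 + B * E * 0"
      by (intro tendsto_add tendsto_mult tendsto_const p) (use \<alpha> \<Upsilon> r in auto)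
    then show "(\<lambda>j. K * real j powr (- 2) + A * E * real j powr (- \<alpha>) + E' * real j powr (- \<Upsilon> - 1) + B * E * real j powr (r - 1)) \<longlonglongrightarrow> 0" by simp
  qed
  \<comment> \<open>Division is legitimate because the limit \<open>c\<close> is nonzero; the scaled
    kernel integral is then nonzero for all large \<open>j\<close>.\<close>
  from tendsto_divide[OF this lim c]
  have "(\<lambda>j. of_real ((real j)\<^sup>2) * ((c0 - V j 0) * I (real j)) / (of_real ((real j)\<^sup>2) * I (real j))) \<longlonglongrightarrow> 0" by simp
  moreover have "\<forall>\<^sub>F j in sequentially. of_real ((real j)\<^sup>2) * ((c0 - V j 0) * I (real j)) / (of_real ((real j)\<^sup>2) * I (real j)) = c0 - V j 0"
    using tendsto_imp_eventually_ne[OF lim c] by (rule eventually_mono) simp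
  ultimately have "(\<lambda>j. c0 - V j 0) \<longlonglongrightarrow> 0" by (rule Lim_transform_eventually)
  then have "(\<lambda>j. c0 - (c0 - V j 0)) \<longlonglongrightarrow> c0 - 0" by (intro tendsto_diff tendsto_const)
  then show ?thesis by simp
qed

text \<open>Dominated convergence: the sectors shrink to the empty set, as the vertex belongs to
  none of them. Applied to the gradient of \<open>v - w\<close>, it supplies the gain over the bare
  Poincare inequality.\<close>

lemma L2_norm_sector_tendsto_0:
  fixes f :: "real ^ 2 \<Rightarrow> complex"
  assumes \<theta>: "- pi < \<theta>m" "\<theta>m < \<theta>M" "\<theta>M < pi" and h: "0 < h" and f: "L2_on lebesgue (S_sector \<theta>m \<theta>M h) f"
  shows "((\<lambda>R. L2_norm_on lebesgue (S_sector \<theta>m \<theta>M R) f) \<longlongrightarrow> 0) (at_right 0)"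
proof (rule tendsto_at_right_sequentially[OF h])
  fix R :: "nat \<Rightarrow> real"
  assume R: "\<And>n. 0 < R n" "\<And>n. R n < h" "decseq R" "R \<longlonglongrightarrow> 0"
  let ?S = "S_sector \<theta>m \<theta>M"
  have sub: "?S (R n) \<subseteq> ?S h" for n using R(2)[of n] by (auto simp: S_sector_def)
  have m: "?S a \<in> sets lebesgue" for a using \<theta> by (intro S_sector_lebesgue) auto
  have "(\<lambda>n. LINT x|lebesgue. indicator (?S (R n)) x *\<^sub>R (norm (f x))\<^sup>2) \<longlonglongrightarrow> (LINT x :: real ^ 2|lebesgue. 0)"
  proof (rule integral_dominated_convergence)
    show "integrable lebesgue (\<lambda>x. indicator (?S h) x *\<^sub>R (norm (f x))\<^sup>2)" by (rule L2_onD(2)[OF f])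
    show "(\<lambda>x. indicator (?S (R n)) x *\<^sub>R (norm (f x))\<^sup>2) \<in> borel_measurable lebesgue" for n
      by (rule borel_measurable_integrable[OF L2_onD(2)[OF L2_on_subset[OF f m sub]]])
    show "AE x in lebesgue. (\<lambda>n. indicator (?S (R n)) x *\<^sub>R (norm (f x))\<^sup>2) \<longlonglongrightarrow> 0"
    proof (rule always_eventually, rule allI)
      fix x
      show "(\<lambda>n. indicator (?S (R n)) x *\<^sub>R (norm (f x))\<^sup>2) \<longlonglongrightarrow> 0"
      proof (cases "x = 0")
        case True
        then show ?thesis by (simp add: S_sector_altdef)
      next
        case False
        then have "\<forall>\<^sub>F n in sequentially. R n < norm x" by (intro order_tendstoD(2)[OF R(4)]) simp
        then have "\<forall>\<^sub>F n in sequentially. indicator (?S (R n)) x *\<^sub>R (norm (f x))\<^sup>2 = 0"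
          by (rule eventually_mono) (simp add: S_sector_altdef)
        then show ?thesis by (rule tendsto_eventually)
      qed
    qed
    show "AE x in lebesgue. norm (indicator (?S (R n)) x *\<^sub>R (norm (f x))\<^sup>2) \<le> indicator (?S h) x *\<^sub>R (norm (f x))\<^sup>2" for n
      using sub[of n] by (intro always_eventually allI) (auto simp: indicator_def)
  qed auto
  from tendsto_real_sqrt[OF this]
  show "(\<lambda>n. L2_norm_on lebesgue (?S (R n)) f) \<longlonglongrightarrow> 0"
    by (simp add: L2_norm_on_def set_lebesgue_integral_def)
qed

text \<open>The difference carries \<open>1 - \<eta> x\<close>, which lives where
  \<open>h / 2 < norm x\<close>; there the kernel is \<open>O(s ^ (-4))\<close>, as small as the
  bound from Green's formula.\<close>

lemma cgo_remove_cutoff: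
  fixes \<eta> G :: "real ^ 2 \<Rightarrow> complex"
  assumes \<theta>: "- pi < \<theta>m" "\<theta>m < \<theta>M" "\<theta>M < pi" and h: "0 < h"
    and \<eta>: "smooth \<eta>" "\<And>x. norm x \<le> h / 2 \<Longrightarrow> \<eta> x = 1"
    and G: "L2_on lebesgue (S_sector \<theta>m \<theta>M h) G"
  defines "\<delta> \<equiv> sector_gap \<theta>m \<theta>M"
  shows "\<exists>K. \<forall>s>0. norm (LINT x:S_sector \<theta>m \<theta>M h|lebesgue. G x * cgo \<delta> s x ^ 4)
    \<le> norm (LINT x:S_sector \<theta>m \<theta>M h|lebesgue. G x * (\<eta> x * cgo \<delta> s x ^ 4)) + K / s ^ 4"
proof -
  let ?S = "S_sector \<theta>m \<theta>M h"
  have \<delta>: "0 < \<delta>" unfolding \<delta>_def by (rule sector_gap_pos[OF \<theta>])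
  have mS: "?S \<in> sets lebesgue" using \<theta> by (intro S_sector_lebesgue) auto
  note bS = bounded_S_sector[of \<theta>m \<theta>M h]
  have c\<eta>: "continuous_on UNIV (\<lambda>x. 1 - \<eta> x)" by (intro continuous_intros smooth_continuous_on \<eta>)
  obtain P where P: "\<And>x. x \<in> ?S \<Longrightarrow> norm (1 - \<eta> x) \<le> P" "0 < P"
    using continuous_bounded_on[OF c\<eta> bS] by blast
  have iG: "set_integrable lebesgue ?S (\<lambda>x. norm (G x))"
    by (intro set_integrable_norm L2_on_integrable(1)[OF G mS] bounded_emeasure_lebesgue bS mS)
  define D where "D = inverse (\<delta> ^ 4) * (2 / h) ^ 4"
  have D: "0 \<le> D" using \<delta> h by (simp add: D_def)
  have "norm (LINT x:?S|lebesgue. G x * cgo \<delta> s x ^ 4)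
      \<le> norm (LINT x:?S|lebesgue. G x * (\<eta> x * cgo \<delta> s x ^ 4)) + P * D * (LINT x:?S|lebesgue. norm (G x)) / s ^ 4"
    if s: "0 < s" for s
  proof -
    let ?U = "\<lambda>x. cgo \<delta> s x ^ 4"
    have sU: "smooth ?U" by (intro smooth_power smooth_cgo \<delta>)
    have i1: "set_integrable lebesgue ?S (\<lambda>x. G x * (\<eta> x * ?U x))"
      and i2: "set_integrable lebesgue ?S (\<lambda>x. G x * ((1 - \<eta> x) * ?U x))"
      by (intro L2_on_mult_integrable[OF G] continuous_L2_on continuous_intros smooth_continuous_on \<eta> sU bS mS)+
    have "(LINT x:?S|lebesgue. G x * ?U x) = (LINT x:?S|lebesgue. G x * (\<eta> x * ?U x) + G x * ((1 - \<eta> x) * ?U x))"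
      by (intro arg_cong[where f = "set_lebesgue_integral lebesgue ?S"] ext) (simp add: algebra_simps)
    also have "\<dots> = (LINT x:?S|lebesgue. G x * (\<eta> x * ?U x)) + (LINT x:?S|lebesgue. G x * ((1 - \<eta> x) * ?U x))"
      by (rule set_integral_add(2)[OF i1 i2])
    finally have "norm (LINT x:?S|lebesgue. G x * ?U x)
        \<le> norm (LINT x:?S|lebesgue. G x * (\<eta> x * ?U x)) + norm (LINT x:?S|lebesgue. G x * ((1 - \<eta> x) * ?U x))"
      by (simp only: norm_triangle_ineq)
    also have "norm (LINT x:?S|lebesgue. G x * ((1 - \<eta> x) * ?U x)) \<le> (LINT x:?S|lebesgue. norm (G x * ((1 - \<eta> x) * ?U x)))"
      by (rule set_integral_norm_bound[OF i2])
    also have "\<dots> \<le> (LINT x:?S|lebesgue. P * D / s ^ 4 * norm (G x))"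
    proof (rule set_integral_mono)
      fix x assume x: "x \<in> ?S"
      show "norm (G x * ((1 - \<eta> x) * ?U x)) \<le> P * D / s ^ 4 * norm (G x)"
      proof (cases "norm x \<le> h / 2")
        case True
        then show ?thesis using \<eta>(2)[OF True] P D s by simp
      next
        case False
        have "s * (h / 2) \<le> 1 + s * norm x" using False s mult_left_mono[of "h / 2" "norm x" s] by linarith
        then have "inverse (1 + s * norm x) \<le> inverse (s * (h / 2))" using s h by (intro le_imp_inverse_le) auto
        then have "inverse (1 + s * norm x) ^ 4 \<le> inverse (s * (h / 2)) ^ 4" using s by (intro power_mono) auto
        also have "\<dots> = (2 / h) ^ 4 / s ^ 4" using s h by (simp add: field_simps)
        finally have "norm (?U x) \<le> inverse (\<delta> ^ 4) * ((2 / h) ^ 4 / s ^ 4)"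
          using cgo_pow4_le[OF \<theta> x s] \<delta> by (fold \<delta>_def) (meson mult_left_mono order_trans inverse_nonnegative_iff_nonnegative less_imp_le zero_less_power)
        then have "norm (?U x) \<le> D / s ^ 4" by (simp add: D_def)
        then have "norm (1 - \<eta> x) * norm (?U x) \<le> P * (D / s ^ 4)"
          using P by (intro mult_mono P(1) x) auto
        then have "norm (G x) * (norm (1 - \<eta> x) * norm (?U x)) \<le> norm (G x) * (P * (D / s ^ 4))"
          by (rule mult_left_mono) simp
        then show ?thesis by (simp add: norm_mult mult_ac)
      qed
    qed (intro set_integrable_norm i2 set_integrable_mult_right iG)+
    also have "\<dots> = P * D / s ^ 4 * (LINT x:?S|lebesgue. norm (G x))" by (rule set_integral_mult_right)
    finally show ?thesis by simp
  qed
  then show ?thesis by blast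
qed

text \<open>The squared norm is used because the norm is not smooth at the vertex. Vanishing already
  from \<open>3 * h / 4\<close> on makes the gradient 0 at radius \<open>h\<close> and beyond, where
  \<open>\<Omega>\<close> is not known to be a sector.\<close>

lemma radial_cutoff_exists:
  assumes h: "0 < h"
  obtains \<eta> :: "real ^ 2 \<Rightarrow> complex" where "smooth \<eta>" "\<And>x. norm x \<le> h / 2 \<Longrightarrow> \<eta> x = 1"
    "\<And>x. 3 * h / 4 \<le> norm x \<Longrightarrow> \<eta> x = 0"
proof -
  have s: "smooth (\<lambda>x :: real ^ 2. (x $ 1)\<^sup>2 + (x $ 2)\<^sup>2)" by (intro smooth_add smooth_power smooth_nth)
  have ab: "(h / 2)\<^sup>2 < (3 * h / 4)\<^sup>2" using h by (intro power_strict_mono) auto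
  have n: "(x $ 1)\<^sup>2 + (x $ 2)\<^sup>2 = (norm x)\<^sup>2" for x :: "real ^ 2"
    by (simp add: norm_vec_def L2_set_def sum_2)
  obtain \<eta> :: "real ^ 2 \<Rightarrow> complex" where \<eta>: "smooth \<eta>" "\<And>x. (x $ 1)\<^sup>2 + (x $ 2)\<^sup>2 \<le> (h / 2)\<^sup>2 \<Longrightarrow> \<eta> x = 1"
      "\<And>x. (3 * h / 4)\<^sup>2 \<le> (x $ 1)\<^sup>2 + (x $ 2)\<^sup>2 \<Longrightarrow> \<eta> x = 0"
    by (rule smooth_cutoff_exists[OF s ab]) blast
  show ?thesis
  proof (rule that[OF \<eta>(1)])
    show "\<eta> x = 1" if "norm x \<le> h / 2" for x using \<eta>(2)[of x] power_mono[OF that norm_ge_zero, of 2] by (simp add: n)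
    show "\<eta> x = 0" if "3 * h / 4 \<le> norm x" for x using \<eta>(3)[of x] power_mono[OF that, of 2] h by (simp add: n)
  qed
qed

text \<open>The test function is the cutoff times the kernel, so integrals over
  \<open>\<Omega>\<close> reduce to the sector. Equal Cauchy data express the integral against it as
  \<open>- 1 / k\<^sup>2\<close> times the pairing of gradients, which is \<open>O(t ^ (-4))\<close>
  by \<open>zero_trace_cgo_bound\<close>; removing the cutoff costs the same order.\<close>

lemma transmission_cgo_bound:
  fixes v w V :: "real ^ 2 \<Rightarrow> complex" and \<zeta> :: "nat \<Rightarrow> real ^ 2 \<Rightarrow> complex"
  assumes \<theta>: "- pi < \<theta>m" "\<theta>m < \<theta>M" "\<theta>M < pi" and h: "0 < h" and S: "\<Omega> \<inter> ball 0 h = S_sector \<theta>m \<theta>M h"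
    and U: "bounded \<Omega>" "open \<Omega>" and fin: "emeasure hausdorff1 (frontier \<Omega>) < \<infinity>" and k: "0 < k"
    and s: "\<And>n. smooth (\<zeta> n)" and lim: "(\<lambda>n. LINT x:frontier \<Omega>|hausdorff1. norm (\<zeta> n x)) \<longlonglongrightarrow> 0"
    and u: "(\<lambda>n. LINT x:\<Omega>|lebesgue. norm ((v x - w x) - \<zeta> n x)) \<longlonglongrightarrow> 0"
    and D: "\<And>i. (\<lambda>n. LINT x:\<Omega>|lebesgue. norm ((weak_partial \<Omega> i v x - weak_partial \<Omega> i w x) - partial i (\<zeta> n) x)) \<longlonglongrightarrow> 0"
    and sv: "sobolev 1 \<Omega> v" and sw: "sobolev 1 \<Omega> w"
    and lw: "has_weak_laplacian \<Omega> w (\<lambda>x. - (complex_of_real (k\<^sup>2) * (1 + V x) * w x))"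
    and lv: "has_weak_laplacian \<Omega> v (\<lambda>x. - (complex_of_real (k\<^sup>2) * v x))"
    and nv: "has_normal_derivative \<Omega> v F" and nw: "has_normal_derivative \<Omega> w F"
    and LF: "L2_on lebesgue \<Omega> (\<lambda>x. (1 + V x) * w x)"
  shows "\<exists>K. \<forall>t>0. norm (LINT x:S_sector \<theta>m \<theta>M h|lebesgue. ((1 + V x) * w x - v x) * cgo (sector_gap \<theta>m \<theta>M) t x ^ 4) \<le> K / t ^ 4"
proof -
  let ?S = "S_sector \<theta>m \<theta>M h" and ?\<delta> = "sector_gap \<theta>m \<theta>M"
  let ?D = "\<lambda>i x. weak_partial \<Omega> i v x - weak_partial \<Omega> i w x"
  let ?G = "\<lambda>x. (1 + V x) * w x - v x"
  have \<delta>: "0 < ?\<delta>" by (rule sector_gap_pos[OF \<theta>])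
  have finU: "\<Omega> \<in> sets lebesgue" "emeasure lebesgue \<Omega> < \<infinity>" using U bounded_emeasure_lebesgue[of \<Omega>] by simp_all
  have mS: "?S \<in> sets lebesgue" using \<theta> by (intro S_sector_lebesgue) auto
  have iu: "set_integrable lebesgue \<Omega> (\<lambda>x. v x - w x)"
    by (intro L2_on_integrable(1) L2_on_diff sobolev1D[OF sv U(2)] sobolev1D[OF sw U(2)] finU)
  have iD: "set_integrable lebesgue \<Omega> (?D i)" for i
    by (intro L2_on_integrable(1) L2_on_diff sobolev1D[OF sv U(2)] sobolev1D[OF sw U(2)] finU)
  have LG: "L2_on lebesgue ?S ?G"
    by (rule L2_on_subset[OF L2_on_diff[OF LF sobolev1D(1)[OF sv U(2)]] mS sector_subset(2)[OF S order_refl]])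
  obtain \<eta> :: "real ^ 2 \<Rightarrow> complex" where \<eta>: "smooth \<eta>" "\<And>x. norm x \<le> h / 2 \<Longrightarrow> \<eta> x = 1" "\<And>x. 3 * h / 4 \<le> norm x \<Longrightarrow> \<eta> x = 0"
    by (rule radial_cutoff_exists[OF h]) blast
  have \<eta>h: "\<eta> x = 0" if "norm x = h" for x using \<eta>(3)[of x] that h by simp
  obtain K0 where K0: "\<And>t. 0 < t \<Longrightarrow> norm (LINT x:?S|lebesgue. \<Sum>i\<in>UNIV. ?D i x * partial i (\<lambda>x. \<eta> x * cgo ?\<delta> t x ^ 4) x) \<le> K0 / t ^ 4"
    using zero_trace_cgo_bound[OF \<theta> h S U fin s lim iu u iD D \<eta>(1,2) \<eta>h] by blast
  obtain K1 where K1: "\<And>t. 0 < t \<Longrightarrow> norm (LINT x:?S|lebesgue. ?G x * cgo ?\<delta> t x ^ 4)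
      \<le> norm (LINT x:?S|lebesgue. ?G x * (\<eta> x * cgo ?\<delta> t x ^ 4)) + K1 / t ^ 4"
    using cgo_remove_cutoff[OF \<theta> h \<eta>(1,2) LG] by blast
  have "norm (LINT x:?S|lebesgue. ?G x * cgo ?\<delta> t x ^ 4) \<le> (K0 / k\<^sup>2 + K1) / t ^ 4" if t: "0 < t" for t
  proof -
    let ?\<phi> = "\<lambda>x. \<eta> x * cgo ?\<delta> t x ^ 4"
    have \<phi>: "smooth ?\<phi>" by (intro smooth_mult smooth_power smooth_cgo \<eta> \<delta>)
    have \<phi>0: "?\<phi> x = 0" "partial i ?\<phi> x = 0" if "h \<le> norm x" for x i
    proof -
      show "?\<phi> x = 0" using \<eta>(3)[of x] that h by simp
      show "partial i ?\<phi> x = 0"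
        by (rule partial_locally_const[of "- cball 0 (3 * h / 4)" _ _ 0]) (use that h \<eta>(3) in auto)
    qed
    \<comment> \<open>Within radius \<open>h\<close> the domain is the sector, and beyond it the
      integrand vanishes.\<close>
    have restrict: "(LINT x:\<Omega>|lebesgue. f x) = (LINT x:?S|lebesgue. f x)" if "\<And>x. h \<le> norm x \<Longrightarrow> f x = 0" for f :: "real ^ 2 \<Rightarrow> complex"
    proof -
      have "indicator \<Omega> x *\<^sub>R f x = indicator ?S x *\<^sub>R f x" for x
        using that[of x] S[symmetric] by (cases "norm x < h") (auto simp: indicator_def)
      then have "(\<lambda>x. indicator \<Omega> x *\<^sub>R f x) = (\<lambda>x. indicator ?S x *\<^sub>R f x)" by (rule ext)
      then show ?thesis unfolding set_lebesgue_integral_def by (simp only:)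
    qed
    have "(LINT x:\<Omega>|lebesgue. (- (complex_of_real (k\<^sup>2) * v x) - - (complex_of_real (k\<^sup>2) * (1 + V x) * w x)) * ?\<phi> x)
        = - (LINT x:\<Omega>|lebesgue. \<Sum>i\<in>UNIV. ?D i x * partial i ?\<phi> x)"
      by (rule equal_normal_derivatives[OF U fin lv lw nv nw \<phi>])
    moreover have "(\<lambda>x. (- (complex_of_real (k\<^sup>2) * v x) - - (complex_of_real (k\<^sup>2) * (1 + V x) * w x)) * ?\<phi> x)
        = (\<lambda>x. complex_of_real (k\<^sup>2) * (?G x * ?\<phi> x))"
      by (rule ext) (simp add: algebra_simps)
    ultimately have "complex_of_real (k\<^sup>2) * (LINT x:\<Omega>|lebesgue. ?G x * ?\<phi> x) = - (LINT x:\<Omega>|lebesgue. \<Sum>i\<in>UNIV. ?D i x * partial i ?\<phi> x)"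
      by (simp only: set_integral_mult_right)
    also have "(LINT x:\<Omega>|lebesgue. ?G x * ?\<phi> x) = (LINT x:?S|lebesgue. ?G x * ?\<phi> x)"
      by (rule restrict) (simp add: \<phi>0(1) del: mult_eq_0_iff)
    also have "(LINT x:\<Omega>|lebesgue. \<Sum>i\<in>UNIV. ?D i x * partial i ?\<phi> x) = (LINT x:?S|lebesgue. \<Sum>i\<in>UNIV. ?D i x * partial i ?\<phi> x)"
      by (rule restrict) (simp add: \<phi>0(2))
    finally have "norm (complex_of_real (k\<^sup>2) * (LINT x:?S|lebesgue. ?G x * ?\<phi> x)) \<le> K0 / t ^ 4"
      using K0[OF t] by (simp only: norm_minus_cancel)
    then have "k\<^sup>2 * norm (LINT x:?S|lebesgue. ?G x * ?\<phi> x) \<le> K0 / t ^ 4"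
      unfolding norm_mult norm_of_real by simp
    moreover have "k\<^sup>2 * X \<le> Y / t ^ 4 \<Longrightarrow> X \<le> Y / k\<^sup>2 / t ^ 4" for X Y
      using k t by (simp add: pos_le_divide_eq field_simps)
    ultimately have "norm (LINT x:?S|lebesgue. ?G x * ?\<phi> x) \<le> K0 / k\<^sup>2 / t ^ 4" by blast
    then have "norm (LINT x:?S|lebesgue. ?G x * cgo ?\<delta> t x ^ 4) \<le> K0 / k\<^sup>2 / t ^ 4 + K1 / t ^ 4"
      using K1[OF t] by linarith
    then show ?thesis by (simp add: add_divide_distrib)
  qed
  then show ?thesis by blast
qed

theorem corollary2p1:
  fixes \<Omega> :: "(real ^ 2) set"
    and V v w :: "real ^ 2 \<Rightarrow> complex"
    and g :: "nat \<Rightarrow> real ^ 2 \<Rightarrow> complex"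
    and k h \<theta>m \<theta>M \<alpha> C \<Upsilon> \<rho>v :: real
  assumes "bounded \<Omega>" and "lipschitz_domain \<Omega>"
    and "- pi < \<theta>m" and "\<theta>m < \<theta>M" and "\<theta>M < pi" and "\<theta>M - \<theta>m \<noteq> pi"
    and "0 < h"
    and "0 \<in> frontier \<Omega>"
    and "\<Omega> \<inter> ball 0 h = S_sector \<theta>m \<theta>M h"
    and "Linfty_on lebesgue \<Omega> V"
    and "0 < k"
    and "transmission_eigenfunctions \<Omega> V k v w"
    and "sobolev 2 (interior (Sigma_sector \<theta>m \<theta>M h)) (\<lambda>x. v x - w x)"
    and "0 < \<alpha>" and "\<alpha> < 1"
    and "holder_closure \<alpha> (S_sector \<theta>m \<theta>M h) (\<lambda>x. (1 + V x) * w x)"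
    and "0 < C" and "0 < \<Upsilon>" and "0 < \<rho>v" and "\<rho>v < \<alpha>"
    and "\<And>j. 1 \<le> j \<Longrightarrow> L2_on circle_measure (sphere 0 1) (g j)"
    and "\<And>j. 1 \<le> j \<Longrightarrow>
           H1_norm (S_sector \<theta>m \<theta>M h) (\<lambda>x. v x - herglotz k (g j) x) \<le> real j powr (- 2 - \<Upsilon>)"
    and "\<And>j. 1 \<le> j \<Longrightarrow>
           L2_norm_on circle_measure (sphere 0 1) (g j) \<le> C * real j powr \<rho>v"
  shows "((\<lambda>\<rho>. (LINT x:ball 0 \<rho> \<inter> \<Omega>|lebesgue. V x * w x)
                 / complex_of_real (measure lebesgue (ball 0 \<rho> \<inter> \<Omega>))) \<longlongrightarrow> 0) (at_right 0)"
proof -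

  \<comment> \<open>Unpacking the transmission problem\<close>
  note bd = assms(1) and \<theta> = assms(3-6) and h = assms(7) and zero = assms(8) and S = assms(9) and k = assms(11)
    and te = assms(12) and \<alpha> = assms(14,15) and hol = assms(16) and \<Upsilon> = assms(18) and \<rho>v = assms(19,20)
    and gL = assms(21) and gH = assms(22) and gN = assms(23)
  have op: "open \<Omega>" using assms(2) by (simp add: lipschitz_domain_def)
  have fin: "emeasure hausdorff1 (frontier \<Omega>) < \<infinity>" by (rule lipschitz_domain_frontier_finite[OF assms(1,2)])
  let ?S = "S_sector \<theta>m \<theta>M" and ?F = "\<lambda>x. (1 + V x) * w x"
  have mS: "?S R \<in> sets lebesgue" for R using \<theta> by (intro S_sector_lebesgue) auto
  have sv: "sobolev 1 \<Omega> v" and sw: "sobolev 1 \<Omega> w"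
    and lw: "has_weak_laplacian \<Omega> w (\<lambda>x. - (complex_of_real (k\<^sup>2) * (1 + V x) * w x))"
    and lv: "has_weak_laplacian \<Omega> v (\<lambda>x. - (complex_of_real (k\<^sup>2) * v x))"
    using te unfolding transmission_eigenfunctions_def by blast+
  obtain g0 F where tw: "has_trace \<Omega> w g0" and tv: "has_trace \<Omega> v g0"
    and nv: "has_normal_derivative \<Omega> v F" and nw: "has_normal_derivative \<Omega> w F"
    using te unfolding transmission_eigenfunctions_def by blast
  have Lv: "L2_on lebesgue \<Omega> v" and Lw: "L2_on lebesgue \<Omega> w"
    by (rule sobolev1D(1)[OF sv op], rule sobolev1D(1)[OF sw op])
  define D where "D i x = weak_partial \<Omega> i v x - weak_partial \<Omega> i w x" for i x
  have LD: "L2_on lebesgue \<Omega> (D i)" for i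
    unfolding D_def by (intro L2_on_diff sobolev1D[OF sv op] sobolev1D[OF sw op])
  \<comment> \<open>The weak Laplacian of \<open>w\<close> is square integrable by definition;
    dividing it by \<open>- k\<^sup>2\<close> gives \<open>(1 + V x) * w x\<close>.\<close>
  have LF: "L2_on lebesgue \<Omega> ?F"
  proof -
    have "L2_on lebesgue \<Omega> (\<lambda>x. - (complex_of_real (k\<^sup>2) * (1 + V x) * w x))"
      using lw by (simp add: has_weak_laplacian_def)
    note L2_on_cmult[OF this, of "- inverse (complex_of_real (k\<^sup>2))"]
    moreover have "(\<lambda>x. - inverse (complex_of_real (k\<^sup>2)) * - (complex_of_real (k\<^sup>2) * (1 + V x) * w x)) = ?F"
    proof
      fix x
      have "- inverse a * - (a * y * z) = y * z" if "a \<noteq> 0" for a y z :: complex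
        using that by (simp add: mult.assoc)
      then show "- inverse (complex_of_real (k\<^sup>2)) * - (complex_of_real (k\<^sup>2) * (1 + V x) * w x) = (1 + V x) * w x"
        using k by simp
    qed
    ultimately show ?thesis by (simp only:)
  qed
  obtain \<zeta> where \<zeta>: "\<And>n. smooth (\<zeta> n)"
    "(\<lambda>n. LINT x:\<Omega>|lebesgue. norm ((v x - w x) - \<zeta> n x)) \<longlonglongrightarrow> 0"
    "\<And>i. (\<lambda>n. LINT x:\<Omega>|lebesgue. norm ((weak_partial \<Omega> i v x - weak_partial \<Omega> i w x) - partial i (\<zeta> n) x)) \<longlonglongrightarrow> 0"
    "(\<lambda>n. LINT x:frontier \<Omega>|hausdorff1. norm (\<zeta> n x)) \<longlonglongrightarrow> 0"
    by (rule equal_traces_approx[OF bd op fin tv tw]) blast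
  obtain K where K: "\<And>t. 0 < t \<Longrightarrow> norm (LINT x:?S h|lebesgue. (?F x - v x) * cgo (sector_gap \<theta>m \<theta>M) t x ^ 4) \<le> K / t ^ 4"
    using transmission_cgo_bound[OF \<theta>(1-3) h S bd op fin k \<zeta>(1,4,2,3) sv sw lw lv nv nw LF] by blast
  have subS: "?S R \<subseteq> \<Omega>" "?S R \<subseteq> ?S h" "ball 0 R \<inter> \<Omega> = ?S R" if "R \<le> h" for R
    by (rule sector_subset(2)[OF S that], rule sector_subset(3)[OF S that], rule sector_subset(1)[OF S that])

  \<comment> \<open>The value at the vertex as the limit of the Herglotz values\<close>
  obtain f L where f: "AE x in lebesgue. x \<in> ?S h \<longrightarrow> f x = ?F x"
    and L: "\<And>x y. x \<in> closure (?S h) \<Longrightarrow> y \<in> closure (?S h) \<Longrightarrow> norm (f x - f y) \<le> L * dist x y powr \<alpha>"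
    using hol unfolding holder_closure_def by blast
  \<comment> \<open>The product \<open>(1 + V x) * w x\<close> is determined only up to null sets,
    so its value at the vertex is that of the Hoelder representative \<open>f\<close>. The maximum
    guards against a negative constant \<open>L\<close>.\<close>
  define c0 A where "c0 = f 0" and "A = max 0 L"
  have A: "0 \<le> A" by (simp add: A_def)
  \<comment> \<open>The vertex is not in the sector; the Hoelder bound reaches it because it lies in
    the closure.\<close>
  have "0 \<in> ball 0 h \<inter> closure \<Omega>" using zero h by (simp add: frontier_def)
  then have "0 \<in> closure (?S h)" using open_Int_closure_subset[OF open_ball, of 0 h \<Omega>] S by (auto simp: Int_commute)
  then have f\<alpha>: "norm (f x - c0) \<le> A * norm x powr \<alpha>" if "x \<in> ?S h" for x
    using L[of x 0] that closure_subset[of "?S h"] mult_right_mono[of L A "norm x powr \<alpha>"] by (auto simp: c0_def A_def)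
  have F\<alpha>: "AE x in lebesgue. x \<in> ?S h \<longrightarrow> norm (?F x - c0) \<le> A * norm x powr \<alpha>"
    using f by (rule eventually_mono) (use f\<alpha> in metis)
  define W where "W j = herglotz k (g j)" for j
  define B where "B = k * sqrt (2 * pi) * C"
  have B: "0 \<le> B" using k assms(17) by (simp add: B_def)
  have Wc: "continuous_on UNIV (W j)" if "1 \<le> j" for j
    unfolding W_def using k by (intro herglotz_continuous gL that) auto
  have WL: "norm (W j x - W j 0) \<le> B * real j powr \<rho>v * norm x" if j: "1 \<le> j" for j x
  proof -
    have "norm (W j x - W j 0) \<le> k * sqrt (2 * pi) * L2_norm_on circle_measure (sphere 0 1) (g j) * norm (x - 0)"
      unfolding W_def using k by (intro herglotz_lipschitz gL j) auto
    also have "\<dots> \<le> k * sqrt (2 * pi) * (C * real j powr \<rho>v) * norm (x - 0)"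
      using k by (intro mult_right_mono mult_left_mono gN j) auto
    finally show ?thesis by (simp add: B_def mult_ac)
  qed
  have vW: "L2_norm_on lebesgue (?S h) (\<lambda>x. v x - W j x) \<le> real j powr (- 2 - \<Upsilon>)" if j: "1 \<le> j" for j
    using order_trans[OF H1_norm_ge(1) gH[OF j]] by (simp add: W_def)
  have LvS: "L2_on lebesgue (?S h) v" and LFS: "L2_on lebesgue (?S h) ?F"
    by (rule L2_on_subset[OF Lv mS subS(1)], simp, rule L2_on_subset[OF LF mS subS(1)], simp)
  have W0: "(\<lambda>j. W j 0) \<longlonglongrightarrow> c0"
    by (rule herglotz_value_limit[OF \<theta> h LFS LvS \<alpha> A F\<alpha> Wc WL B _ vW \<Upsilon> K]) (use \<rho>v \<alpha> in auto)

  \<comment> \<open>Averages over small sectors\<close>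
  define J where "J R = nat \<lceil>1 / R\<rceil>" for R :: real
  \<comment> \<open>Chosen so that the sector of radius \<open>R\<close> has area
    \<open>(R * d)\<^sup>2\<close>; Cauchy-Schwarz then gives the factor
    \<open>R * d\<close>.\<close>
  define d where "d = sqrt ((\<theta>M - \<theta>m) / 2)"
  have d: "0 < d" using \<theta> by (simp add: d_def)
  define N where "N i R = L2_norm_on lebesgue (?S R) (D i)" for i R
  \<comment> \<open>One term for each error after division by the area: Hoelder modulus, Herglotz
    approximation, Lipschitz bound, distance of the Herglotz value from \<open>c0\<close>, and the
    Poincare estimate of \<open>v - w\<close>.\<close>
  define b where "b R = A * R powr \<alpha> + real (J R) powr (- \<Upsilon> - 1) / d + B * (1 + h) * real (J R) powr (\<rho>v - 1)
      + norm (c0 - W (J R) 0) + (\<theta>M - \<theta>m) / d * (N 1 R + N 2 R)" for R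
  have est: "norm ((LINT x:ball 0 R \<inter> \<Omega>|lebesgue. V x * w x) / complex_of_real (measure lebesgue (ball 0 R \<inter> \<Omega>))) \<le> b R"
    if R: "0 < R" "R < h" for R
  proof -
    have Rh: "R \<le> h" using R by simp
    let ?m = "measure lebesgue (?S R)" and ?j = "J R"
    have m: "?m = (R * d)\<^sup>2" using sector_area[OF \<theta>(1-3) R(1)] \<theta> by (simp add: d_def power_mult_distrib)
    have m0: "0 < ?m" using R d by (simp add: m)
    have fS: "emeasure lebesgue (?S R) < \<infinity>" by (intro bounded_emeasure_lebesgue bounded_S_sector mS)
    \<comment> \<open>With \<open>j = \<lceil>1 / R\<rceil>\<close> the product \<open>j * R\<close>
      stays between 1 and \<open>1 + h\<close>, so a factor \<open>1 / R\<close> or \<open>R\<close>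
      in the errors can be traded for a power of \<open>j\<close>.\<close>
    have j1: "1 / R \<le> real ?j" "real ?j \<le> 1 / R + 1"
      using R by (simp_all add: J_def of_nat_nat)
    have j: "1 \<le> ?j"
      using j1(1) R by (metis One_nat_def Suc_leI divide_pos_pos less_le_trans of_nat_0_less_iff zero_less_one)
    note sub = L2_on_subset[OF _ mS subS(1)[OF Rh]]
    have LW: "L2_on lebesgue (?S R) (W ?j)" by (rule continuous_L2_on[OF Wc[OF j] bounded_S_sector mS])
    have Lc: "L2_on lebesgue (?S R) (\<lambda>x. a)" for a :: complex by (rule continuous_L2_on[OF continuous_on_const bounded_S_sector mS])
    note int = L2_on_integrable(1)[OF _ mS fS]
    have i1: "set_integrable lebesgue (?S R) (\<lambda>x. ?F x - c0)"
      and i2: "set_integrable lebesgue (?S R) (\<lambda>x. v x - W ?j x)"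
      and i3: "set_integrable lebesgue (?S R) (\<lambda>x. W ?j x - W ?j 0)"
      and i4: "set_integrable lebesgue (?S R) (\<lambda>x. v x - w x)"
      and i5: "set_integrable lebesgue (?S R) (\<lambda>x. c0 - W ?j 0)"
      by (intro int L2_on_diff sub LF Lv Lw LW Lc)+
    \<comment> \<open>This is \<open>V w = q w - v + (v - w)\<close>, with \<open>q w\<close>
      compared to \<open>c0\<close> and \<open>v\<close>, through the Herglotz wave, to its value at
      the vertex.\<close>
    have "(LINT x:?S R|lebesgue. V x * w x)
        = (LINT x:?S R|lebesgue. (?F x - c0) - (v x - W ?j x) - (W ?j x - W ?j 0) + (v x - w x) + (c0 - W ?j 0))"
      by (intro arg_cong[where f = "set_lebesgue_integral lebesgue (?S R)"] ext) (simp add: algebra_simps)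
    also have "\<dots> = (LINT x:?S R|lebesgue. ?F x - c0) - (LINT x:?S R|lebesgue. v x - W ?j x) - (LINT x:?S R|lebesgue. W ?j x - W ?j 0)
        + (LINT x:?S R|lebesgue. v x - w x) + (LINT x:?S R|lebesgue. c0 - W ?j 0)"
      using i1 i2 i3 i4 i5 by (simp only: set_integral_add set_integral_diff)
    finally have eq: "(LINT x:?S R|lebesgue. V x * w x) = \<dots>" .
    have n1: "norm (LINT x:?S R|lebesgue. ?F x - c0) \<le> A * R powr \<alpha> * ?m"
    proof -
      have "norm (LINT x:?S R|lebesgue. ?F x - c0) \<le> (LINT x:?S R|lebesgue. norm (?F x - c0))"
        by (rule set_integral_norm_bound[OF i1])
      also have "\<dots> \<le> (LINT x:?S R|lebesgue. A * R powr \<alpha>)"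
      proof (rule set_integral_mono_AE)
        show "AE x\<in>?S R in lebesgue. norm (?F x - c0) \<le> A * R powr \<alpha>" using F\<alpha>
        proof (rule eventually_mono, intro impI)
          fix x assume *: "x \<in> ?S h \<longrightarrow> norm (?F x - c0) \<le> A * norm x powr \<alpha>" and x: "x \<in> ?S R"
          have "norm x powr \<alpha> \<le> R powr \<alpha>" using x \<alpha> by (intro powr_mono2) (auto simp: S_sector_altdef)
          then show "norm (?F x - c0) \<le> A * R powr \<alpha>"
            using * x subS(2)[OF Rh] A mult_left_mono[of "norm x powr \<alpha>" "R powr \<alpha>" A] by force
        qed
        show "set_integrable lebesgue (?S R) (\<lambda>x. A * R powr \<alpha>)"
          by (intro set_integrable_continuous continuous_on_const bounded_S_sector mS)
      qed (intro set_integrable_norm i1)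
      also have "\<dots> = A * R powr \<alpha> * ?m" using fS mS by (subst set_integral_const) auto
      finally show ?thesis .
    qed
    have n2: "norm (LINT x:?S R|lebesgue. v x - W ?j x) \<le> (R * d) * real ?j powr (- 2 - \<Upsilon>)"
    proof -
      have "norm (LINT x:?S R|lebesgue. v x - W ?j x) \<le> (LINT x:?S R|lebesgue. norm (v x - W ?j x))"
        by (rule set_integral_norm_bound[OF i2])
      also have "\<dots> \<le> sqrt ?m * L2_norm_on lebesgue (?S R) (\<lambda>x. v x - W ?j x)"
        by (intro L2_on_integrable(2) L2_on_diff sub Lv LW mS fS)
      also have "\<dots> \<le> (R * d) * real ?j powr (- 2 - \<Upsilon>)"
      proof (intro mult_mono)
        show "sqrt ?m \<le> R * d" using R d by (simp add: m)
        have "L2_on lebesgue (?S h) (\<lambda>x. v x - W ?j x)"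
          by (intro L2_on_diff LvS continuous_L2_on[OF Wc[OF j] bounded_S_sector mS])
        from L2_norm_on_mono_set[OF this mS subS(2)[OF Rh]] vW[OF j]
        show "L2_norm_on lebesgue (?S R) (\<lambda>x. v x - W ?j x) \<le> real ?j powr (- 2 - \<Upsilon>)" by linarith
      qed (use R d L2_norm_on_nonneg in auto)
      finally show ?thesis .
    qed
    have n3: "norm (LINT x:?S R|lebesgue. W ?j x - W ?j 0) \<le> B * real ?j powr \<rho>v * R * ?m"
    proof -
      have "norm (LINT x:?S R|lebesgue. W ?j x - W ?j 0) \<le> (LINT x:?S R|lebesgue. norm (W ?j x - W ?j 0))"
        by (rule set_integral_norm_bound[OF i3])
      also have "\<dots> \<le> (LINT x:?S R|lebesgue. B * real ?j powr \<rho>v * R)"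
      proof (rule set_integral_mono)
        show "set_integrable lebesgue (?S R) (\<lambda>x. B * real ?j powr \<rho>v * R)"
          by (intro set_integrable_continuous continuous_on_const bounded_S_sector mS)
        fix x assume x: "x \<in> ?S R"
        have "B * real ?j powr \<rho>v * norm x \<le> B * real ?j powr \<rho>v * R"
          using x B by (intro mult_left_mono) (auto simp: S_sector_altdef)
        then show "norm (W ?j x - W ?j 0) \<le> B * real ?j powr \<rho>v * R" using WL[OF j, of x] by linarith
      qed (intro set_integrable_norm i3)
      also have "\<dots> = B * real ?j powr \<rho>v * R * ?m" using fS mS by (subst set_integral_const) auto
      finally show ?thesis .
    qed
    \<comment> \<open>The Poincare factor \<open>R\<close> and the Cauchy-Schwarz factor
      \<open>R * d\<close> together have the order of the area, so the decay must come from the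
      gradient norms \<open>N 1 R\<close> and \<open>N 2 R\<close>.\<close>
    have n4: "norm (LINT x:?S R|lebesgue. v x - w x) \<le> (\<theta>M - \<theta>m) * R * ((R * d) * (N 1 R + N 2 R))"
    proof -
      have finU: "\<Omega> \<in> sets lebesgue" "emeasure lebesgue \<Omega> < \<infinity>" using bd op bounded_emeasure_lebesgue[of \<Omega>] by simp_all
      have "norm (LINT x:?S R|lebesgue. v x - w x) \<le> (LINT x:?S R|lebesgue. norm (v x - w x))"
        by (rule set_integral_norm_bound[OF i4])
      also have "\<dots> \<le> (\<theta>M - \<theta>m) * R * ((LINT x:?S R|lebesgue. norm (D 1 x)) + (LINT x:?S R|lebesgue. norm (D 2 x)))"
        by (rule zero_trace_poincare[OF \<theta>(1-3) S bd op fin \<zeta>(1,4) _ \<zeta>(2) _ _ R(1) Rh])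
          (use \<zeta>(3) in \<open>auto simp: D_def[abs_def] intro!: L2_on_integrable(1) L2_on_diff Lv Lw finU LD[unfolded D_def[abs_def]]\<close>)
      also have "\<dots> \<le> (\<theta>M - \<theta>m) * R * ((R * d) * N 1 R + (R * d) * N 2 R)"
      proof (intro mult_left_mono add_mono)
        have "(LINT x:?S R|lebesgue. norm (D i x)) \<le> sqrt ?m * N i R" for i
          unfolding N_def by (intro L2_on_integrable(2) sub LD mS fS)
        then show "(LINT x:?S R|lebesgue. norm (D 1 x)) \<le> R * d * N 1 R" "(LINT x:?S R|lebesgue. norm (D 2 x)) \<le> R * d * N 2 R"
          using R d by (simp_all add: m)
      qed (use \<theta> R in auto)
      finally show ?thesis by (simp only: distrib_left)
    qed
    have n5: "norm (LINT x:?S R|lebesgue. c0 - W ?j 0) = norm (c0 - W ?j 0) * ?m"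
      using fS mS by (subst set_integral_const) auto
    have "norm (LINT x:?S R|lebesgue. V x * w x) \<le> norm (LINT x:?S R|lebesgue. ?F x - c0) + norm (LINT x:?S R|lebesgue. v x - W ?j x)
        + norm (LINT x:?S R|lebesgue. W ?j x - W ?j 0) + norm (LINT x:?S R|lebesgue. v x - w x) + norm (LINT x:?S R|lebesgue. c0 - W ?j 0)"
      unfolding eq by (intro norm_triangle_le add_mono order_trans[OF norm_triangle_ineq4] order_refl)
    also have "\<dots> \<le> A * R powr \<alpha> * ?m + (R * d) * real ?j powr (- 2 - \<Upsilon>) + B * real ?j powr \<rho>v * R * ?m
        + (\<theta>M - \<theta>m) * R * ((R * d) * (N 1 R + N 2 R)) + norm (c0 - W ?j 0) * ?m"
      using n1 n2 n3 n4 n5 by linarith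
    also have "\<dots> \<le> b R * ?m"
    proof -
      have jp: "0 < real ?j" using j by simp
      have "1 \<le> real ?j * R" using j1(1) R by (simp add: field_simps)
      \<comment> \<open>Only one factor \<open>R\<close> is at hand where the area has two;
        \<open>1 \<le> j * R\<close> supplies the other at the price of one power of
        \<open>j\<close>.\<close>
      then have "(R * d) * real ?j powr (- 2 - \<Upsilon>) \<le> (R * d) * real ?j powr (- 2 - \<Upsilon>) * (real ?j * R)"
        using mult_left_mono[of 1 "real ?j * R" "(R * d) * real ?j powr (- 2 - \<Upsilon>)"] R d by simp
      also have "\<dots> = real ?j powr (- \<Upsilon> - 1) / d * ?m"
      proof -
        have "real ?j powr (- 2 - \<Upsilon>) * real ?j = real ?j powr (- \<Upsilon> - 1)"
          using powr_add[of "real ?j" "- 2 - \<Upsilon>" 1] jp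
          by (simp add: mult.commute minus_diff_commute[of \<Upsilon> 1])
        moreover have "(R * d) * real ?j powr (- 2 - \<Upsilon>) * (real ?j * R) = (real ?j powr (- 2 - \<Upsilon>) * real ?j) / d * (R * d)\<^sup>2"
          using d by (simp add: power2_eq_square field_simps)
        ultimately show ?thesis by (simp only: m)
      qed
      finally have e2: "(R * d) * real ?j powr (- 2 - \<Upsilon>) \<le> real ?j powr (- \<Upsilon> - 1) / d * ?m" .
      have e3: "B * real ?j powr \<rho>v * R * ?m \<le> B * (1 + h) * real ?j powr (\<rho>v - 1) * ?m"
      proof (rule mult_right_mono)
        have "real ?j * R \<le> (1 / R + 1) * R" using j1(2) R by (intro mult_right_mono) auto
        then have "real ?j * R \<le> 1 + h" using R by (simp add: distrib_right)
        then have "B * real ?j powr (\<rho>v - 1) * (real ?j * R) \<le> B * real ?j powr (\<rho>v - 1) * (1 + h)"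
          using B by (intro mult_left_mono) auto
        moreover have "real ?j powr \<rho>v = real ?j powr (\<rho>v - 1) * real ?j"
          using powr_add[of "real ?j" "\<rho>v - 1" 1] jp by simp
        ultimately show "B * real ?j powr \<rho>v * R \<le> B * (1 + h) * real ?j powr (\<rho>v - 1)" by (simp only: mult_ac)
      qed (use m0 in simp)
      have e4: "(\<theta>M - \<theta>m) * R * ((R * d) * (N 1 R + N 2 R)) = (\<theta>M - \<theta>m) / d * (N 1 R + N 2 R) * ?m"
        using d by (simp add: m power2_eq_square)
      show ?thesis using e2 e3 unfolding e4 b_def distrib_right by linarith
    qed
    finally have "norm (LINT x:?S R|lebesgue. V x * w x) / ?m \<le> b R" using m0 by (simp add: divide_le_eq)
    then show ?thesis unfolding subS(3)[OF Rh] using m0 by (simp add: norm_divide)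
  qed

  \<comment> \<open>Letting the radius tend to 0\<close>
  have Jlim: "filterlim J at_top (at_right 0)"
    unfolding filterlim_at_top
  proof
    fix Z :: nat
    have "\<forall>\<^sub>F R in at_right 0. R < 1 / (real Z + 1)" "\<forall>\<^sub>F R in at_right (0::real). 0 < R"
      by (auto simp: eventually_at_right_field intro: exI[of _ "1 / (real Z + 1)"] exI[of _ 1])
    then show "\<forall>\<^sub>F R in at_right 0. Z \<le> J R"
    proof eventually_elim
      case (elim R)
      then have "real Z + 1 < 1 / R" by (simp add: field_simps)
      then have "real Z \<le> real_of_int \<lceil>1 / R\<rceil>" using le_of_int_ceiling[of "1 / R"] by linarith
      then show ?case unfolding J_def by linarith
    qed
  qed
  have pw: "((\<lambda>R. real (J R) powr a) \<longlongrightarrow> 0) (at_right 0)" if "a < 0" for a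
    by (rule tendsto_neg_powr[OF that filterlim_compose[OF filterlim_real_sequentially Jlim]])
  have "(b \<longlongrightarrow> A * 0 + 0 / d + B * (1 + h) * 0 + norm (c0 - c0) + (\<theta>M - \<theta>m) / d * (0 + 0)) (at_right 0)"
    unfolding b_def
  proof (intro tendsto_add tendsto_mult tendsto_const tendsto_divide tendsto_norm tendsto_diff pw)
    show "((\<lambda>R. R powr \<alpha>) \<longlongrightarrow> 0) (at_right 0)"
      using tendsto_zero_powrI[of "\<lambda>R. R" "at_right (0::real)" "\<lambda>_. \<alpha>" \<alpha>] \<alpha>
      by (auto intro: tendsto_ident_at eventually_at_right_less[THEN eventually_mono] less_imp_le)
    show "((\<lambda>R. W (J R) 0) \<longlongrightarrow> c0) (at_right 0)" by (rule filterlim_compose[OF W0 Jlim])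
    have "(N i \<longlongrightarrow> 0) (at_right 0)" for i
      unfolding N_def by (rule L2_norm_sector_tendsto_0[OF \<theta>(1-3) h L2_on_subset[OF LD mS subS(1)]]) simp
    then show "(N 1 \<longlongrightarrow> 0) (at_right 0)" "(N 2 \<longlongrightarrow> 0) (at_right 0)" by blast+
  qed (use d \<Upsilon> \<rho>v \<alpha> in auto)
  then have blim: "(b \<longlongrightarrow> 0) (at_right 0)" by simp
  show ?thesis
  proof (rule Lim_null_comparison[OF _ blim])
    show "\<forall>\<^sub>F R in at_right 0. norm ((LINT x:ball 0 R \<inter> \<Omega>|lebesgue. V x * w x) / complex_of_real (measure lebesgue (ball 0 R \<inter> \<Omega>))) \<le> b R"
      unfolding eventually_at_right_field using h est by (intro exI[of _ h]) auto
  qed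
qed

end
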